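(* Let $m,n\ge1$ and let $U\subseteq\{\mathbf q\in\mathbb C^m:\max_i|q_i|<1\}$ be open. Let $H(\mathbf t,\mathbf y;\mathbf q)=(H_1,\dots,H_n)$ be such that for every $\mathbf q_0\in U$, $H$ is holomorphic at $(\mathbf t,\mathbf y,\mathbf q)=(\mathbf 0,\mathbf 0,\mathbf q_0)$ with $H(\mathbf 0,\mathbf 0;\mathbf q_0)=\mathbf 0$. Suppose that for every $\mathbf q\in U$ no eigenvalue of $D(\mathbf q)=\big(\frac{\partial H_j}{\partial y_k}(\mathbf 0,\mathbf 0;\mathbf q)\big)_{j,k}$ lies in $Q_0=\{0\}\cup\{\mathbf q^\alpha:\alpha\in\mathbb N^m\setminus\{0\}\}$. Then for every $\mathbf q\in U$ the system $y_j(q_1t_1,\dots,q_mt_m;\mathbf q)=H_j(\mathbf t,\mathbf y(\mathbf t;\mathbf q);\mathbf q)$ ($1\le j\le n$) has a unique convergent power series solution $y_j(\mathbf t;\mathbf q)=\sum_{\alpha\in\mathbb N^m\setminus\{0\}}b^{(j)}_\alpha(\mathbf q)\mathbf t^\alpha$ vanishing at $\mathbf t=\mathbf 0$, and for every $\mathbf q_0\in U$ there are open neighbourhoods $Z\subseteq\mathbb C^m$ of $\mathbf 0$ and $V\subseteq U$ of $\mathbf q_0$ such that these series converge uniformly on $Z\times V$ in $(\mathbf t,\mathbf q)$, defining holomorphic functions there.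
   Context: Multi-index notation: for $\alpha\in\mathbb N^m$, $\mathbf q^\alpha=q_1^{\alpha_1}\cdots q_m^{\alpha_m}$ and $\mathbf t^\alpha=t_1^{\alpha_1}\cdots t_m^{\alpha_m}$. *)

theory Defs
  imports "HOL-Analysis.Analysis"
begin

definition mpow :: "(complex^'m::finite) \<Rightarrow> ('m \<Rightarrow> nat) \<Rightarrow> complex" where
  "mpow x \<alpha> = (\<Prod>i\<in>UNIV. (x $ i) ^ (\<alpha> i))"

definition cwmult :: "(complex^'m::finite) \<Rightarrow> (complex^'m::finite) \<Rightarrow> (complex^'m::finite)" where
  "cwmult q t = (\<chi> i. q $ i * t $ i)"

definition cmat_eigenvalue :: "(complex^'n::finite)^'n \<Rightarrow> complex \<Rightarrow> bool" where
  "cmat_eigenvalue A c \<longleftrightarrow> (\<exists>v. v \<noteq> 0 \<and> A *v v = c *s v)"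

text \<open>Holomorphy in several complex variables: complex-differentiable (Frechet derivative
  is complex linear) at every point of an open set.  Complex multiplication by i on the
  product domains is componentwise.\<close>
definition holo3_on ::
  "((complex^'a::finite) \<times> (complex^'b::finite) \<times> (complex^'c::finite) \<Rightarrow> (complex^'d::finite)) \<Rightarrow>
   ((complex^'a::finite) \<times> (complex^'b::finite) \<times> (complex^'c::finite)) set \<Rightarrow> bool" where
  "holo3_on f S \<longleftrightarrow> open S \<and> (\<forall>z\<in>S. \<exists>L. (f has_derivative L) (at z) \<and>
      (\<forall>u v w. L (\<i> *s u, \<i> *s v, \<i> *s w) = \<i> *s L (u, v, w)))"

definition holo2_on ::
  "((complex^'a::finite) \<times> (complex^'b::finite) \<Rightarrow> (complex^'d::finite)) \<Rightarrow> ((complex^'a::finite) \<times> (complex^'b::finite)) set \<Rightarrow> bool" where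
  "holo2_on f S \<longleftrightarrow> open S \<and> (\<forall>z\<in>S. \<exists>L. (f has_derivative L) (at z) \<and>
      (\<forall>u v. L (\<i> *s u, \<i> *s v) = \<i> *s L (u, v)))"

definition holo3_at ::
  "((complex^'a::finite) \<times> (complex^'b::finite) \<times> (complex^'c::finite) \<Rightarrow> (complex^'d::finite)) \<Rightarrow>
   ((complex^'a::finite) \<times> (complex^'b::finite) \<times> (complex^'c::finite)) \<Rightarrow> bool" where
  "holo3_at f x \<longleftrightarrow> (\<exists>S. x \<in> S \<and> holo3_on f S)"

definition jac_y :: "((complex^'m::finite) \<Rightarrow> (complex^'n::finite) \<Rightarrow> (complex^'m::finite) \<Rightarrow> (complex^'n::finite)) \<Rightarrow>
    (complex^'m::finite) \<Rightarrow> (complex^'n::finite)^'n" where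
  "jac_y H q = (\<chi> j k. deriv (\<lambda>z. H 0 (z *s axis k 1) q $ j) 0)"

definition pseries :: "('n \<Rightarrow> ('m \<Rightarrow> nat) \<Rightarrow> complex) \<Rightarrow> (complex^'m::finite) \<Rightarrow> (complex^'n::finite)" where
  "pseries b t = (\<chi> j. infsum (\<lambda>\<alpha>. b j \<alpha> * mpow t \<alpha>) UNIV)"

definition is_solution ::
  "((complex^'m::finite) \<Rightarrow> (complex^'n::finite) \<Rightarrow> (complex^'m::finite) \<Rightarrow> (complex^'n::finite)) \<Rightarrow> (complex^'m::finite) \<Rightarrow>
   ('n \<Rightarrow> ('m \<Rightarrow> nat) \<Rightarrow> complex) \<Rightarrow> bool" where
  "is_solution H q b \<longleftrightarrow>
     (\<forall>j. b j (\<lambda>_. 0) = 0) \<and>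
     (\<forall>\<^sub>F t in nhds 0. \<forall>j. (\<lambda>\<alpha>. b j \<alpha> * mpow t \<alpha>) summable_on UNIV) \<and>
     (\<forall>\<^sub>F t in nhds 0. pseries b (cwmult q t) = H t (pseries b t) q)"

end

theory Submission
  imports Defs "HOL-Complex_Analysis.Complex_Analysis"
begin

text \<open>Split \<open>H (t, y, q) = D(q) y + R (t, y, q)\<close> and let \<open>L y = y (q t, q) - D(q) y (t, q)\<close>, so that
  the equation reads \<open>L y = R (t, y, q)\<close>. On power series in \<open>t\<close>, \<open>L\<close> multiplies the coefficient of
  \<open>t\<^sup>\<alpha>\<close> by \<open>q\<^sup>\<alpha> - D(q)\<close>. Since \<open>q\<^sup>\<alpha>\<close> tends to \<open>0\<close>, nonresonance bounds the inverses of these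
  matrices uniformly in \<open>\<alpha>\<close> and locally uniformly in \<open>q\<close>, and \<open>L\<close> is invertible on bounded holomorphic
  functions vanishing at \<open>t = 0\<close>, with a bound that does not depend on the radius of the polydisc.
  As \<open>R\<close> has a small Lipschitz constant in \<open>y\<close> near the origin, Picard iteration converges uniformly
  in \<open>(t, q)\<close>, and the limit is holomorphic. For uniqueness, the lowest order part of the
  difference of two solutions lies in the kernel of \<open>L\<close>.\<close>

text \<open>The order of choices is the obstacle. The Lipschitz constant of \<open>R\<close> becomes
  small only after the polydisc in \<open>t\<close> and the neighbourhood of \<open>q0\<close> have
  been shrunk, while the inverse of \<open>L\<close> dictates how small it must be; a bound on that
  inverse that grew as the radius shrinks could defeat the contraction. Bounds on single
  coefficients do not suffice either: summing the majorants
  \<open>K / r ^ mdegree \<alpha> * cmod (mpow t \<alpha>)\<close> gives no bound that is uniform up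
  to the boundary of the polydisc. The remedy is that \<open>q\<close> contracts:
  \<open>y (q t, q)\<close> is controlled on the full polydisc, and invertibility of
  \<open>D(q)\<close>, that is, the exclusion of the eigenvalue 0, carries the bound over to
  \<open>y\<close>. The same exclusion rules out small denominators, 0 being the limit of the
  \<open>q\<^sup>\<alpha>\<close>. Complex analysis in several variables is reduced to one variable
  by restricting to complex lines or to single coordinates, with everything else kept as a
  holomorphic parameter.\<close>

no_notation fps_nth (infixl "$" 75)

section \<open>Holomorphic maps between complex normed spaces\<close>

text \<open>One notion of holomorphy has to serve \<open>complex\<close>, vectors over it and nested
  pairs of these. The class supplies the complex multiplication under which derivatives are to be
  homogeneous, and \<open>scaleC_of_real\<close> ties it to the real structure on which
  \<open>has_derivative\<close> rests.\<close>

class complex_normed = real_normed_vector +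
  fixes scaleC :: "complex \<Rightarrow> 'a \<Rightarrow> 'a"  (infixr "*\<^sub>C" 75)
  assumes scaleC_add_right: "c *\<^sub>C (x + y) = c *\<^sub>C x + c *\<^sub>C y"
    and scaleC_add_left: "(c + d) *\<^sub>C x = c *\<^sub>C x + d *\<^sub>C x"
    and scaleC_scaleC: "c *\<^sub>C d *\<^sub>C x = (c * d) *\<^sub>C x"
    and scaleC_of_real: "complex_of_real r *\<^sub>C x = r *\<^sub>R x"
    and norm_scaleC: "norm (c *\<^sub>C x) = cmod c * norm x"

instantiation complex :: complex_normed
begin
definition scaleC_complex :: "complex \<Rightarrow> complex \<Rightarrow> complex" where
  "scaleC_complex c x = c * x"
instance
  by standard (auto simp: scaleC_complex_def algebra_simps norm_mult scaleR_conv_of_real)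
end

instantiation prod :: (complex_normed, complex_normed) complex_normed
begin
definition scaleC_prod :: "complex \<Rightarrow> 'a \<times> 'b \<Rightarrow> 'a \<times> 'b" where
  "scaleC_prod c x = (c *\<^sub>C fst x, c *\<^sub>C snd x)"
instance
proof
  fix c :: complex and x :: "'a \<times> 'b"
  show "norm (c *\<^sub>C x) = cmod c * norm x"
    by (simp add: scaleC_prod_def norm_prod_def norm_scaleC power_mult_distrib
        distrib_left[symmetric] real_sqrt_mult)
qed (auto simp: scaleC_prod_def scaleC_add_left scaleC_add_right scaleC_scaleC scaleC_of_real
       scaleR_prod_def)
end

instantiation vec :: (complex_normed, finite) complex_normed
begin
definition scaleC_vec :: "complex \<Rightarrow> 'a ^ 'b \<Rightarrow> 'a ^ 'b" where
  "scaleC_vec c x = (\<chi> i. c *\<^sub>C (x $ i))"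
instance
proof
  fix c :: complex and x :: "'a ^ 'b"
  show "norm (c *\<^sub>C x) = cmod c * norm x"
    by (simp add: scaleC_vec_def norm_vec_def norm_scaleC L2_set_right_distrib)
qed (auto simp: scaleC_vec_def vec_eq_iff scaleC_add_left scaleC_add_right scaleC_scaleC
       scaleC_of_real)
end

lemma scaleC_vec_complex: "c *\<^sub>C (x :: complex ^ 'n) = c *s x"
  by (simp add: scaleC_vec_def scaleC_complex_def vec_eq_iff)

lemma scaleC_zero_left [simp]: "0 *\<^sub>C x = (0 :: 'a :: complex_normed)"
  using scaleC_of_real[of 0 x] by simp

lemma scaleC_zero_right [simp]: "c *\<^sub>C 0 = (0 :: 'a :: complex_normed)"
  using scaleC_add_right[of c 0 0] by simp

lemma scaleC_minus_right: "c *\<^sub>C (- x) = - (c *\<^sub>C (x :: 'a :: complex_normed))"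
  using scaleC_add_right[of c x "- x"] by (simp add: eq_neg_iff_add_eq_0 add.commute)

lemma scaleC_diff_right: "c *\<^sub>C (x - y) = c *\<^sub>C x - c *\<^sub>C (y :: 'a :: complex_normed)"
  using scaleC_add_right[of c x "- y"] by (simp add: scaleC_minus_right)

lemma bounded_linear_scaleC_left: "bounded_linear (\<lambda>c. c *\<^sub>C (u :: 'a :: complex_normed))"
proof (rule bounded_linear_intro[where K = "norm u"])
  show "(r *\<^sub>R c) *\<^sub>C u = r *\<^sub>R c *\<^sub>C u" for r c
    by (simp add: scaleR_conv_of_real scaleC_scaleC[symmetric] scaleC_of_real)
qed (auto simp: scaleC_add_left norm_scaleC)

text \<open>Additivity of \<open>L\<close> is already part of \<open>has_derivative\<close>, so
  complex linearity comes down to homogeneity. Openness is built in so that every point has a ball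
  on which Cauchy estimates can be applied.\<close>

definition holo_on :: "('a::complex_normed \<Rightarrow> 'b::complex_normed) \<Rightarrow> 'a set \<Rightarrow> bool" where
  "holo_on f S \<longleftrightarrow> open S \<and>
     (\<forall>z\<in>S. \<exists>L. (f has_derivative L) (at z) \<and> (\<forall>c u. L (c *\<^sub>C u) = c *\<^sub>C L u))"

lemma holo_on_openD: "holo_on f S \<Longrightarrow> open S"
  by (simp add: holo_on_def)

lemma holo_onE:
  assumes "holo_on f S" "z \<in> S"
  obtains L where "(f has_derivative L) (at z)" "\<And>c u. L (c *\<^sub>C u) = c *\<^sub>C L u"
  using assms unfolding holo_on_def by blast

lemma holo_on_subset: "holo_on f S \<Longrightarrow> open T \<Longrightarrow> T \<subseteq> S \<Longrightarrow> holo_on f T"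
  unfolding holo_on_def by blast

text \<open>Serves where an estimate is available only near each point: on a slightly smaller
  polydisc, or on a ball where the function is bounded.\<close>

lemma holo_on_locally:
  assumes "\<And>z. z \<in> S \<Longrightarrow> \<exists>T. z \<in> T \<and> T \<subseteq> S \<and> holo_on f T"
  shows "holo_on f S"
  unfolding holo_on_def
proof
  show "open S"
  proof (subst open_subopen, intro ballI)
    show "\<exists>T. open T \<and> z \<in> T \<and> T \<subseteq> S" if "z \<in> S" for z
      using assms[OF that] holo_on_openD by blast
  qed
  show "\<forall>z\<in>S. \<exists>L. (f has_derivative L) (at z) \<and> (\<forall>c u. L (c *\<^sub>C u) = c *\<^sub>C L u)"
    using assms unfolding holo_on_def by blast
qed

lemma holo_on_cong:
  assumes "\<And>z. z \<in> S \<Longrightarrow> f z = g z"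
  shows "holo_on f S \<longleftrightarrow> holo_on g S"
proof -
  have "holo_on b S" if "holo_on a S" "\<And>z. z \<in> S \<Longrightarrow> a z = b z" for a b :: "'a \<Rightarrow> 'b"
    unfolding holo_on_def
  proof (intro conjI ballI)
    fix z assume z: "z \<in> S"
    obtain L where L: "(a has_derivative L) (at z)" "\<And>c u. L (c *\<^sub>C u) = c *\<^sub>C L u"
      using holo_onE[OF \<open>holo_on a S\<close> z] by blast
    have "(b has_derivative L) (at z)"
      using has_derivative_transform_within_open[OF L(1) holo_on_openD[OF \<open>holo_on a S\<close>] z] that(2)
      by blast
    with L(2) show "\<exists>L. (b has_derivative L) (at z) \<and> (\<forall>c u. L (c *\<^sub>C u) = c *\<^sub>C L u)"
      by blast
  qed (use that(1) holo_on_openD in blast)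
  then show ?thesis
    using assms by metis
qed

section \<open>Closure properties of holomorphic maps\<close>

lemma holo_on_imp_continuous_on: "holo_on f S \<Longrightarrow> continuous_on S f"
  unfolding holo_on_def
  by (meson continuous_at_imp_continuous_on has_derivative_continuous)

lemma holo_on_compose:
  assumes f: "holo_on f S" and g: "holo_on g T" and sub: "f ` S \<subseteq> T"
  shows "holo_on (\<lambda>z. g (f z)) S"
  unfolding holo_on_def
proof (intro conjI ballI)
  fix z assume z: "z \<in> S"
  obtain L where L: "(f has_derivative L) (at z)" "\<And>c u. L (c *\<^sub>C u) = c *\<^sub>C L u"
    using holo_onE[OF f z] by blast
  obtain K where K: "(g has_derivative K) (at (f z))" "\<And>c u. K (c *\<^sub>C u) = c *\<^sub>C K u"
    using holo_onE[OF g] sub z by blast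
  show "\<exists>L. ((\<lambda>z. g (f z)) has_derivative L) (at z) \<and> (\<forall>c u. L (c *\<^sub>C u) = c *\<^sub>C L u)"
    using has_derivative_compose[OF L(1) K(1)] L(2) K(2)
    by (intro exI[of _ "\<lambda>x. K (L x)"]) auto
qed (use f holo_on_openD in blast)

lemma holo_on_linear:
  assumes "bounded_linear L" "\<And>c u. L (c *\<^sub>C u) = c *\<^sub>C L u" "open S"
  shows "holo_on L S"
  unfolding holo_on_def
  using assms bounded_linear_imp_has_derivative by blast

lemma holo_on_const: "open S \<Longrightarrow> holo_on (\<lambda>z. c) S"
  unfolding holo_on_def by (intro conjI ballI exI[of _ "\<lambda>_. 0"]) auto

lemma holo_on_id: "open S \<Longrightarrow> holo_on (\<lambda>z. z) S"
  by (rule holo_on_linear) (auto intro: bounded_linear_ident)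

lemma holo_on_fst: "open S \<Longrightarrow> holo_on fst S"
  by (rule holo_on_linear) (auto intro: bounded_linear_fst simp: scaleC_prod_def)

lemma holo_on_snd: "open S \<Longrightarrow> holo_on snd S"
  by (rule holo_on_linear) (auto intro: bounded_linear_snd simp: scaleC_prod_def)

lemma holo_on_Pair:
  assumes f: "holo_on f S" and g: "holo_on g S"
  shows "holo_on (\<lambda>z. (f z, g z)) S"
  unfolding holo_on_def
proof (intro conjI ballI)
  fix z assume z: "z \<in> S"
  obtain L where L: "(f has_derivative L) (at z)" "\<And>c u. L (c *\<^sub>C u) = c *\<^sub>C L u"
    using holo_onE[OF f z] by blast
  obtain K where K: "(g has_derivative K) (at z)" "\<And>c u. K (c *\<^sub>C u) = c *\<^sub>C K u"
    using holo_onE[OF g z] by blast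
  show "\<exists>L. ((\<lambda>z. (f z, g z)) has_derivative L) (at z) \<and> (\<forall>c u. L (c *\<^sub>C u) = c *\<^sub>C L u)"
    using has_derivative_Pair[OF L(1) K(1)] L(2) K(2)
    by (intro exI[of _ "\<lambda>x. (L x, K x)"]) (auto simp: scaleC_prod_def)
qed (use f holo_on_openD in blast)

lemma holo_on_add:
  assumes f: "holo_on f S" and g: "holo_on g S"
  shows "holo_on (\<lambda>z. f z + g z) S"
proof -
  have "holo_on (\<lambda>p::'b \<times> 'b. fst p + snd p) UNIV"
    by (intro holo_on_linear bounded_linear_add bounded_linear_fst bounded_linear_snd)
       (auto simp: scaleC_prod_def scaleC_add_right)
  from holo_on_compose[OF holo_on_Pair[OF f g] this] show ?thesis by simp
qed

lemma holo_on_diff: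
  assumes f: "holo_on f S" and g: "holo_on g S"
  shows "holo_on (\<lambda>z. f z - g z) S"
proof -
  have "holo_on (\<lambda>p::'b \<times> 'b. fst p - snd p) UNIV"
    by (intro holo_on_linear bounded_linear_sub bounded_linear_fst bounded_linear_snd)
       (auto simp: scaleC_prod_def scaleC_diff_right)
  from holo_on_compose[OF holo_on_Pair[OF f g] this] show ?thesis by simp
qed

lemma holo_on_sum:
  assumes "\<And>i. i \<in> I \<Longrightarrow> holo_on (f i) S" "open S"
  shows "holo_on (\<lambda>z. \<Sum>i\<in>I. f i z) S"
  using assms by (induction I rule: infinite_finite_induct) (auto intro: holo_on_const holo_on_add)

lemma holo_on_mult:
  fixes f g :: "'a::complex_normed \<Rightarrow> complex"
  assumes f: "holo_on f S" and g: "holo_on g S"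
  shows "holo_on (\<lambda>z. f z * g z) S"
  unfolding holo_on_def
proof (intro conjI ballI)
  fix z assume z: "z \<in> S"
  obtain L where L: "(f has_derivative L) (at z)" "\<And>c u. L (c *\<^sub>C u) = c *\<^sub>C L u"
    using holo_onE[OF f z] by blast
  obtain K where K: "(g has_derivative K) (at z)" "\<And>c u. K (c *\<^sub>C u) = c *\<^sub>C K u"
    using holo_onE[OF g z] by blast
  show "\<exists>L. ((\<lambda>z. f z * g z) has_derivative L) (at z) \<and> (\<forall>c u. L (c *\<^sub>C u) = c *\<^sub>C L u)"
    using has_derivative_mult[OF L(1) K(1)] L(2) K(2)
    by (intro exI[of _ "\<lambda>x. f z * K x + L x * g z"]) (auto simp: scaleC_complex_def algebra_simps)
qed (use f holo_on_openD in blast)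

lemma holo_on_prod:
  fixes f :: "'i \<Rightarrow> 'a::complex_normed \<Rightarrow> complex"
  assumes "\<And>i. i \<in> I \<Longrightarrow> holo_on (f i) S" "open S"
  shows "holo_on (\<lambda>z. \<Prod>i\<in>I. f i z) S"
  using assms by (induction I rule: infinite_finite_induct) (auto intro: holo_on_const holo_on_mult)

lemma holo_on_power:
  fixes f :: "'a::complex_normed \<Rightarrow> complex"
  assumes "holo_on f S"
  shows "holo_on (\<lambda>z. f z ^ n) S"
  using holo_on_prod[of "{..<n}" "\<lambda>_. f" S] holo_on_openD[OF assms] assms by simp

lemma holo_on_complex_iff:
  fixes f :: "complex \<Rightarrow> complex"
  assumes "open S"
  shows "holo_on f S \<longleftrightarrow> f holomorphic_on S"
proof
  assume f: "holo_on f S"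
  show "f holomorphic_on S"
    unfolding holomorphic_on_open[OF assms]
  proof
    fix z assume z: "z \<in> S"
    obtain L where L: "(f has_derivative L) (at z)" "\<And>c u. L (c *\<^sub>C u) = c *\<^sub>C L u"
      using holo_onE[OF f z] by blast
    have "L u = L 1 * u" for u
      using L(2)[of u 1] by (metis scaleC_complex_def mult.commute mult.right_neutral)
    then have "L = (\<lambda>u. L 1 * u)" ..
    with L(1) show "\<exists>f'. (f has_field_derivative f') (at z)"
      unfolding has_field_derivative_def by metis
  qed
next
  assume f: "f holomorphic_on S"
  show "holo_on f S"
    unfolding holo_on_def
  proof (intro conjI ballI)
    fix z assume "z \<in> S"
    then obtain D where "(f has_field_derivative D) (at z)"
      using f holomorphic_on_open[OF assms] by blast
    then show "\<exists>L. (f has_derivative L) (at z) \<and> (\<forall>c u. L (c *\<^sub>C u) = c *\<^sub>C L u)"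
      unfolding has_field_derivative_def
      by (intro exI[of _ "\<lambda>u. D * u"]) (auto simp: scaleC_complex_def)
  qed (rule assms)
qed

lemma holo_on_divide:
  fixes f g :: "'a::complex_normed \<Rightarrow> complex"
  assumes f: "holo_on f S" and g: "holo_on g S" and nz: "\<And>z. z \<in> S \<Longrightarrow> g z \<noteq> 0"
  shows "holo_on (\<lambda>z. f z / g z) S"
proof -
  have "holo_on (inverse :: complex \<Rightarrow> complex) (- {0})"
    by (subst holo_on_complex_iff) (auto intro!: holomorphic_intros)
  from holo_on_compose[OF g this] have "holo_on (\<lambda>z. inverse (g z)) S"
    using nz by fastforce
  from holo_on_mult[OF f this] show ?thesis
    by (simp add: divide_inverse)
qed

lemma holo_on_vec_nth:
  fixes f :: "'a::complex_normed \<Rightarrow> complex ^ 'n"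
  assumes "holo_on f S"
  shows "holo_on (\<lambda>z. f z $ j) S"
proof -
  have "holo_on (\<lambda>v :: complex ^ 'n. v $ j) UNIV"
    by (intro holo_on_linear bounded_linear_vec_nth) (auto simp: scaleC_vec_def)
  from holo_on_compose[OF assms this] show ?thesis by simp
qed

text \<open>A vector is the sum of its coordinates placed on the axes, so scalar functions are
  enough; the theorems on uniform limits and Taylor expansions are therefore stated for values in
  \<open>complex\<close> only.\<close>

lemma holo_on_vec:
  fixes f :: "'a::complex_normed \<Rightarrow> complex ^ 'n"
  assumes "\<And>j. holo_on (\<lambda>z. f z $ j) S"
  shows "holo_on f S"
proof -
  have S: "open S" using assms holo_on_openD by blast
  have lin: "holo_on (\<lambda>c. axis j c :: complex ^ 'n) UNIV" for j
  proof (intro holo_on_linear bounded_linear_intro[where K = 1])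
    show "norm (axis j x :: complex ^ 'n) \<le> norm x * 1" for x
      by (simp add: norm_vec_def axis_def L2_set_def if_distrib[of norm] if_distrib[of "\<lambda>x. x\<^sup>2"]
          cong: if_cong)
  qed (auto simp: vec_eq_iff axis_def scaleC_vec_def scaleC_complex_def)
  have "holo_on (\<lambda>z. \<Sum>j\<in>UNIV. axis j (f z $ j) :: complex ^ 'n) S"
    by (intro holo_on_sum S holo_on_compose[OF assms lin]) auto
  moreover have "(\<Sum>j\<in>UNIV. axis j (v $ j)) = v" for v :: "complex ^ 'n"
    by (simp add: vec_eq_iff axis_def if_distrib cong: if_cong)
  ultimately show ?thesis by simp
qed

section \<open>Restriction to complex lines and Cauchy estimates\<close>

lemma holo_on_line:
  fixes f :: "'a::complex_normed \<Rightarrow> complex"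
  assumes "holo_on f S" "open T" "\<And>s. s \<in> T \<Longrightarrow> z + s *\<^sub>C u \<in> S"
  shows "(\<lambda>s. f (z + s *\<^sub>C u)) holomorphic_on T"
proof -
  have "holo_on (\<lambda>s. s *\<^sub>C u) T"
    using assms(2) by (intro holo_on_linear bounded_linear_scaleC_left)
                      (auto simp: scaleC_complex_def scaleC_scaleC)
  then have "holo_on (\<lambda>s. z + s *\<^sub>C u) T"
    by (intro holo_on_add holo_on_const assms(2))
  from holo_on_compose[OF this assms(1)] assms(2,3) show ?thesis
    by (auto simp: holo_on_complex_iff)
qed

lemma deriv_line:
  fixes f :: "'a::complex_normed \<Rightarrow> complex"
  assumes L: "(f has_derivative L) (at z)" "\<And>c u. L (c *\<^sub>C u) = c *\<^sub>C L u"
  shows "((\<lambda>s. f (z + s *\<^sub>C u)) has_field_derivative L u) (at 0)"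
proof -
  have "((\<lambda>s. z + s *\<^sub>C u) has_derivative (\<lambda>s. s *\<^sub>C u)) (at 0)"
    using bounded_linear_imp_has_derivative[OF bounded_linear_scaleC_left, of u "at 0"]
    by (auto intro!: derivative_eq_intros)
  from has_derivative_compose[OF this] L(1)
  have "((\<lambda>s. f (z + s *\<^sub>C u)) has_derivative (\<lambda>s. L (s *\<^sub>C u))) (at 0)"
    by simp
  then show ?thesis
    by (simp add: has_field_derivative_def L(2) scaleC_complex_def mult_commute_abs)
qed

text \<open>Cauchy's inequality on circles of radius \<open>s < r\<close>, followed by
  \<open>s\<close> tending to \<open>r\<close>. Retaining the full radius of the open disc lets
  later expansions keep one fixed polydisc instead of losing a little at each use.\<close>

lemma holomorphic_coeff_bound:
  assumes f: "f holomorphic_on ball 0 r" and r: "r > 0"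
    and M: "\<And>z. cmod z < r \<Longrightarrow> cmod (f z) \<le> M"
  shows "cmod ((deriv ^^ n) f 0 / fact n) \<le> M / r ^ n"
proof -
  define c where "c = cmod ((deriv ^^ n) f 0 / fact n)"
  have "c * s ^ n \<le> M" if s: "0 < s" "s < r" for s
  proof -
    have "cball 0 s \<subseteq> ball 0 r" using s by auto
    then have "cmod ((deriv ^^ n) f 0) \<le> fact n * M / s ^ n"
      using f s M
      by (intro Cauchy_inequality)
         (auto intro: holomorphic_on_subset holomorphic_on_imp_continuous_on)
    then show ?thesis
      using s by (simp add: c_def norm_divide field_simps)
  qed
  then have "\<forall>\<^sub>F s in at_left r. c * s ^ n \<le> M"
    using r eventually_at_left_real[of 0 r] by (auto elim!: eventually_mono)
  moreover have "((\<lambda>s. c * s ^ n) \<longlongrightarrow> c * r ^ n) (at_left r)"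
    by (intro tendsto_intros)
  ultimately have "c * r ^ n \<le> M"
    by (intro tendsto_upperbound[of _ _ "at_left r"]) auto
  then show ?thesis
    using r by (simp add: c_def field_simps)
qed

text \<open>The value \<open>L u\<close> is the first Taylor coefficient at 0 of \<open>f\<close>
  along the line through \<open>z\<close> in direction \<open>u\<close>. That line stays in the ball
  for parameters of modulus below \<open>r / norm u\<close>, which is where the factor
  \<open>norm u / r\<close> comes from.\<close>

lemma holo_on_derivative_bound:
  fixes f :: "'a::complex_normed \<Rightarrow> complex"
  assumes f: "holo_on f (ball z r)" and r: "r > 0"
    and M: "\<And>w. w \<in> ball z r \<Longrightarrow> cmod (f w) \<le> M"
    and L: "(f has_derivative L) (at z)" "\<And>c u. L (c *\<^sub>C u) = c *\<^sub>C L u"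
  shows "cmod (L u) \<le> M / r * norm u"
proof (cases "u = 0")
  case True
  with L(2)[of 0 u] show ?thesis by simp
next
  case False
  define s where "s = r / norm u"
  have s: "s > 0" using False r by (simp add: s_def)
  have sub: "z + c *\<^sub>C u \<in> ball z r" if "cmod c < s" for c
    using that False by (simp add: s_def dist_norm norm_scaleC field_simps)
  have "(\<lambda>c. f (z + c *\<^sub>C u)) holomorphic_on ball 0 s"
    using sub by (intro holo_on_line[OF f]) auto
  from holomorphic_coeff_bound[OF this s, of M 1]
  have "cmod (deriv (\<lambda>c. f (z + c *\<^sub>C u)) 0) \<le> M / s"
    using sub M by auto
  moreover have "deriv (\<lambda>c. f (z + c *\<^sub>C u)) 0 = L u"
    using DERIV_imp_deriv deriv_line[OF L] by blast
  ultimately show ?thesis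
    by (simp add: s_def)
qed

text \<open>By the Cauchy estimate along complex lines, uniform convergence of holomorphic maps
  entails uniform convergence of their derivatives on smaller balls.\<close>

theorem holo_on_uniform_approx:
  fixes f :: "'a::complex_normed \<Rightarrow> complex"
  assumes S: "open S"
    and approx: "\<And>e. e > 0 \<Longrightarrow> \<exists>g. holo_on g S \<and> (\<forall>z\<in>S. cmod (g z - f z) \<le> e)"
  shows "holo_on f S"
  unfolding holo_on_def
proof (intro conjI ballI S)
  fix z0 assume "z0 \<in> S"
  \<comment> \<open>The doubled radius leaves room for a ball of radius \<open>r\<close> around
    every point of \<open>ball z0 r\<close>, so the derivative estimate is uniform there.\<close>
  then obtain r where r: "r > 0" "ball z0 (2 * r) \<subseteq> S"
    using S unfolding open_contains_ball by (metis field_sum_of_halves half_gt_zero mult_2)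
  have sub: "ball z r \<subseteq> S" if "z \<in> ball z0 r" for z
  proof
    fix w assume "w \<in> ball z r"
    with that have "dist z0 w < 2 * r"
      using dist_triangle[of z0 w z] by simp
    then show "w \<in> S" using r by auto
  qed
  have "\<exists>g. \<forall>n. holo_on (g n) S \<and> (\<forall>z\<in>S. cmod (g n z - f z) \<le> inverse (real (Suc n)))"
  proof (intro choice allI)
    show "\<exists>h. holo_on h S \<and> (\<forall>z\<in>S. cmod (h z - f z) \<le> inverse (real (Suc n)))" for n
      by (rule approx) simp
  qed
  then obtain g where g: "\<And>n. holo_on (g n) S"
    and gf: "\<And>n z. z \<in> S \<Longrightarrow> cmod (g n z - f z) \<le> inverse (real (Suc n))"
    by blast
  have "\<forall>n. \<forall>z\<in>S. \<exists>L. (g n has_derivative L) (at z) \<and> (\<forall>c u. L (c *\<^sub>C u) = c *\<^sub>C L u)"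
    using g unfolding holo_on_def by blast
  then obtain L where L: "\<And>n z. z \<in> S \<Longrightarrow> (g n has_derivative L n z) (at z)"
    and Lc: "\<And>n z c u. z \<in> S \<Longrightarrow> L n z (c *\<^sub>C u) = c *\<^sub>C L n z u"
    by metis
  have cauchy: "cmod (L n z u - L k z u) \<le> 2 * inverse (real (Suc N)) / r * norm u"
    if nk: "n \<ge> N" "k \<ge> N" and z: "z \<in> ball z0 r" for n k N z u
  proof (rule holo_on_derivative_bound[where f = "\<lambda>z. g n z - g k z" and L = "\<lambda>u. L n z u - L k z u"])
    show "holo_on (\<lambda>z. g n z - g k z) (ball z r)"
      using sub[OF z] by (intro holo_on_subset[OF holo_on_diff[OF g g]]) auto
    have zS: "z \<in> S" using sub[OF z] r by auto
    show "((\<lambda>z. g n z - g k z) has_derivative (\<lambda>u. L n z u - L k z u)) (at z)"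
      by (intro has_derivative_diff L zS)
    show "L n z (c *\<^sub>C u) - L k z (c *\<^sub>C u) = c *\<^sub>C (L n z u - L k z u)" for c u
      using zS by (simp add: Lc scaleC_diff_right)
    show "cmod (g n w - g k w) \<le> 2 * inverse (real (Suc N))" if "w \<in> ball z r" for w
    proof -
      have w: "w \<in> S" using that sub[OF z] by auto
      have "cmod (g n w - g k w) \<le> cmod (g n w - f w) + cmod (g k w - f w)"
        using norm_triangle_ineq4[of "g n w - f w" "g k w - f w"] by simp
      also have "\<dots> \<le> inverse (real (Suc n)) + inverse (real (Suc k))"
        by (intro add_mono gf w)
      also have "\<dots> \<le> inverse (real (Suc N)) + inverse (real (Suc N))"
        using nk by (intro add_mono le_imp_inverse_le) auto
      finally show ?thesis by simp
    qed
  qed (use r in auto)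
  have small: "\<exists>N. 2 * inverse (real (Suc N)) / r * c < e" if "e > 0" for e c
  proof -
    have "(\<lambda>N. 2 * inverse (real (Suc N)) / r * c) \<longlonglongrightarrow> 2 * 0 / r * c"
      using r by (intro tendsto_intros LIMSEQ_inverse_real_of_nat) auto
    then have "\<forall>\<^sub>F N in sequentially. 2 * inverse (real (Suc N)) / r * c < e"
      using that by (intro order_tendstoD(2)) auto
    then show ?thesis
      by (meson eventually_sequentially order_refl)
  qed
  have "convergent (\<lambda>n. L n z u)" if z: "z \<in> ball z0 r" for z u
    unfolding Cauchy_convergent_iff[symmetric]
  proof (rule CauchyI)
    fix e :: real assume "e > 0"
    then obtain N where "2 * inverse (real (Suc N)) / r * norm u < e"
      using small by blast
    with cauchy[OF _ _ z, of N] show "\<exists>M. \<forall>m\<ge>M. \<forall>n\<ge>M. norm (L m z u - L n z u) < e"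
      by (meson le_less_trans)
  qed
  then obtain L' where L': "\<And>z u. z \<in> ball z0 r \<Longrightarrow> (\<lambda>n. L n z u) \<longlonglongrightarrow> L' z u"
    unfolding convergent_def by metis
  have lim: "cmod (L n z u - L' z u) \<le> 2 * inverse (real (Suc N)) / r * norm u"
    if "n \<ge> N" and z: "z \<in> ball z0 r" for n N z u
  proof (rule tendsto_upperbound)
    show "(\<lambda>k. cmod (L n z u - L k z u)) \<longlonglongrightarrow> cmod (L n z u - L' z u)"
      by (intro tendsto_intros L' z)
    show "\<forall>\<^sub>F k in sequentially. cmod (L n z u - L k z u) \<le> 2 * inverse (real (Suc N)) / r * norm u"
      using cauchy[OF that(1) _ z] eventually_sequentially by blast
  qed auto
  have z0: "z0 \<in> ball z0 r" using r by simp
  have glim: "(\<lambda>n. g n z) \<longlonglongrightarrow> f z" if "z \<in> S" for z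
  proof (rule LIM_zero_cancel, rule Lim_null_comparison)
    show "\<forall>\<^sub>F n in sequentially. cmod (g n z - f z) \<le> inverse (real (Suc n))"
      using gf[OF that] by simp
  qed (rule LIMSEQ_inverse_real_of_nat)
  \<comment> \<open>The theorem on sequences of derivatives yields some limit \<open>h\<close>;
    pointwise convergence of \<open>g\<close> then identifies it with \<open>f\<close> on the
    ball.\<close>
  have "\<exists>h. \<forall>x\<in>ball z0 r. (\<lambda>n. g n x) \<longlonglongrightarrow> h x \<and> (h has_derivative L' x) (at x within ball z0 r)"
  proof (rule has_derivative_sequence[where f = g and f' = L])
    show "(g n has_derivative L n x) (at x within ball z0 r)" if "x \<in> ball z0 r" for n x
    proof -
      have "x \<in> S" using sub[OF that] r by auto
      then show ?thesis by (rule has_derivative_at_withinI[OF L])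
    qed
    show "\<forall>\<^sub>F n in sequentially. \<forall>x\<in>ball z0 r. \<forall>h. norm (L n x h - L' x h) \<le> e * norm h"
      if e: "e > 0" for e
    proof -
      obtain N where N: "2 * inverse (real (Suc N)) / r * 1 < e"
        using small[OF e, of 1] by blast
      have "norm (L n x h - L' x h) \<le> e * norm h" if "n \<ge> N" "x \<in> ball z0 r" for n x h
        using lim[OF that, of h] N by (smt (verit) mult_right_mono norm_ge_zero mult.right_neutral)
      then show ?thesis unfolding eventually_sequentially by blast
    qed
    show "(\<lambda>n. g n z0) \<longlonglongrightarrow> f z0"
      using glim \<open>z0 \<in> S\<close> by blast
  qed (use z0 in auto)
  then obtain h where h: "\<And>x. x \<in> ball z0 r \<Longrightarrow> (\<lambda>n. g n x) \<longlonglongrightarrow> h x"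
    and hd: "\<And>x. x \<in> ball z0 r \<Longrightarrow> (h has_derivative L' x) (at x within ball z0 r)"
    by blast
  have "h x = f x" if "x \<in> ball z0 r" for x
    using LIMSEQ_unique[OF h[OF that] glim] sub[OF that] r(1) centre_in_ball by blast
  moreover have "(h has_derivative L' z0) (at z0)"
    using hd[OF z0] z0 by (simp add: at_within_open[OF z0])
  ultimately have "(f has_derivative L' z0) (at z0)"
    using has_derivative_transform_within_open[of h "L' z0" z0 UNIV "ball z0 r" f] z0 by auto
  moreover have "L' z0 (c *\<^sub>C u) = c *\<^sub>C L' z0 u" for c u
  proof (rule LIMSEQ_unique)
    show "(\<lambda>n. L n z0 (c *\<^sub>C u)) \<longlonglongrightarrow> L' z0 (c *\<^sub>C u)" by (rule L'[OF z0])
    show "(\<lambda>n. L n z0 (c *\<^sub>C u)) \<longlonglongrightarrow> c *\<^sub>C L' z0 u"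
      unfolding Lc[OF \<open>z0 \<in> S\<close>] scaleC_complex_def by (intro tendsto_intros L' z0)
  qed
  ultimately show "\<exists>L. (f has_derivative L) (at z0) \<and> (\<forall>c u. L (c *\<^sub>C u) = c *\<^sub>C L u)"
    by blast
qed

section \<open>Taylor expansion in several variables with parameters\<close>

lemma holo_on_slice:
  fixes F :: "complex \<times> 'a::complex_normed \<Rightarrow> complex"
  assumes "holo_on F (ball 0 r \<times> W)" "w \<in> W"
  shows "(\<lambda>s. F (s, w)) holomorphic_on ball 0 r"
proof -
  have "holo_on (\<lambda>s. (s, w)) (ball (0::complex) r)"
    by (intro holo_on_Pair holo_on_id holo_on_const) auto
  from holo_on_compose[OF this assms(1)] assms(2) show ?thesis
    by (auto simp: holo_on_complex_iff)
qed

text \<open>Given the coefficients of lower order, the \<open>n\<close>-th one is the uniform limit, as \<open>h\<close> tends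
  to \<open>0\<close>, of the functions \<open>(F (h, w) - (\<Sum>l<n. a l w * h ^ l)) / h ^ n\<close>, which are
  holomorphic in \<open>w\<close>.\<close>

lemma holo_on_taylor_coeff:
  fixes F :: "complex \<times> 'a::complex_normed \<Rightarrow> complex"
  assumes F: "holo_on F (ball 0 r \<times> W)" and r: "r > 0" and W: "open W"
    and M: "\<And>s w. cmod s < r \<Longrightarrow> w \<in> W \<Longrightarrow> cmod (F (s, w)) \<le> M"
  shows "holo_on (\<lambda>w. (deriv ^^ n) (\<lambda>s. F (s, w)) 0 / fact n) W"
proof -
  define a where "a n w = (deriv ^^ n) (\<lambda>s. F (s, w)) 0 / fact n" for n w
  have bound: "cmod (a n w) \<le> M / r ^ n" if "w \<in> W" for n w
    unfolding a_def using holomorphic_coeff_bound[OF holo_on_slice[OF F that] r] M that by blast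
  have sums: "(\<lambda>n. a n w * s ^ n) sums F (s, w)" if "w \<in> W" "cmod s < r" for w s
    using holomorphic_power_series[OF holo_on_slice[OF F that(1)], of s] that(2)
    by (simp add: a_def)
  have "holo_on (a n) W"
  proof (induction n rule: less_induct)
    case (less n)
    show ?case
    proof (cases "W = {}")
      case True
      then show ?thesis by (simp add: holo_on_def)
    next
      case False
      then have M0: "M \<ge> 0"
        using M[of 0] r by (metis ex_in_conv norm_ge_zero norm_zero order_trans)
      show ?thesis
      proof (rule holo_on_uniform_approx[OF W])
        fix e :: real assume e: "e > 0"
        \<comment> \<open>With \<open>h \<le> r / 2\<close> the tail beyond order \<open>n\<close>
          is dominated by a geometric series of ratio 1/2, whose sum contributes the factor 2. The
          second bound makes the resulting error \<open>2 * M * h / r ^ Suc n\<close> at most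
          \<open>e\<close>; \<open>M + 1\<close> keeps the denominator positive.\<close>
        define h where "h = min (r / 2) (e * r ^ Suc n / (2 * (M + 1)))"
        have h: "0 < h" "h \<le> r / 2"
          using r e M0 by (auto simp: h_def min_def)
        have "h \<le> e * r ^ Suc n / (2 * (M + 1))" by (simp add: h_def)
        then have "h * (2 * (M + 1)) \<le> e * r ^ Suc n"
          using M0 by (simp add: pos_le_divide_eq)
        moreover have "h * (2 * M) \<le> h * (2 * (M + 1))" using h by simp
        ultimately have he: "2 * M * h / r ^ Suc n \<le> e"
          using r by (simp add: field_simps)
        define g where "g w = (F (of_real h, w) - (\<Sum>l<n. a l w * of_real h ^ l)) / of_real h ^ n" for w
        have "holo_on g W"
          unfolding g_def
        proof (intro holo_on_divide holo_on_diff holo_on_sum holo_on_mult holo_on_const less W)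
          have "holo_on (\<lambda>w. (complex_of_real h, w)) W"
            by (intro holo_on_Pair holo_on_const holo_on_id W)
          moreover have "(\<lambda>w. (complex_of_real h, w)) ` W \<subseteq> ball 0 r \<times> W"
            using h r by auto
          ultimately show "holo_on (\<lambda>w. F (of_real h, w)) W"
            by (rule holo_on_compose[OF _ F])
        qed (use h in auto)
        moreover have "cmod (g w - a n w) \<le> e" if w: "w \<in> W" for w
        proof -
          let ?f = "\<lambda>k. a (k + Suc n) w * of_real h ^ (k + Suc n)"
          let ?g = "\<lambda>k. M * (h / r) ^ Suc n * (1 / 2) ^ k"
          have "?f sums (F (of_real h, w) - (\<Sum>l<Suc n. a l w * of_real h ^ l))"
            using sums_split_initial_segment[OF sums[OF w], of "of_real h" "Suc n"] h r by simp
          moreover have "F (of_real h, w) - (\<Sum>l<Suc n. a l w * of_real h ^ l) = (g w - a n w) * of_real h ^ n"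
            using h by (simp add: g_def field_simps)
          ultimately have f: "?f sums ((g w - a n w) * of_real h ^ n)" by simp
          have g: "?g sums (M * (h / r) ^ Suc n * 2)"
            using sums_mult[OF geometric_sums[of "1 / 2 :: real"], of "M * (h / r) ^ Suc n"] by simp
          have "cmod (?f k) \<le> ?g k" for k
          proof -
            have "cmod (?f k) \<le> M / r ^ (k + Suc n) * h ^ (k + Suc n)"
              using bound[OF w, of "k + Suc n"] h
              by (simp only: norm_mult norm_power norm_of_real abs_of_pos) (intro mult_right_mono, auto)
            also have "\<dots> = M * (h / r) ^ Suc n * (h / r) ^ k"
              by (simp add: power_add power_divide field_simps)
            also have "\<dots> \<le> M * (h / r) ^ Suc n * (1 / 2) ^ k"
              using h r M0 by (intro mult_left_mono power_mono) (auto simp: field_simps)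
            finally show ?thesis .
          qed
          then have "cmod ((g w - a n w) * of_real h ^ n) \<le> M * (h / r) ^ Suc n * 2"
            using norm_suminf_le[of ?f ?g] f g by (simp add: sums_iff)
          moreover have "cmod ((g w - a n w) * of_real h ^ n) = cmod (g w - a n w) * h ^ n"
            using h by (simp only: norm_mult norm_power norm_of_real abs_of_pos)
          moreover have "M * (h / r) ^ Suc n * 2 = (2 * M * h / r ^ Suc n) * h ^ n"
            by (simp add: power_divide)
          ultimately have "cmod (g w - a n w) * h ^ n \<le> (2 * M * h / r ^ Suc n) * h ^ n"
            by simp
          then have "cmod (g w - a n w) \<le> 2 * M * h / r ^ Suc n"
            using h by (simp only: mult_le_cancel_right_pos zero_less_power)
          with he show ?thesis by linarith
        qed
        ultimately show "\<exists>g. holo_on g W \<and> (\<forall>w\<in>W. cmod (g w - a n w) \<le> e)"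
          by blast
      qed
    qed
  qed
  then show ?thesis by (simp add: a_def[abs_def])
qed

text \<open>A convergent expansion is the Taylor expansion of its sum, so Cauchy's estimate also
  applies when only the coefficients and the sums are given, as happens for series that are
  themselves the starting point.\<close>

lemma sums_coeff_bound:
  assumes r: "r > 0" and sums: "\<And>s. cmod s < r \<Longrightarrow> (\<lambda>n. a n * s ^ n) sums g s"
    and M: "\<And>s. cmod s < r \<Longrightarrow> cmod (g s) \<le> M"
  shows "cmod (a n) \<le> M / r ^ n"
proof -
  have "g has_fps_expansion Abs_fps a"
    unfolding has_fps_expansion_def
  proof
    have "ereal (norm (complex_of_real (r / 2))) \<le> fps_conv_radius (Abs_fps a)"
      unfolding fps_conv_radius_def using sums[of "of_real (r / 2)"] r
      by (intro conv_radius_geI) (auto simp: sums_iff)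
    moreover have "0 < ereal (norm (complex_of_real (r / 2)))"
      using r by simp
    ultimately show "0 < fps_conv_radius (Abs_fps a)"
      by (rule less_le_trans[rotated])
    have "\<forall>\<^sub>F s in nhds 0. s \<in> ball 0 r"
      using r by (intro eventually_nhds_in_open) auto
    then show "\<forall>\<^sub>F s in nhds 0. eval_fps (Abs_fps a) s = g s"
      by eventually_elim (use sums in \<open>simp add: eval_fps_def sums_iff\<close>)
  qed
  from fps_nth_fps_expansion[OF this, of n] have "a n = (deriv ^^ n) g 0 / fact n"
    by simp
  moreover have "g holomorphic_on ball 0 r"
    using sums by (intro power_series_holomorphic[where a = a]) auto
  ultimately show ?thesis
    using holomorphic_coeff_bound[OF _ r M] by simp
qed

section \<open>Polydiscs, multi-indices and the geometric majorant\<close>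

text \<open>Polydiscs fit the problem better than Euclidean balls: a coordinate can be replaced
  independently of the others, multiplication by \<open>q\<close> with all
  \<open>cmod (q $ i) < 1\<close> preserves them, and monomials are bounded by
  \<open>r ^ mdegree \<alpha>\<close>.\<close>

definition polydisc :: "real \<Rightarrow> (complex ^ 'm) set" where
  "polydisc r = {t. \<forall>i. cmod (t $ i) < r}"

lemma polydisc_iff: "t \<in> polydisc r \<longleftrightarrow> (\<forall>i. cmod (t $ i) < r)"
  by (simp add: polydisc_def)

lemma open_polydisc: "open (polydisc r :: (complex ^ 'm) set)"
proof -
  have "polydisc r = (\<Inter>i. {t :: complex ^ 'm. cmod (t $ i) < r})"
    by (auto simp: polydisc_def)
  then show ?thesis
    by (simp add: open_INT open_Collect_less continuous_intros)
qed

lemma zero_in_polydisc: "r > 0 \<Longrightarrow> 0 \<in> polydisc r"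
  by (simp add: polydisc_iff)

lemma polydisc_mono: "t \<in> polydisc s \<Longrightarrow> s \<le> r \<Longrightarrow> t \<in> polydisc r"
  by (auto simp: polydisc_iff intro: less_le_trans)

lemma cwmult_in_polydisc:
  assumes "\<And>i. cmod (q $ i) < 1" "t \<in> polydisc r"
  shows "cwmult q t \<in> polydisc r"
  unfolding polydisc_iff
proof
  fix i
  have "cmod (q $ i) * cmod (t $ i) \<le> 1 * cmod (t $ i)"
    using less_imp_le[OF assms(1)] by (intro mult_right_mono) auto
  also have "\<dots> < r" using assms(2) by (simp add: polydisc_iff)
  finally show "cmod (cwmult q t $ i) < r"
    by (simp add: cwmult_def norm_mult)
qed

text \<open>The number of variables is fixed by the type \<open>'m\<close>, so induction on it is
  replaced by induction on the set \<open>I\<close> of active coordinates; exponents vanish outside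
  \<open>I\<close>.\<close>

definition supp_in :: "'m set \<Rightarrow> ('m \<Rightarrow> nat) set" where
  "supp_in I = {\<alpha>. \<forall>i. i \<notin> I \<longrightarrow> \<alpha> i = 0}"

lemma supp_in_UNIV [simp]: "supp_in UNIV = UNIV"
  by (simp add: supp_in_def)

lemma supp_in_empty [simp]: "supp_in {} = {\<lambda>_. 0}"
  by (auto simp: supp_in_def)

lemma bij_betw_supp_in_insert:
  assumes "i \<notin> I"
  shows "bij_betw (\<lambda>(\<beta>, n). \<beta>(i := n)) (supp_in I \<times> UNIV) (supp_in (insert i I))"
proof (rule bij_betwI[where g = "\<lambda>\<gamma>. (\<gamma>(i := 0), \<gamma> i)"])
  fix p assume "p \<in> supp_in I \<times> (UNIV :: nat set)"
  then show "((case p of (\<beta>, n) \<Rightarrow> \<beta>(i := n))(i := 0), (case p of (\<beta>, n) \<Rightarrow> \<beta>(i := n)) i) = p"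
    using assms by (auto simp: supp_in_def fun_eq_iff)
qed (auto simp: supp_in_def)

abbreviation mdegree :: "('m::finite \<Rightarrow> nat) \<Rightarrow> nat" where
  "mdegree \<alpha> \<equiv> sum \<alpha> UNIV"

lemma mdegree_upd:
  assumes "\<beta> i = 0"
  shows "mdegree (\<beta>(i := n)) = mdegree \<beta> + n"
  using assms by (simp add: sum.remove[of UNIV i])

lemma prod_power_upd:
  fixes x :: "'m::finite \<Rightarrow> 'a::comm_semiring_1"
  assumes "\<beta> i = 0"
  shows "(\<Prod>k\<in>UNIV. x k ^ (\<beta>(i := n)) k) = (\<Prod>k\<in>UNIV. x k ^ \<beta> k) * x i ^ n"
  using assms by (simp add: prod.remove[of UNIV i] mult.commute)

lemma mpow_upd: "\<beta> i = 0 \<Longrightarrow> mpow t (\<beta>(i := n)) = mpow t \<beta> * t $ i ^ n"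
  unfolding mpow_def by (rule prod_power_upd)

lemma mpow_zero [simp]: "mpow t (\<lambda>_. 0) = 1"
  by (simp add: mpow_def)

lemma norm_mpow: "cmod (mpow t \<alpha>) = (\<Prod>i\<in>UNIV. cmod (t $ i) ^ \<alpha> i)"
  by (simp add: mpow_def prod_norm[symmetric] norm_power)

text \<open>A product of one-variable geometric series: each new coordinate adds a factor
  \<open>1 / (1 - x i)\<close>, by iterated summation of nonnegative terms. This is the majorant
  behind the convergence estimates below.\<close>

lemma summable_on_multi_geometric:
  fixes x :: "'m::finite \<Rightarrow> real"
  assumes x: "\<And>i. 0 \<le> x i" "\<And>i. x i < 1"
  shows "(\<lambda>\<alpha>. \<Prod>i\<in>UNIV. x i ^ \<alpha> i) summable_on UNIV"
proof -
  have "(\<lambda>\<alpha>. \<Prod>i\<in>UNIV. x i ^ \<alpha> i) summable_on supp_in I" if "finite I" for I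
    using that
  proof (induction I)
    case (insert i I)
    have "(\<lambda>p. (\<Prod>k\<in>UNIV. x k ^ fst p k) * x i ^ snd p) summable_on (supp_in I \<times> UNIV)"
    proof (rule summable_on_SigmaI)
      have "((\<lambda>n. x i ^ n) has_sum (1 / (1 - x i))) UNIV"
        using x[of i] geometric_sums[of "x i"] by (intro norm_summable_imp_has_sum) (auto simp: norm_power sums_iff)
      then show "((\<lambda>n. (\<Prod>k\<in>UNIV. x k ^ fst (\<beta>, n) k) * x i ^ snd (\<beta>, n)) has_sum
                   (\<Prod>k\<in>UNIV. x k ^ \<beta> k) * (1 / (1 - x i))) UNIV" for \<beta>
        using has_sum_cmult_right by fastforce
      show "(\<lambda>\<beta>. (\<Prod>k\<in>UNIV. x k ^ \<beta> k) * (1 / (1 - x i))) summable_on supp_in I"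
        by (intro summable_on_cmult_left insert)
    qed (use x in \<open>auto intro!: mult_nonneg_nonneg prod_nonneg\<close>)
    also have "?this \<longleftrightarrow> (\<lambda>p. \<Prod>k\<in>UNIV. x k ^ (case p of (\<beta>, n) \<Rightarrow> \<beta>(i := n)) k) summable_on (supp_in I \<times> UNIV)"
    proof (rule summable_on_cong)
      fix p assume "p \<in> supp_in I \<times> (UNIV :: nat set)"
      then have "fst p i = 0" using insert by (auto simp: supp_in_def)
      from prod_power_upd[of "fst p", OF this, of x "snd p"]
      show "(\<Prod>k\<in>UNIV. x k ^ fst p k) * x i ^ snd p = (\<Prod>k\<in>UNIV. x k ^ (case p of (\<beta>, n) \<Rightarrow> \<beta>(i := n)) k)"
        by (simp add: case_prod_unfold)
    qed
    finally show ?case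
      using summable_on_reindex_bij_betw[OF bij_betw_supp_in_insert[OF insert(2)],
          of "\<lambda>\<alpha>. \<Prod>i\<in>UNIV. x i ^ \<alpha> i"] by simp
  qed simp
  from this[of UNIV] show ?thesis by simp
qed

lemma multi_geometric_eq:
  fixes t :: "complex ^ 'm"
  shows "M / r ^ mdegree \<alpha> * cmod (mpow t \<alpha>) = M * (\<Prod>i\<in>UNIV. (cmod (t $ i) / r) ^ \<alpha> i)"
  by (simp add: norm_mpow power_divide prod_dividef power_sum)

lemma summable_on_multi_power:
  fixes t :: "complex ^ 'm"
  assumes "r > 0" "t \<in> polydisc r"
  shows "(\<lambda>\<alpha>. M / r ^ mdegree \<alpha> * cmod (mpow t \<alpha>)) summable_on A"
proof -
  have "(\<lambda>\<alpha>. M * (\<Prod>i\<in>UNIV. (cmod (t $ i) / r) ^ \<alpha> i)) summable_on UNIV"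
    using assms by (intro summable_on_cmult_right summable_on_multi_geometric) (auto simp: polydisc_iff)
  then show ?thesis
    unfolding multi_geometric_eq using summable_on_subset by blast
qed

definition vec_upd :: "complex ^ 'm \<Rightarrow> 'm \<Rightarrow> complex \<Rightarrow> complex ^ 'm" where
  "vec_upd t i s = (\<chi> k. if k = i then s else t $ k)"

lemma vec_upd_nth [simp]: "vec_upd t i s $ k = (if k = i then s else t $ k)"
  by (simp add: vec_upd_def)

lemma vec_upd_self [simp]: "vec_upd t i (t $ i) = t"
  by (simp add: vec_eq_iff)

lemma vec_upd_in_polydisc: "t \<in> polydisc r \<Longrightarrow> cmod s < r \<Longrightarrow> vec_upd t i s \<in> polydisc r"
  by (simp add: polydisc_iff)

lemma mpow_vec_upd: "\<beta> i = 0 \<Longrightarrow> mpow (vec_upd t i s) \<beta> = mpow t \<beta>"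
  unfolding mpow_def by (rule prod.cong) auto

text \<open>One coordinate is expanded at a time. The coefficients remain functions on the whole
  polydisc, since the type of \<open>t\<close> cannot shrink; the last clause on \<open>c\<close>
  says instead that they no longer depend on the coordinates in \<open>I\<close>. In the step for
  \<open>i\<close>, the old coefficients are expanded at 0 in the \<open>i\<close>-th coordinate,
  and \<open>holo_on_taylor_coeff\<close> keeps the new ones holomorphic in everything else.\<close>

lemma taylor_expansion_partial:
  fixes f :: "(complex ^ 'm) \<times> 'a::complex_normed \<Rightarrow> complex"
  assumes f: "holo_on f (polydisc r \<times> W)" and r: "r > 0" and W: "open W"
    and M: "\<And>t w. t \<in> polydisc r \<Longrightarrow> w \<in> W \<Longrightarrow> cmod (f (t, w)) \<le> M"
    and I: "finite I"
  shows "\<exists>c. (\<forall>\<beta>\<in>supp_in I. holo_on (c \<beta>) (polydisc r \<times> W) \<and>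
             (\<forall>t\<in>polydisc r. \<forall>w\<in>W. cmod (c \<beta> (t, w)) \<le> M / r ^ mdegree \<beta> \<and>
                (\<forall>t'\<in>polydisc r. (\<forall>i. i \<notin> I \<longrightarrow> t' $ i = t $ i) \<longrightarrow> c \<beta> (t', w) = c \<beta> (t, w)))) \<and>
             (\<forall>t\<in>polydisc r. \<forall>w\<in>W. ((\<lambda>\<beta>. c \<beta> (t, w) * mpow t \<beta>) has_sum f (t, w)) (supp_in I))"
  using I
proof (induction I)
  case empty
  show ?case
    using f M by (intro exI[of _ "\<lambda>_. f"]) (auto simp: vec_eq_iff[symmetric] has_sum_finite_iff)
next
  case (insert i I)
  obtain c where c: "\<forall>\<beta>\<in>supp_in I. holo_on (c \<beta>) (polydisc r \<times> W) \<and>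
             (\<forall>t\<in>polydisc r. \<forall>w\<in>W. cmod (c \<beta> (t, w)) \<le> M / r ^ mdegree \<beta> \<and>
                (\<forall>t'\<in>polydisc r. (\<forall>i. i \<notin> I \<longrightarrow> t' $ i = t $ i) \<longrightarrow> c \<beta> (t', w) = c \<beta> (t, w)))"
    and sum: "\<And>t w. t \<in> polydisc r \<Longrightarrow> w \<in> W \<Longrightarrow> ((\<lambda>\<beta>. c \<beta> (t, w) * mpow t \<beta>) has_sum f (t, w)) (supp_in I)"
    using insert.IH by blast
  have holo: "holo_on (c \<beta>) (polydisc r \<times> W)" if "\<beta> \<in> supp_in I" for \<beta>
    using c that by blast
  have bound: "cmod (c \<beta> (t, w)) \<le> M / r ^ mdegree \<beta>"
    if "\<beta> \<in> supp_in I" "t \<in> polydisc r" "w \<in> W" for \<beta> t w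
    using c that by blast
  have indep: "c \<beta> (t', w) = c \<beta> (t, w)"
    if "\<beta> \<in> supp_in I" "t \<in> polydisc r" "t' \<in> polydisc r" "w \<in> W" "\<forall>i. i \<notin> I \<longrightarrow> t' $ i = t $ i"
    for \<beta> t t' w
    using c that by blast
  \<comment> \<open>The \<open>i\<close>-th coordinate becomes the variable \<open>s\<close>. The
    parameter still carries its old \<open>i\<close>-th coordinate, which is overwritten; hence
    \<open>a\<close> does not depend on it.\<close>
  define F where "F \<beta> p = c \<beta> (vec_upd (fst (snd p)) i (fst p), snd (snd p))" for \<beta> p
  define a where "a \<beta> n x = (deriv ^^ n) (\<lambda>s. F \<beta> (s, x)) 0 / fact n" for \<beta> n x
  have PW: "open (polydisc r \<times> W)"
    by (intro open_Times open_polydisc W)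
  have upd_holo: "holo_on (\<lambda>p. (vec_upd (fst (snd p)) i (fst p), snd (snd p))) (ball 0 r \<times> polydisc r \<times> W)"
  proof (intro holo_on_Pair holo_on_vec)
    have o: "open (ball (0::complex) r \<times> (polydisc r :: (complex ^ 'm) set) \<times> W)"
      by (intro open_Times open_ball PW)
    have s: "holo_on (\<lambda>p. snd p) (ball (0::complex) r \<times> (polydisc r :: (complex ^ 'm) set) \<times> W)"
      by (rule holo_on_snd[OF o])
    show "holo_on (\<lambda>p. snd (snd p)) (ball (0::complex) r \<times> (polydisc r :: (complex ^ 'm) set) \<times> W)"
      by (rule holo_on_compose[OF s holo_on_snd[OF open_UNIV]]) auto
    have "holo_on (\<lambda>p. fst (snd p)) (ball (0::complex) r \<times> (polydisc r :: (complex ^ 'm) set) \<times> W)"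
      by (rule holo_on_compose[OF s holo_on_fst[OF open_UNIV]]) auto
    then show "holo_on (\<lambda>p. vec_upd (fst (snd p)) i (fst p) $ j) (ball (0::complex) r \<times> (polydisc r :: (complex ^ 'm) set) \<times> W)" for j
      by (cases "j = i") (auto intro: holo_on_fst[OF o] holo_on_vec_nth)
  qed
  have F_holo: "holo_on (F \<beta>) (ball 0 r \<times> polydisc r \<times> W)" if "\<beta> \<in> supp_in I" for \<beta>
    unfolding F_def
    by (rule holo_on_compose[OF upd_holo holo[OF that]]) (auto intro: vec_upd_in_polydisc)
  have F_bound: "cmod (F \<beta> (s, x)) \<le> M / r ^ mdegree \<beta>"
    if "\<beta> \<in> supp_in I" "cmod s < r" "x \<in> polydisc r \<times> W" for \<beta> s x
    using that bound[OF that(1)] vec_upd_in_polydisc[of "fst x" r s i] by (auto simp: F_def)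
  have a_holo: "holo_on (a \<beta> n) (polydisc r \<times> W)" if "\<beta> \<in> supp_in I" for \<beta> n
    unfolding a_def by (rule holo_on_taylor_coeff[OF F_holo[OF that] r PW F_bound[OF that]])
  have a_bound: "cmod (a \<beta> n x) \<le> M / r ^ mdegree \<beta> / r ^ n"
    if "\<beta> \<in> supp_in I" "x \<in> polydisc r \<times> W" for \<beta> n x
    unfolding a_def
    using holomorphic_coeff_bound[OF holo_on_slice[OF F_holo[OF that(1)] that(2)] r] F_bound that by blast
  have a_sums: "(\<lambda>n. a \<beta> n (t, w) * t $ i ^ n) sums c \<beta> (t, w)"
    if "\<beta> \<in> supp_in I" "t \<in> polydisc r" "w \<in> W" for \<beta> t w
    using holomorphic_power_series[OF holo_on_slice[OF F_holo[OF that(1)], of "(t, w)"], of "t $ i"] that(2,3)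
    by (simp add: a_def F_def polydisc_iff)
  \<comment> \<open>Once coordinate \<open>i\<close> has been overwritten by the same
    \<open>s\<close>, the points \<open>t\<close> and \<open>t'\<close> agree outside
    \<open>I\<close>, where the old independence applies.\<close>
  have a_indep: "a \<beta> n (t', w) = a \<beta> n (t, w)"
    if "\<beta> \<in> supp_in I" "t \<in> polydisc r" "t' \<in> polydisc r" "w \<in> W" "\<forall>k. k \<notin> insert i I \<longrightarrow> t' $ k = t $ k"
    for \<beta> n t t' w
  proof -
    have "\<forall>\<^sub>F s in nhds 0. s \<in> ball 0 r"
      using r by (intro eventually_nhds_in_open) auto
    then have "\<forall>\<^sub>F s in nhds 0. F \<beta> (s, (t', w)) = F \<beta> (s, (t, w))"
    proof eventually_elim
      case (elim s)
      then show ?case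
        unfolding F_def using that by (simp) (rule indep, auto intro: vec_upd_in_polydisc)
    qed
    from higher_deriv_cong_ev[OF this refl] show ?thesis
      by (simp add: a_def)
  qed
  define c' where "c' \<gamma> = a (\<gamma>(i := 0)) (\<gamma> i)" for \<gamma>
  have restrict: "\<gamma>(i := 0) \<in> supp_in I" if "\<gamma> \<in> supp_in (insert i I)" for \<gamma>
    using that by (auto simp: supp_in_def)
  have c'_bound: "cmod (c' \<gamma> (t, w)) \<le> M / r ^ mdegree \<gamma>"
    if "\<gamma> \<in> supp_in (insert i I)" "t \<in> polydisc r" "w \<in> W" for \<gamma> t w
    using a_bound[OF restrict[OF that(1)], of "(t, w)" "\<gamma> i"] that(2,3)
      mdegree_upd[of "\<gamma>(i := 0)" i "\<gamma> i"]
    by (simp add: c'_def power_add)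
  have "((\<lambda>\<gamma>. c' \<gamma> (t, w) * mpow t \<gamma>) has_sum f (t, w)) (supp_in (insert i I))"
    if t: "t \<in> polydisc r" and w: "w \<in> W" for t w
  proof -
    \<comment> \<open>Convergence of the iterated sums alone would not give summability over all
      exponents. The coefficient bound provides a sum \<open>b\<close> first; summing over the
      exponent of \<open>i\<close> then recovers \<open>c \<beta>\<close>, and comparison with the
      old expansion shows that \<open>b\<close> is the value of \<open>f\<close>.\<close>
    have "(\<lambda>\<gamma>. norm (c' \<gamma> (t, w) * mpow t \<gamma>)) summable_on supp_in (insert i I)"
    proof (rule summable_on_comparison_test[OF summable_on_multi_power[OF r t, of M]])
      show "norm (c' \<gamma> (t, w) * mpow t \<gamma>) \<le> M / r ^ mdegree \<gamma> * cmod (mpow t \<gamma>)"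
        if "\<gamma> \<in> supp_in (insert i I)" for \<gamma>
        unfolding norm_mult by (intro mult_right_mono c'_bound t w that) simp
    qed simp
    then have "(\<lambda>\<gamma>. c' \<gamma> (t, w) * mpow t \<gamma>) summable_on supp_in (insert i I)"
      by (rule abs_summable_summable)
    then obtain b where b: "((\<lambda>\<gamma>. c' \<gamma> (t, w) * mpow t \<gamma>) has_sum b) (supp_in (insert i I))"
      by (auto simp: summable_on_def)
    then have "((\<lambda>p. c' (case p of (\<beta>, n) \<Rightarrow> \<beta>(i := n)) (t, w) * mpow t (case p of (\<beta>, n) \<Rightarrow> \<beta>(i := n))) has_sum b)
                 (supp_in I \<times> UNIV)"
      using has_sum_reindex_bij_betw[OF bij_betw_supp_in_insert[OF insert(2)],
          of "\<lambda>\<gamma>. c' \<gamma> (t, w) * mpow t \<gamma>" b] by simp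
    also have "?this \<longleftrightarrow> ((\<lambda>p. (a (fst p) (snd p) (t, w) * t $ i ^ snd p) * mpow t (fst p)) has_sum b) (supp_in I \<times> UNIV)"
    proof (rule has_sum_cong)
      fix p assume "p \<in> supp_in I \<times> (UNIV :: nat set)"
      then have "fst p i = 0" using insert by (auto simp: supp_in_def)
      then show "c' (case p of (\<beta>, n) \<Rightarrow> \<beta>(i := n)) (t, w) * mpow t (case p of (\<beta>, n) \<Rightarrow> \<beta>(i := n)) =
          (a (fst p) (snd p) (t, w) * t $ i ^ snd p) * mpow t (fst p)"
        by (simp add: case_prod_unfold c'_def mpow_upd fun_upd_idem)
    qed
    finally have "((\<lambda>\<beta>. c \<beta> (t, w) * mpow t \<beta>) has_sum b) (supp_in I)"
    proof (rule has_sum_SigmaD)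
      fix \<beta> assume \<beta>: "\<beta> \<in> supp_in I"
      have "((\<lambda>n. a \<beta> n (t, w) * t $ i ^ n) has_sum c \<beta> (t, w)) UNIV"
      proof (rule norm_summable_imp_has_sum[OF _ a_sums[OF \<beta> t w]])
        show "summable (\<lambda>n. norm (a \<beta> n (t, w) * t $ i ^ n))"
        proof (rule summable_comparison_test')
          show "summable (\<lambda>n. M / r ^ mdegree \<beta> * (cmod (t $ i) / r) ^ n)"
            using t r by (intro summable_mult summable_geometric) (auto simp: polydisc_iff)
          show "norm (norm (a \<beta> n (t, w) * t $ i ^ n)) \<le> M / r ^ mdegree \<beta> * (cmod (t $ i) / r) ^ n"
            for n
            using mult_right_mono[OF a_bound[OF \<beta>, of "(t, w)" n], of "cmod (t $ i) ^ n"] t w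
            by (simp add: norm_mult norm_power power_divide)
        qed
      qed
      from has_sum_cmult_left[OF this, of "mpow t \<beta>"]
      show "((\<lambda>n. (a (fst (\<beta>, n)) (snd (\<beta>, n)) (t, w) * t $ i ^ snd (\<beta>, n)) * mpow t (fst (\<beta>, n))) has_sum
              c \<beta> (t, w) * mpow t \<beta>) UNIV"
        by simp
    qed
    with sum[OF t w] have "b = f (t, w)"
      using has_sum_unique by blast
    with b show ?thesis by simp
  qed
  then show ?case
    by (intro exI[of _ c'] conjI ballI impI c'_bound)
       (simp_all only: c'_def a_holo[OF restrict] a_indep[OF restrict])
qed

text \<open>Once every coordinate is active, the coefficients are constant in \<open>t\<close>, so
  evaluating them at \<open>t = 0\<close> leaves functions of the parameter only.\<close>

theorem taylor_expansion:
  fixes f :: "(complex ^ 'm) \<times> 'a::complex_normed \<Rightarrow> complex"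
  assumes f: "holo_on f (polydisc r \<times> W)" and r: "r > 0" and W: "open W"
    and M: "\<And>t w. t \<in> polydisc r \<Longrightarrow> w \<in> W \<Longrightarrow> cmod (f (t, w)) \<le> M"
  obtains c where "\<And>\<alpha>. holo_on (c \<alpha>) W"
    and "\<And>\<alpha> w. w \<in> W \<Longrightarrow> cmod (c \<alpha> w) \<le> M / r ^ mdegree \<alpha>"
    and "\<And>t w. t \<in> polydisc r \<Longrightarrow> w \<in> W \<Longrightarrow> ((\<lambda>\<alpha>. c \<alpha> w * mpow t \<alpha>) has_sum f (t, w)) UNIV"
proof -
  have "finite (UNIV :: 'm set)" by simp
  from taylor_expansion_partial[OF f r W M this]
  obtain c where c: "\<forall>\<beta>\<in>supp_in UNIV. holo_on (c \<beta>) (polydisc r \<times> W) \<and>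
             (\<forall>t\<in>polydisc r. \<forall>w\<in>W. cmod (c \<beta> (t, w)) \<le> M / r ^ mdegree \<beta> \<and>
                (\<forall>t'\<in>polydisc r. (\<forall>i. i \<notin> UNIV \<longrightarrow> t' $ i = t $ i) \<longrightarrow> c \<beta> (t', w) = c \<beta> (t, w)))"
    and sum: "\<forall>t\<in>polydisc r. \<forall>w\<in>W. ((\<lambda>\<beta>. c \<beta> (t, w) * mpow t \<beta>) has_sum f (t, w)) (supp_in UNIV)"
    by blast
  have U: "\<alpha> \<in> supp_in UNIV" for \<alpha> :: "'m \<Rightarrow> nat" by simp
  have holo: "holo_on (c \<alpha>) (polydisc r \<times> W)" for \<alpha>
    using c U by blast
  have bound: "cmod (c \<alpha> (t, w)) \<le> M / r ^ mdegree \<alpha>" if "t \<in> polydisc r" "w \<in> W" for \<alpha> t w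
    using c U that by blast
  have indep: "c \<alpha> (t', w) = c \<alpha> (t, w)" if "t \<in> polydisc r" "t' \<in> polydisc r" "w \<in> W" for \<alpha> t t' w
    using c U that by blast
  show ?thesis
  proof (rule that[of "\<lambda>\<alpha> w. c \<alpha> (0, w)"])
    have "holo_on (\<lambda>w. (0 :: complex ^ 'm, w)) W"
      by (intro holo_on_Pair holo_on_const holo_on_id W)
    then show "holo_on (\<lambda>w. c \<alpha> (0, w)) W" for \<alpha>
      by (rule holo_on_compose[OF _ holo]) (auto intro: zero_in_polydisc r)
    show "((\<lambda>\<alpha>. c \<alpha> (0, w) * mpow t \<alpha>) has_sum f (t, w)) UNIV"
      if "t \<in> polydisc r" "w \<in> W" for t w
      using bspec[OF bspec[OF sum that(1)] that(2)] indep[OF that(1) zero_in_polydisc[OF r] that(2)]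
      by (simp only: supp_in_UNIV)
  qed (auto intro: bound zero_in_polydisc r)
qed

text \<open>Cauchy's estimate for a function known only as the sum of a series. Grouping the terms
  by the exponent \<open>n\<close> of the new coordinate gives a one-variable power series whose
  coefficients \<open>?G n t\<close> are at most \<open>M / r ^ n\<close>. These are again series in
  the remaining variables, so the induction hypothesis is used with other \<open>c\<close>,
  \<open>g\<close> and \<open>M\<close>.\<close>

lemma multi_series_coeff_bound_partial:
  fixes c :: "('m::finite \<Rightarrow> nat) \<Rightarrow> complex"
  assumes r: "r > 0" and I: "finite I"
    and sum: "\<And>t. t \<in> polydisc r \<Longrightarrow> ((\<lambda>\<alpha>. c \<alpha> * mpow t \<alpha>) has_sum g t) (supp_in I)"
    and M: "\<And>t. t \<in> polydisc r \<Longrightarrow> cmod (g t) \<le> M"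
    and \<alpha>: "\<alpha> \<in> supp_in I"
  shows "cmod (c \<alpha>) \<le> M / r ^ mdegree \<alpha>"
  using I sum M \<alpha>
proof (induction I arbitrary: c g M \<alpha>)
  case empty
  have "((\<lambda>\<alpha>. c \<alpha> * mpow 0 \<alpha>) has_sum g 0) {\<lambda>_. 0}"
    using empty(1)[OF zero_in_polydisc[OF r]] by simp
  then have "g 0 = c (\<lambda>_. 0)"
    using has_sum_finite[of "{\<lambda>_. 0}" "\<lambda>\<alpha>. c \<alpha> * mpow 0 \<alpha>"] has_sum_unique by fastforce
  then show ?case
    using empty(2)[OF zero_in_polydisc[OF r]] empty(3) by simp
next
  case (insert i I)
  have prod: "((\<lambda>p. (c ((snd p)(i := fst p)) * mpow t (snd p)) * s ^ fst p) has_sum g (vec_upd t i s)) (UNIV \<times> supp_in I)"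
    if t: "t \<in> polydisc r" and s: "cmod s < r" for t s
  proof -
    have "((\<lambda>p. c (case p of (\<beta>, n) \<Rightarrow> \<beta>(i := n)) * mpow (vec_upd t i s) (case p of (\<beta>, n) \<Rightarrow> \<beta>(i := n)))
             has_sum g (vec_upd t i s)) (supp_in I \<times> UNIV)"
      using has_sum_reindex_bij_betw[OF bij_betw_supp_in_insert[OF insert(2)],
          of "\<lambda>\<alpha>. c \<alpha> * mpow (vec_upd t i s) \<alpha>"] insert.prems(1)[OF vec_upd_in_polydisc[OF t s]] by simp
    also have "?this \<longleftrightarrow> ((\<lambda>p. (c ((fst p)(i := snd p)) * mpow t (fst p)) * s ^ snd p) has_sum g (vec_upd t i s)) (supp_in I \<times> UNIV)"
    proof (rule has_sum_cong)
      fix p assume "p \<in> supp_in I \<times> (UNIV :: nat set)"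
      then have "fst p i = 0" using insert by (auto simp: supp_in_def)
      then show "c (case p of (\<beta>, n) \<Rightarrow> \<beta>(i := n)) * mpow (vec_upd t i s) (case p of (\<beta>, n) \<Rightarrow> \<beta>(i := n)) =
          (c ((fst p)(i := snd p)) * mpow t (fst p)) * s ^ snd p"
        by (simp add: case_prod_unfold mpow_upd mpow_vec_upd)
    qed
    finally show ?thesis
      by (subst has_sum_swap) (simp add: case_prod_unfold)
  qed
  have "(\<lambda>\<beta>. c (\<beta>(i := n)) * mpow t \<beta>) summable_on supp_in I" if t: "t \<in> polydisc r" for t n
  proof -
    \<comment> \<open>A single nonzero value of the new coordinate suffices: the slice with exponent
      \<open>n\<close> is summable there, and the constant factor \<open>(r / 2) ^ n\<close> can be
      divided out.\<close>
    have "(\<lambda>(k, \<beta>). (c (\<beta>(i := k)) * mpow t \<beta>) * of_real (r / 2) ^ k) summable_on (UNIV \<times> supp_in I)"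
      using prod[OF t, of "of_real (r / 2)"] r by (auto simp: summable_on_def case_prod_unfold)
    from summable_on_SigmaD1[OF this, of n]
    have "(\<lambda>\<beta>. (c (\<beta>(i := n)) * mpow t \<beta>) * of_real (r / 2) ^ n) summable_on supp_in I"
      by simp
    from summable_on_cmult_left[OF this, of "inverse (of_real (r / 2) ^ n)"]
    show ?thesis
      using r by (simp add: mult.assoc)
  qed
  then have G: "((\<lambda>\<beta>. c (\<beta>(i := n)) * mpow t \<beta>) has_sum (\<Sum>\<^sub>\<infinity>\<beta>\<in>supp_in I. c (\<beta>(i := n)) * mpow t \<beta>)) (supp_in I)"
    if "t \<in> polydisc r" for t n
    using that by (simp add: has_sum_infsum)
  let ?G = "\<lambda>n t. \<Sum>\<^sub>\<infinity>\<beta>\<in>supp_in I. c (\<beta>(i := n)) * mpow t \<beta>"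
  have G_bound: "cmod (?G n t) \<le> M / r ^ n" if t: "t \<in> polydisc r" for t n
  proof (rule sums_coeff_bound[OF r, where a = "\<lambda>n. ?G n t"])
    show "(\<lambda>n. ?G n t * s ^ n) sums g (vec_upd t i s)" if "cmod s < r" for s
    proof (rule has_sum_imp_sums, rule has_sum_SigmaD[OF prod[OF t that]])
      show "((\<lambda>\<beta>. (c ((snd (n, \<beta>))(i := fst (n, \<beta>))) * mpow t (snd (n, \<beta>))) * s ^ fst (n, \<beta>)) has_sum ?G n t * s ^ n)
              (supp_in I)" for n
        using has_sum_cmult_left[OF G[OF t, of n], of "s ^ n"] by simp
    qed
    show "cmod (g (vec_upd t i s)) \<le> M" if "cmod s < r" for s
      by (intro insert.prems vec_upd_in_polydisc t that)
  qed
  define n where "n = \<alpha> i"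
  have \<beta>: "\<alpha>(i := 0) \<in> supp_in I"
    using insert.prems(3) by (auto simp: supp_in_def)
  have "cmod (c ((\<alpha>(i := 0))(i := n))) \<le> M / r ^ n / r ^ mdegree (\<alpha>(i := 0))"
    by (rule insert.IH[where c = "\<lambda>\<beta>. c (\<beta>(i := n))", OF G G_bound \<beta>])
  then show ?case
    using mdegree_upd[of "\<alpha>(i := 0)" i n] by (simp add: n_def power_add mult.commute)
qed

lemma multi_series_coeff_bound:
  fixes c :: "('m::finite \<Rightarrow> nat) \<Rightarrow> complex"
  assumes "r > 0"
    and "\<And>t. t \<in> polydisc r \<Longrightarrow> ((\<lambda>\<alpha>. c \<alpha> * mpow t \<alpha>) has_sum g t) UNIV"
    and "\<And>t. t \<in> polydisc r \<Longrightarrow> cmod (g t) \<le> M"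
  shows "cmod (c \<alpha>) \<le> M / r ^ mdegree \<alpha>"
  using multi_series_coeff_bound_partial[of r UNIV c g M \<alpha>] assms by simp

section \<open>Series with holomorphic coefficients\<close>

text \<open>Weierstrass test with majorant \<open>(r' / r) ^ mdegree \<alpha>\<close>, which is
  summable because \<open>r' < r\<close>. The factor is the absolute value of \<open>K\<close>, as
  no sign is assumed for \<open>K\<close>.\<close>

lemma uniform_limit_multi_series:
  fixes x :: "('m::finite \<Rightarrow> nat) \<Rightarrow> 'a \<Rightarrow> complex"
  assumes r: "0 \<le> r'" "r' < r"
    and K: "\<And>\<alpha> q. q \<in> V \<Longrightarrow> cmod (x \<alpha> q) \<le> K / r ^ mdegree \<alpha>"
  shows "uniform_limit (polydisc r' \<times> V) (\<lambda>F (t, q). \<Sum>\<alpha>\<in>F. x \<alpha> q * mpow t \<alpha>)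
           (\<lambda>(t, q). \<Sum>\<^sub>\<infinity>\<alpha>. x \<alpha> q * mpow t \<alpha>) (finite_subsets_at_top UNIV)"
proof -
  have "uniform_limit (polydisc r' \<times> V) (\<lambda>F p. \<Sum>\<alpha>\<in>F. x \<alpha> (snd p) * mpow (fst p) \<alpha>)
           (\<lambda>p. \<Sum>\<^sub>\<infinity>\<alpha>. x \<alpha> (snd p) * mpow (fst p) \<alpha>) (finite_subsets_at_top UNIV)"
  proof (rule Weierstrass_m_test_general)
    show "(\<lambda>\<alpha>. \<bar>K\<bar> * (\<Prod>i\<in>(UNIV :: 'm set). (r' / r) ^ \<alpha> i)) summable_on UNIV"
      using r by (intro summable_on_cmult_right summable_on_multi_geometric) auto
    fix \<alpha> :: "'m \<Rightarrow> nat" and p :: "(complex ^ 'm) \<times> 'a"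
    assume p: "p \<in> polydisc r' \<times> V"
    have "norm (x \<alpha> (snd p) * mpow (fst p) \<alpha>) \<le> \<bar>K\<bar> / r ^ mdegree \<alpha> * (\<Prod>i\<in>UNIV. r' ^ \<alpha> i)"
      unfolding norm_mult norm_mpow
    proof (intro mult_mono prod_mono conjI power_mono)
      have "cmod (x \<alpha> (snd p)) \<le> K / r ^ mdegree \<alpha>"
        using K p by auto
      also have "\<dots> \<le> \<bar>K\<bar> / r ^ mdegree \<alpha>"
        using r by (intro divide_right_mono) auto
      finally show "cmod (x \<alpha> (snd p)) \<le> \<bar>K\<bar> / r ^ mdegree \<alpha>" .
      show "cmod (fst p $ i) \<le> r'" for i
        using p by (auto simp: polydisc_iff less_imp_le)
    qed (use r in \<open>auto intro: prod_nonneg\<close>)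
    also have "\<dots> = \<bar>K\<bar> * (\<Prod>i\<in>UNIV. (r' / r) ^ \<alpha> i)"
      by (simp add: power_divide prod_dividef power_sum)
    finally show "norm (x \<alpha> (snd p) * mpow (fst p) \<alpha>) \<le> \<bar>K\<bar> * (\<Prod>i\<in>UNIV. (r' / r) ^ \<alpha> i)" .
  qed
  then show ?thesis by (simp add: case_prod_unfold)
qed

lemma holo_on_mpow:
  fixes f :: "'a::complex_normed \<Rightarrow> complex ^ 'm"
  assumes "holo_on f S"
  shows "holo_on (\<lambda>z. mpow (f z) \<alpha>) S"
  unfolding mpow_def
  by (intro holo_on_prod holo_on_power holo_on_vec_nth assms holo_on_openD[OF assms])

lemma polydisc_shrink:
  assumes "t \<in> polydisc r" "r > 0"
  obtains r' where "0 < r'" "r' < r" "t \<in> polydisc r'"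
proof -
  define m where "m = Max (range (\<lambda>i. cmod (t $ i)))"
  have m: "cmod (t $ i) \<le> m" for i
    by (simp add: m_def)
  have "m \<in> range (\<lambda>i. cmod (t $ i))"
    unfolding m_def by (rule Max_in) auto
  then have "0 \<le> m" "m < r"
    using assms by (auto simp: polydisc_iff)
  moreover have "cmod (t $ i) < (m + r) / 2" for i
    using m[of i] \<open>m < r\<close> by simp
  ultimately show ?thesis
    by (intro that[of "(m + r) / 2"]) (auto simp: polydisc_iff)
qed

text \<open>Uniform convergence is available on each polydisc of radius \<open>r' < r\<close>; since
  holomorphy is local and every point lies in such a polydisc, the conclusion keeps the radius
  \<open>r\<close>.\<close>

lemma holo_on_multi_series:
  fixes x :: "('m::finite \<Rightarrow> nat) \<Rightarrow> 'a::complex_normed \<Rightarrow> complex"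
  assumes r: "r > 0" and V: "open V" and x: "\<And>\<alpha>. holo_on (x \<alpha>) V"
    and K: "\<And>\<alpha> q. q \<in> V \<Longrightarrow> cmod (x \<alpha> q) \<le> K / r ^ mdegree \<alpha>"
  shows "holo_on (\<lambda>p. \<Sum>\<^sub>\<infinity>\<alpha>. x \<alpha> (snd p) * mpow (fst p) \<alpha>) (polydisc r \<times> V)"
proof (rule holo_on_locally)
  fix p assume "p \<in> (polydisc r :: (complex ^ 'm) set) \<times> V"
  then obtain r' where r': "0 < r'" "r' < r" "fst p \<in> polydisc r'" and p: "snd p \<in> V"
    using polydisc_shrink r by (metis mem_Times_iff)
  let ?T = "(polydisc r' :: (complex ^ 'm) set) \<times> V"
  have T: "open ?T" by (intro open_Times open_polydisc V)
  have "holo_on (\<lambda>p. \<Sum>\<^sub>\<infinity>\<alpha>. x \<alpha> (snd p) * mpow (fst p) \<alpha>) ?T"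
  proof (rule holo_on_uniform_approx[OF T])
    fix e :: real assume e: "e > 0"
    have ul: "uniform_limit ?T (\<lambda>F (t, q). \<Sum>\<alpha>\<in>F. x \<alpha> q * mpow t \<alpha>)
           (\<lambda>(t, q). \<Sum>\<^sub>\<infinity>\<alpha>. x \<alpha> q * mpow t \<alpha>) (finite_subsets_at_top UNIV)"
      by (rule uniform_limit_multi_series[OF less_imp_le[OF r'(1)] r'(2) K])
    from uniform_limitD[OF ul e] have "\<forall>\<^sub>F F in finite_subsets_at_top UNIV. \<forall>p\<in>?T.
        cmod ((\<Sum>\<alpha>\<in>F. x \<alpha> (snd p) * mpow (fst p) \<alpha>) - (\<Sum>\<^sub>\<infinity>\<alpha>. x \<alpha> (snd p) * mpow (fst p) \<alpha>)) < e"
      by (simp add: case_prod_unfold dist_norm)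
    from eventually_happens'[OF finite_subsets_at_top_neq_bot this]
    obtain F where F: "\<forall>p\<in>?T.
        cmod ((\<Sum>\<alpha>\<in>F. x \<alpha> (snd p) * mpow (fst p) \<alpha>) - (\<Sum>\<^sub>\<infinity>\<alpha>. x \<alpha> (snd p) * mpow (fst p) \<alpha>)) < e"
      by blast
    have "holo_on (\<lambda>p. x \<alpha> (snd p)) ?T" for \<alpha>
      by (rule holo_on_compose[OF holo_on_snd[OF T] x]) auto
    moreover have "holo_on (\<lambda>p. mpow (fst p) \<alpha>) ?T" for \<alpha>
      by (rule holo_on_mpow[OF holo_on_fst[OF T]])
    ultimately have "holo_on (\<lambda>p. \<Sum>\<alpha>\<in>F. x \<alpha> (snd p) * mpow (fst p) \<alpha>) ?T"
      by (intro holo_on_sum[OF holo_on_mult T])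
    with F show "\<exists>g. holo_on g ?T \<and> (\<forall>p\<in>?T. cmod (g p - (\<Sum>\<^sub>\<infinity>\<alpha>. x \<alpha> (snd p) * mpow (fst p) \<alpha>)) \<le> e)"
      by (intro exI conjI ballI) (auto intro: less_imp_le)
  qed
  moreover have "?T \<subseteq> polydisc r \<times> V"
    using r'(2) by (auto intro: polydisc_mono)
  ultimately show "\<exists>T. p \<in> T \<and> T \<subseteq> polydisc r \<times> V \<and>
      holo_on (\<lambda>p. \<Sum>\<^sub>\<infinity>\<alpha>. x \<alpha> (snd p) * mpow (fst p) \<alpha>) T"
    using r' p by (intro exI[of _ ?T]) (auto simp: mem_Times_iff)
qed

lemma multi_series_has_sum:
  fixes x :: "('m::finite \<Rightarrow> nat) \<Rightarrow> complex"
  assumes r: "r > 0" and t: "t \<in> polydisc r"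
    and K: "\<And>\<alpha>. cmod (x \<alpha>) \<le> K / r ^ mdegree \<alpha>"
  shows "((\<lambda>\<alpha>. x \<alpha> * mpow t \<alpha>) has_sum (\<Sum>\<^sub>\<infinity>\<alpha>. x \<alpha> * mpow t \<alpha>)) UNIV"
proof -
  have "(\<lambda>\<alpha>. norm (x \<alpha> * mpow t \<alpha>)) summable_on UNIV"
  proof (rule summable_on_comparison_test[OF summable_on_multi_power[OF r t, of K]])
    show "norm (x \<alpha> * mpow t \<alpha>) \<le> K / r ^ mdegree \<alpha> * cmod (mpow t \<alpha>)" for \<alpha>
      unfolding norm_mult by (intro mult_right_mono K) simp
  qed simp
  then show ?thesis
    by (rule has_sum_infsum[OF abs_summable_summable])
qed

lemma has_sum_diff:
  fixes f g :: "'a \<Rightarrow> complex"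
  assumes "(f has_sum a) A" "(g has_sum b) A"
  shows "((\<lambda>x. f x - g x) has_sum (a - b)) A"
  using has_sum_add[OF assms(1) has_sum_uminusI[OF assms(2)]] by simp

lemma has_sum_sum:
  fixes f :: "'i \<Rightarrow> 'a \<Rightarrow> complex"
  assumes "finite I" "\<And>i. i \<in> I \<Longrightarrow> (f i has_sum s i) A"
  shows "((\<lambda>x. \<Sum>i\<in>I. f i x) has_sum (\<Sum>i\<in>I. s i)) A"
  using assms by (induction I) (auto intro: has_sum_add)

lemma mpow_zero_left: "mpow (0 :: complex ^ 'm) \<alpha> = (if \<alpha> = (\<lambda>_. 0) then 1 else 0)"
proof (cases "\<alpha> = (\<lambda>_. 0)")
  case False
  then obtain i where "\<alpha> i \<noteq> 0" by (auto simp: fun_eq_iff)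
  then have "(\<Prod>i\<in>UNIV. (0 :: complex ^ 'm) $ i ^ \<alpha> i) = 0"
    by (intro prod_zero bexI[of _ i]) auto
  with False show ?thesis by (simp add: mpow_def)
qed simp

lemma multi_series_at_zero:
  assumes "((\<lambda>\<alpha>. x \<alpha> * mpow (0 :: complex ^ 'm) \<alpha>) has_sum s) UNIV"
  shows "s = x (\<lambda>_. 0)"
proof -
  have "((\<lambda>\<alpha>. x \<alpha> * mpow (0 :: complex ^ 'm) \<alpha>) has_sum s) UNIV \<longleftrightarrow> (x has_sum s) {\<lambda>_. 0}"
    by (rule has_sum_cong_neutral) (auto simp: mpow_zero_left)
  with assms show ?thesis
    by (simp add: has_sum_finite_iff)
qed

lemma mpow_cwmult: "mpow (cwmult q t) \<alpha> = mpow q \<alpha> * mpow t \<alpha>"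
  by (simp add: mpow_def cwmult_def power_mult_distrib prod.distrib)

lemma norm_mpow_le:
  fixes q :: "complex ^ 'm"
  assumes "\<And>i. cmod (q $ i) \<le> \<rho>"
  shows "cmod (mpow q \<alpha>) \<le> \<rho> ^ mdegree \<alpha>"
  unfolding norm_mpow power_sum using assms by (intro prod_mono conjI power_mono) auto

section \<open>Inverting the linear part\<close>

lemma norm_vec_le_sum: "norm (v :: 'a::real_normed_vector ^ 'n) \<le> (\<Sum>j\<in>UNIV. norm (v $ j))"
  by (simp add: norm_vec_def L2_set_le_sum)

lemma norm_vec_le:
  fixes v :: "'a::real_normed_vector ^ 'n"
  assumes "\<And>j. norm (v $ j) \<le> B"
  shows "norm v \<le> real CARD('n) * B"
  by (rule order_trans[OF norm_vec_le_sum sum_bounded_above[OF assms]])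

lemma matrix_vector_nth: "(A *v v) $ j = (\<Sum>k\<in>UNIV. A $ j $ k * v $ k)"
  by (simp add: matrix_vector_mult_def)

lemma norm_matrix_vector_le:
  fixes A :: "complex ^ 'n ^ 'k"
  shows "norm (A *v v) \<le> (\<Sum>j\<in>UNIV. \<Sum>k\<in>UNIV. cmod (A $ j $ k)) * norm v"
proof -
  have "norm (A *v v) \<le> (\<Sum>j\<in>UNIV. cmod ((A *v v) $ j))"
    by (rule norm_vec_le_sum)
  also have "\<dots> \<le> (\<Sum>j\<in>UNIV. (\<Sum>k\<in>UNIV. cmod (A $ j $ k)) * norm v)"
  proof (rule sum_mono)
    fix j
    have "cmod ((A *v v) $ j) \<le> (\<Sum>k\<in>UNIV. cmod (A $ j $ k * v $ k))"
      unfolding matrix_vector_nth by (rule norm_sum)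
    also have "\<dots> \<le> (\<Sum>k\<in>UNIV. cmod (A $ j $ k) * norm v)"
      unfolding norm_mult by (intro sum_mono mult_left_mono Finite_Cartesian_Product.norm_nth_le) auto
    finally show "cmod ((A *v v) $ j) \<le> (\<Sum>k\<in>UNIV. cmod (A $ j $ k)) * norm v"
      by (simp add: sum_distrib_right)
  qed
  finally show ?thesis
    by (simp add: sum_distrib_right)
qed

lemma holo_on_det:
  fixes A :: "'a::complex_normed \<Rightarrow> complex ^ 'n ^ 'n"
  assumes "\<And>j k. holo_on (\<lambda>z. A z $ j $ k) S"
  shows "holo_on (\<lambda>z. det (A z)) S"
proof -
  have S: "open S" using holo_on_openD[OF assms] .
  have "holo_on (\<lambda>z. of_int (sign p) * (\<Prod>i\<in>UNIV. A z $ i $ p i)) S" for p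
    by (rule holo_on_mult[OF holo_on_const[OF S] holo_on_prod[OF assms S]])
  then show ?thesis
    unfolding det_def by (rule holo_on_sum[OF _ S])
qed

lemma det_nonzero_of_bounded_below:
  fixes A :: "complex ^ 'n ^ 'n"
  assumes "\<kappa> > 0" "\<And>v. \<kappa> * norm v \<le> norm (A *v v)"
  shows "det A \<noteq> 0"
proof -
  have "inj ((*v) A)"
  proof (rule injI)
    fix v w assume "A *v v = A *v w"
    then have "\<kappa> * norm (v - w) \<le> 0"
      using assms(2)[of "v - w"] by (simp add: matrix_vector_mult_diff_distrib)
    then show "v = w"
      using assms(1) by (simp add: mult_le_0_iff)
  qed
  then show ?thesis
    unfolding invertible_det_nz[symmetric] invertible_left_inverse matrix_left_invertible_injective .
qed

text \<open>Solving \<open>g (q t, q) - D q g (t, q) = f (t, q)\<close> coefficientwise: the series \<open>g (q t, q)\<close>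
  is dominated by a geometric series on the whole polydisc, and \<open>g\<close> itself is then bounded
  through \<open>D q g (t, q) = g (q t, q) - f (t, q)\<close>. Hence the constant does not depend on \<open>r\<close>.\<close>

theorem linear_qdifference_solution:
  fixes f :: "(complex ^ 'm) \<times> (complex ^ 'm) \<Rightarrow> complex ^ 'n"
    and D :: "complex ^ 'm \<Rightarrow> complex ^ 'n ^ 'n"
  assumes V: "open V" and D: "\<And>j k. holo_on (\<lambda>q. D q $ j $ k) V"
    and \<rho>: "0 < \<rho>" "\<rho> < 1" "\<And>q i. q \<in> V \<Longrightarrow> cmod (q $ i) \<le> \<rho>"
    and G: "((\<lambda>\<alpha> :: 'm \<Rightarrow> nat. \<rho> ^ mdegree \<alpha>) has_sum G) UNIV"
    and \<kappa>: "\<kappa> > 0" "\<And>q v. q \<in> V \<Longrightarrow> \<kappa> * norm v \<le> norm (D q *v v)"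
      "\<And>q \<alpha> v. q \<in> V \<Longrightarrow> \<alpha> \<noteq> (\<lambda>_. 0) \<Longrightarrow> \<kappa> * norm v \<le> norm (mpow q \<alpha> *s v - D q *v v)"
    and r: "r > 0" and f: "holo_on f (polydisc r \<times> V)"
    and M: "\<And>t q. t \<in> polydisc r \<Longrightarrow> q \<in> V \<Longrightarrow> norm (f (t, q)) \<le> M"
    and f0: "\<And>q. q \<in> V \<Longrightarrow> f (0, q) = 0"
  obtains g where "holo_on g (polydisc r \<times> V)" "\<And>q. q \<in> V \<Longrightarrow> g (0, q) = 0"
    "\<And>t q. t \<in> polydisc r \<Longrightarrow> q \<in> V \<Longrightarrow> g (cwmult q t, q) - D q *v g (t, q) = f (t, q)"
    "\<And>t q. t \<in> polydisc r \<Longrightarrow> q \<in> V \<Longrightarrow>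
       norm (g (t, q)) \<le> (real CARD('n) * real CARD('n) * G / \<kappa> + 1) / \<kappa> * M"
proof -
  have "\<exists>c. (\<forall>\<alpha>. holo_on (c \<alpha>) V) \<and> (\<forall>\<alpha>. \<forall>q\<in>V. cmod (c \<alpha> q) \<le> M / r ^ mdegree \<alpha>) \<and>
         (\<forall>t\<in>polydisc r. \<forall>q\<in>V. ((\<lambda>\<alpha>. c \<alpha> q * mpow t \<alpha>) has_sum f (t, q) $ j) UNIV)" for j
  proof -
    have "cmod (f (t, q) $ j) \<le> M" if "t \<in> polydisc r" "q \<in> V" for t q
      using order_trans[OF Finite_Cartesian_Product.norm_nth_le M[OF that]] .
    then show ?thesis
      by (rule taylor_expansion[OF holo_on_vec_nth[OF f, of j] r V]) blast+
  qed
  then have "\<exists>c. \<forall>j. (\<forall>\<alpha>. holo_on (c j \<alpha>) V) \<and> (\<forall>\<alpha>. \<forall>q\<in>V. cmod (c j \<alpha> q) \<le> M / r ^ mdegree \<alpha>) \<and>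
         (\<forall>t\<in>polydisc r. \<forall>q\<in>V. ((\<lambda>\<alpha>. c j \<alpha> q * mpow t \<alpha>) has_sum f (t, q) $ j) UNIV)"
    by (intro choice allI)
  then obtain c where c: "\<And>j \<alpha>. holo_on (c j \<alpha>) V"
    and c_bound: "\<And>j \<alpha> q. q \<in> V \<Longrightarrow> cmod (c j \<alpha> q) \<le> M / r ^ mdegree \<alpha>"
    and c_sum: "\<And>j t q. t \<in> polydisc r \<Longrightarrow> q \<in> V \<Longrightarrow> ((\<lambda>\<alpha>. c j \<alpha> q * mpow t \<alpha>) has_sum f (t, q) $ j) UNIV"
    by blast
  have c0: "c j (\<lambda>_. 0) q = 0" if "q \<in> V" for j q
    using multi_series_at_zero[OF c_sum[OF zero_in_polydisc[OF r] that, of j]] f0[OF that] by simp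
  define A where "A \<alpha> q = (\<chi> i j. (if i = j then mpow q \<alpha> else 0) - D q $ i $ j)" for \<alpha> q
  have A: "A \<alpha> q *v v = mpow q \<alpha> *s v - D q *v v" for \<alpha> q v
    by (simp add: A_def vec_eq_iff matrix_vector_nth left_diff_distrib sum_subtractf
        if_distrib[of "\<lambda>x. x * _"] cong: if_cong)
  have detA: "det (A \<alpha> q) \<noteq> 0" if "\<alpha> \<noteq> (\<lambda>_. 0)" "q \<in> V" for \<alpha> q
    using \<kappa>(1) \<kappa>(3)[OF that(2,1)] by (intro det_nonzero_of_bounded_below[of \<kappa>]) (auto simp: A)
  have A_holo: "holo_on (\<lambda>q. A \<alpha> q $ i $ j) V" for \<alpha> i j
  proof -
    have "holo_on (\<lambda>q. if i = j then mpow q \<alpha> else 0) V"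
      using V by (cases "i = j") (auto intro: holo_on_mpow holo_on_id holo_on_const)
    from holo_on_diff[OF this D] show ?thesis by (simp add: A_def)
  qed
  \<comment> \<open>Cramer's rule presents the coefficients as quotients of determinants, which
    shows at once that they are holomorphic in \<open>q\<close>. At \<alpha> = 0 the matrix is the
    identity minus \<open>D q\<close>, which may be singular, as the lower bound covers only nonzero
    \<alpha>; the value 0 solves that equation because \<open>c0\<close> makes its right-hand side
    vanish.\<close>
  define x where "x \<alpha> q = (if \<alpha> = (\<lambda>_. 0) then 0 else
      (\<chi> k. det (\<chi> i j. if j = k then c i \<alpha> q else A \<alpha> q $ i $ j) / det (A \<alpha> q)) :: complex ^ 'n)" for \<alpha> q
  have x_eq: "mpow q \<alpha> *s x \<alpha> q - D q *v x \<alpha> q = (\<chi> j. c j \<alpha> q)" if q: "q \<in> V" for \<alpha> q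
  proof (cases "\<alpha> = (\<lambda>_. 0)")
    case True
    then show ?thesis using c0[OF q] by (simp add: x_def vec_eq_iff)
  next
    case False
    then have "x \<alpha> q = (\<chi> k. det (\<chi> i j. if j = k then (\<chi> j. c j \<alpha> q) $ i else A \<alpha> q $ i $ j) / det (A \<alpha> q))"
      by (simp add: x_def cong: if_cong)
    with cramer[OF detA[OF False q]] show ?thesis
      unfolding A[symmetric] by blast
  qed
  have x_holo: "holo_on (\<lambda>q. x \<alpha> q $ k) V" for \<alpha> k
  proof (cases "\<alpha> = (\<lambda>_. 0)")
    case True
    then show ?thesis using V by (simp add: x_def holo_on_const)
  next
    case False
    have "holo_on (\<lambda>q. det (\<chi> i j. if j = k then c i \<alpha> q else A \<alpha> q $ i $ j) / det (A \<alpha> q)) V"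
    proof (intro holo_on_divide holo_on_det A_holo detA False)
      show "holo_on (\<lambda>q. (\<chi> i j. if j = k then c i \<alpha> q else A \<alpha> q $ i $ j) $ i $ j) V" for i j
        by (cases "j = k") (auto intro: c A_holo)
    qed
    with False show ?thesis by (simp add: x_def)
  qed
  \<comment> \<open>The factor \<open>CARD('n)\<close> pays for passing from coordinates of
    \<open>c\<close> to the norm of the vector, and \<open>1 / \<kappa>\<close> for inverting the
    matrix.\<close>
  define K where "K = real CARD('n) * M / \<kappa>"
  have x_norm: "norm (x \<alpha> q) \<le> K / r ^ mdegree \<alpha>" if q: "q \<in> V" for \<alpha> q
  proof -
    have "norm (\<chi> j. c j \<alpha> q) \<le> real CARD('n) * (M / r ^ mdegree \<alpha>)"
      using c_bound[OF q] by (intro norm_vec_le) simp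
    moreover have "\<kappa> * norm (x \<alpha> q) \<le> norm (\<chi> j. c j \<alpha> q)"
    proof (cases "\<alpha> = (\<lambda>_. 0)")
      case True
      then show ?thesis by (simp add: x_def)
    next
      case False
      then show ?thesis using \<kappa>(3)[OF q False, of "x \<alpha> q"] x_eq[OF q] by simp
    qed
    ultimately have "norm (x \<alpha> q) * \<kappa> \<le> real CARD('n) * (M / r ^ mdegree \<alpha>)"
      by (simp add: mult.commute)
    then have "norm (x \<alpha> q) \<le> real CARD('n) * (M / r ^ mdegree \<alpha>) / \<kappa>"
      unfolding pos_le_divide_eq[OF \<kappa>(1)] .
    then show ?thesis
      by (simp add: K_def mult.commute)
  qed
  have x_bound: "cmod (x \<alpha> q $ j) \<le> K / r ^ mdegree \<alpha>" if "q \<in> V" for \<alpha> q j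
    using order_trans[OF Finite_Cartesian_Product.norm_nth_le x_norm[OF that]] .
  define g where "g p = (\<chi> j. \<Sum>\<^sub>\<infinity>\<alpha>. x \<alpha> (snd p) $ j * mpow (fst p) \<alpha>)" for p
  have g_holo: "holo_on g (polydisc r \<times> V)"
  proof (rule holo_on_vec)
    show "holo_on (\<lambda>p. g p $ j) (polydisc r \<times> V)" for j
      using holo_on_multi_series[where x = "\<lambda>\<alpha> q. x \<alpha> q $ j", OF r V x_holo x_bound]
      by (simp add: g_def)
  qed
  have g_sum: "((\<lambda>\<alpha>. x \<alpha> q $ j * mpow t \<alpha>) has_sum g (t, q) $ j) UNIV"
    if "t \<in> polydisc r" "q \<in> V" for t q j
    using multi_series_has_sum[where x = "\<lambda>\<alpha>. x \<alpha> q $ j", OF r that(1) x_bound[OF that(2)]]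
    by (simp add: g_def)
  have g0: "g (0, q) = 0" if "q \<in> V" for q
    using multi_series_at_zero[OF g_sum[OF zero_in_polydisc[OF r] that]]
    by (simp add: vec_eq_iff x_def)
  have qt: "cwmult q t \<in> polydisc r" if "t \<in> polydisc r" "q \<in> V" for t q
    using le_less_trans[OF \<rho>(3)[OF that(2)] \<rho>(2)] that(1) by (rule cwmult_in_polydisc)
  have g_eq: "g (cwmult q t, q) - D q *v g (t, q) = f (t, q)" if t: "t \<in> polydisc r" and q: "q \<in> V" for t q
    unfolding vec_eq_iff
  proof
    fix j
    have "((\<lambda>\<alpha>. x \<alpha> q $ j * mpow (cwmult q t) \<alpha> - (\<Sum>k\<in>UNIV. D q $ j $ k * (x \<alpha> q $ k * mpow t \<alpha>)))
        has_sum (g (cwmult q t, q) $ j - (\<Sum>k\<in>UNIV. D q $ j $ k * g (t, q) $ k))) UNIV"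
      by (intro has_sum_diff has_sum_sum has_sum_cmult_right g_sum qt t q finite)
    also have "(\<lambda>\<alpha>. x \<alpha> q $ j * mpow (cwmult q t) \<alpha> - (\<Sum>k\<in>UNIV. D q $ j $ k * (x \<alpha> q $ k * mpow t \<alpha>)))
        = (\<lambda>\<alpha>. c j \<alpha> q * mpow t \<alpha>)"
    proof
      fix \<alpha>
      have "c j \<alpha> q = (mpow q \<alpha> *s x \<alpha> q - D q *v x \<alpha> q) $ j"
        using x_eq[OF q] by simp
      then show "x \<alpha> q $ j * mpow (cwmult q t) \<alpha> - (\<Sum>k\<in>UNIV. D q $ j $ k * (x \<alpha> q $ k * mpow t \<alpha>))
          = c j \<alpha> q * mpow t \<alpha>"
        by (simp add: mpow_cwmult matrix_vector_nth left_diff_distrib sum_distrib_right mult.assoc mult.left_commute)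
    qed
    finally have "g (cwmult q t, q) $ j - (\<Sum>k\<in>UNIV. D q $ j $ k * g (t, q) $ k) = f (t, q) $ j"
      by (rule has_sum_unique[OF _ c_sum[OF t q]])
    then show "(g (cwmult q t, q) - D q *v g (t, q)) $ j = f (t, q) $ j"
      by (simp add: matrix_vector_nth)
  qed
  have "norm (g (t, q)) \<le> (real CARD('n) * real CARD('n) * G / \<kappa> + 1) / \<kappa> * M"
    if t: "t \<in> polydisc r" and q: "q \<in> V" for t q
  proof -
    have M0: "M \<ge> 0" using M[OF t q] norm_ge_zero order_trans by blast
    have "cmod (g (cwmult q t, q) $ j) \<le> K * G" for j
    proof (rule norm_infsum_le[OF g_sum[OF qt[OF t q] q] has_sum_cmult_right[OF G]])
      fix \<alpha>
      have "norm (x \<alpha> q $ j * mpow (cwmult q t) \<alpha>) =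
          (cmod (x \<alpha> q $ j) * cmod (mpow t \<alpha>)) * cmod (mpow q \<alpha>)"
        by (simp add: mpow_cwmult norm_mult)
      also have "\<dots> \<le> K * \<rho> ^ mdegree \<alpha>"
      proof (rule mult_mono)
        have "cmod (x \<alpha> q $ j) * cmod (mpow t \<alpha>) \<le> K / r ^ mdegree \<alpha> * r ^ mdegree \<alpha>"
          using t M0 \<kappa>(1) r
          by (intro mult_mono x_bound q norm_mpow_le) (auto simp: polydisc_iff K_def intro: less_imp_le)
        then show "cmod (x \<alpha> q $ j) * cmod (mpow t \<alpha>) \<le> K"
          using r by simp
        show "cmod (mpow q \<alpha>) \<le> \<rho> ^ mdegree \<alpha>"
          by (intro norm_mpow_le \<rho> q)
      qed (use M0 \<kappa>(1) in \<open>auto simp: K_def\<close>)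
      finally show "norm (x \<alpha> q $ j * mpow (cwmult q t) \<alpha>) \<le> K * \<rho> ^ mdegree \<alpha>" .
    qed
    then have "norm (g (cwmult q t, q)) \<le> real CARD('n) * (K * G)"
      by (rule norm_vec_le)
    moreover have "D q *v g (t, q) = g (cwmult q t, q) - f (t, q)"
      using g_eq[OF t q] by (simp add: algebra_simps)
    ultimately have "norm (D q *v g (t, q)) \<le> real CARD('n) * (K * G) + M"
      using M[OF t q] norm_triangle_ineq4[of "g (cwmult q t, q)" "f (t, q)"] by simp
    with \<kappa>(2)[OF q, of "g (t, q)"] have "\<kappa> * norm (g (t, q)) \<le> real CARD('n) * (K * G) + M"
      by linarith
    moreover have "real CARD('n) * (K * G) + M = (real CARD('n) * real CARD('n) * G / \<kappa> + 1) * M"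
      by (simp add: K_def algebra_simps)
    ultimately show ?thesis
      using \<kappa>(1) by (simp add: pos_le_divide_eq mult.commute)
  qed
  with g_holo g0 g_eq show ?thesis by (rule that)
qed

section \<open>The partial Jacobian\<close>

text \<open>The derivative is the first Taylor coefficient in \<open>s\<close> of
  \<open>f (w + s *\<^sub>C u)\<close>, with \<open>w\<close> as parameter. The theorem on such
  coefficients needs a bounded function, so the argument is carried out near each point, where
  continuity keeps \<open>f\<close> within 1 of its central value.\<close>

lemma holo_on_directional_deriv:
  fixes f :: "'a::complex_normed \<Rightarrow> complex"
  assumes f: "holo_on f S"
  shows "holo_on (\<lambda>z. deriv (\<lambda>s. f (z + s *\<^sub>C u)) 0) S"
proof (rule holo_on_locally)
  fix z0 assume z0: "z0 \<in> S"
  have S: "open S" using f by (rule holo_on_openD)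
  have "isCont f z0"
    using holo_on_imp_continuous_on[OF f] S z0 continuous_on_eq_continuous_at by blast
  then have "\<forall>\<^sub>F z in nhds z0. dist (f z) (f z0) < 1"
    by (metis isCont_def tendsto_at_iff_tendsto_nhds tendstoD zero_less_one)
  moreover have "\<forall>\<^sub>F z in nhds z0. z \<in> S"
    using S z0 by (rule eventually_nhds_in_open)
  ultimately have "\<forall>\<^sub>F z in nhds z0. z \<in> S \<and> dist (f z) (f z0) < 1"
    by (rule eventually_conj[rotated])
  then obtain \<rho> where \<rho>: "\<rho> > 0" "\<And>z. dist z z0 < \<rho> \<Longrightarrow> z \<in> S \<and> dist (f z) (f z0) < 1"
    unfolding eventually_nhds_metric by blast
  define W where "W = ball z0 (\<rho> / 2)"
  \<comment> \<open>Half of \<open>\<rho>\<close> is spent on \<open>w\<close>, half on the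
    displacement along \<open>u\<close>; adding 1 covers \<open>u = 0\<close>.\<close>
  define r where "r = \<rho> / (2 * (norm u + 1))"
  have nu: "norm u + 1 > 0"
    using norm_ge_zero[of u] by linarith
  have r: "r > 0" using \<rho>(1) nu by (simp add: r_def)
  have near: "dist (w + s *\<^sub>C u) z0 < \<rho>" if "cmod s < r" "w \<in> W" for s w
  proof -
    have "cmod s * norm u \<le> cmod s * (norm u + 1)"
      by (intro mult_left_mono) auto
    also have "\<dots> < r * (norm u + 1)"
      by (intro mult_strict_right_mono that nu)
    also have "\<dots> = \<rho> / 2"
      using nu by (simp add: r_def field_simps)
    finally have "norm (s *\<^sub>C u) < \<rho> / 2"
      by (simp add: norm_scaleC)
    moreover have "dist w z0 < \<rho> / 2"
      using that by (simp add: W_def dist_commute)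
    moreover have "dist (w + s *\<^sub>C u) z0 \<le> dist w z0 + norm (s *\<^sub>C u)"
      using norm_triangle_ineq[of "w - z0" "s *\<^sub>C u"] by (simp add: dist_norm algebra_simps)
    ultimately show ?thesis by simp
  qed
  have BW: "open (ball (0::complex) r \<times> W)"
    by (simp add: W_def open_Times)
  have scal: "holo_on (\<lambda>s. s *\<^sub>C u) UNIV"
    by (intro holo_on_linear bounded_linear_scaleC_left) (auto simp: scaleC_complex_def scaleC_scaleC)
  have "holo_on (\<lambda>p. snd p + fst p *\<^sub>C u) (ball 0 r \<times> W)"
    by (intro holo_on_add holo_on_snd[OF BW] holo_on_compose[OF holo_on_fst[OF BW] scal]) auto
  then have F: "holo_on (\<lambda>p. f (snd p + fst p *\<^sub>C u)) (ball 0 r \<times> W)"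
    by (rule holo_on_compose[OF _ f]) (use near \<rho>(2) in auto)
  have W: "open W" by (simp add: W_def)
  have "cmod (f (snd (s, w) + fst (s, w) *\<^sub>C u)) \<le> cmod (f z0) + 1" if "cmod s < r" "w \<in> W" for s w
  proof -
    have "dist (f (w + s *\<^sub>C u)) (f z0) < 1"
      using near[OF that] \<rho>(2) by blast
    then show ?thesis
      using norm_triangle_sub[of "f (w + s *\<^sub>C u)" "f z0"] by (simp add: dist_norm)
  qed
  from holo_on_taylor_coeff[OF F r W this, where n = 1]
  have "holo_on (\<lambda>w. deriv (\<lambda>s. f (w + s *\<^sub>C u)) 0) W"
    by simp
  moreover have "z0 \<in> W" "W \<subseteq> S"
    using \<rho> by (auto simp: W_def dist_commute)
  ultimately show "\<exists>T. z0 \<in> T \<and> T \<subseteq> S \<and> holo_on (\<lambda>z. deriv (\<lambda>s. f (z + s *\<^sub>C u)) 0) T"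
    by blast
qed

text \<open>A real-linear map that commutes with multiplication by \<open>\<i>\<close> is complex
  linear. This bridges the condition in \<open>holo3_on\<close>, which speaks of \<open>\<i>\<close>
  only, and the one in \<open>holo_on\<close>.\<close>

lemma scaleC_Re_Im: "c *\<^sub>C x = Re c *\<^sub>R x + Im c *\<^sub>R (\<i> *\<^sub>C (x :: 'a :: complex_normed))"
proof -
  have "c *\<^sub>C x = (complex_of_real (Re c) + complex_of_real (Im c) * \<i>) *\<^sub>C x"
    using complex_eq[of c] by (simp add: mult.commute)
  then show ?thesis
    by (simp only: scaleC_add_left scaleC_of_real scaleC_scaleC[symmetric])
qed

lemma holo3_on_imp_holo_on:
  fixes f :: "(complex ^ 'a) \<times> (complex ^ 'b) \<times> (complex ^ 'c) \<Rightarrow> complex ^ 'd"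
  assumes "holo3_on f S"
  shows "holo_on f S"
  unfolding holo_on_def
proof (intro conjI ballI)
  show "open S" using assms by (simp add: holo3_on_def)
  fix z assume "z \<in> S"
  then obtain L where L: "(f has_derivative L) (at z)"
    and Li: "\<And>u v w. L (\<i> *s u, \<i> *s v, \<i> *s w) = \<i> *s L (u, v, w)"
    using assms unfolding holo3_on_def by blast
  have lin: "linear L" using L by (rule has_derivative_linear)
  have "L (\<i> *\<^sub>C x) = \<i> *\<^sub>C L x" for x
    using Li[of "fst x" "fst (snd x)" "snd (snd x)"] by (simp add: scaleC_prod_def scaleC_vec_complex)
  then have "L (c *\<^sub>C x) = c *\<^sub>C L x" for c x
    unfolding scaleC_Re_Im[of c] by (simp add: linear_add[OF lin] linear_scale[OF lin])
  with L show "\<exists>L. (f has_derivative L) (at z) \<and> (\<forall>c u. L (c *\<^sub>C u) = c *\<^sub>C L u)"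
    by blast
qed

lemma holo_on_imp_holo2_on:
  fixes f :: "(complex ^ 'a) \<times> (complex ^ 'b) \<Rightarrow> complex ^ 'd"
  assumes "holo_on f S"
  shows "holo2_on f S"
  unfolding holo2_on_def
proof (intro conjI ballI)
  show "open S" using assms by (rule holo_on_openD)
  fix z assume "z \<in> S"
  then obtain L where L: "(f has_derivative L) (at z)" "\<And>c u. L (c *\<^sub>C u) = c *\<^sub>C L u"
    using holo_onE[OF assms] by blast
  have "L (\<i> *s u, \<i> *s v) = \<i> *s L (u, v)" for u v
    using L(2)[of \<i> "(u, v)"] by (simp add: scaleC_prod_def scaleC_vec_complex)
  with L(1) show "\<exists>L. (f has_derivative L) (at z) \<and> (\<forall>u v. L (\<i> *s u, \<i> *s v) = \<i> *s L (u, v))"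
    by blast
qed

text \<open>The mean value estimate needs the Jacobian in \<open>y\<close> at all points near
  \<open>(0, 0, q0)\<close>; \<open>jac_y\<close> is its restriction to \<open>t = 0\<close> and
  \<open>y = 0\<close>.\<close>

definition partial_jac ::
  "(complex ^ 'm \<Rightarrow> complex ^ 'n \<Rightarrow> complex ^ 'm \<Rightarrow> complex ^ 'n) \<Rightarrow>
   (complex ^ 'm) \<times> (complex ^ 'n) \<times> (complex ^ 'm) \<Rightarrow> complex ^ 'n ^ 'n" where
  "partial_jac H z = (\<chi> j k. deriv (\<lambda>s. H (fst z) (fst (snd z) + s *s axis k 1) (snd (snd z)) $ j) 0)"

lemma jac_y_eq_partial_jac: "jac_y H q = partial_jac H (0, 0, q)"
  by (simp add: jac_y_def partial_jac_def)

lemma partial_jac_line: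
  "partial_jac H z $ j $ k = deriv (\<lambda>s. (\<lambda>(t, y, q). H t y q) (z + s *\<^sub>C (0, axis k 1, 0)) $ j) 0"
  by (simp add: partial_jac_def case_prod_unfold scaleC_prod_def scaleC_vec_complex)

lemma holo_on_partial_jac:
  assumes "holo_on (\<lambda>(t, y, q). H t y q) S"
  shows "holo_on (\<lambda>z. partial_jac H z $ j $ k) S"
  unfolding partial_jac_line by (rule holo_on_directional_deriv[OF holo_on_vec_nth[OF assms]])

text \<open>The matrix entries are one-variable derivatives along the axes. Expanding
  \<open>(0, v, 0)\<close> in the axes and using complex linearity of the full derivative shows that
  they assemble into the derivative in \<open>y\<close>.\<close>

lemma partial_jac_has_derivative:
  assumes H: "holo_on (\<lambda>(t, y, q). H t y q) S" and z: "(t, y, q) \<in> S"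
  shows "((\<lambda>y. H t y q) has_derivative (\<lambda>v. partial_jac H (t, y, q) *v v)) (at y)"
proof -
  let ?H = "\<lambda>(t, y, q). H t y q"
  obtain L where L: "(?H has_derivative L) (at (t, y, q))" "\<And>c u. L (c *\<^sub>C u) = c *\<^sub>C L u"
    using holo_onE[OF H z] by blast
  have lin: "linear L" using L(1) by (rule has_derivative_linear)
  have "((\<lambda>y. (t, y, q)) has_derivative (\<lambda>v. (0, v, 0))) (at y)"
    by (intro has_derivative_Pair has_derivative_const has_derivative_ident)
  from has_derivative_compose[OF this L(1)]
  have "((\<lambda>y. H t y q) has_derivative (\<lambda>v. L (0, v, 0))) (at y)"
    by simp
  moreover have "L (0, v, 0) = partial_jac H (t, y, q) *v v" for v
    unfolding vec_eq_iff
  proof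
    fix j
    have Lj: "((\<lambda>z. ?H z $ j) has_derivative (\<lambda>u. L u $ j)) (at (t, y, q))"
      using bounded_linear.has_derivative[OF bounded_linear_vec_nth L(1)] .
    have "L (c *\<^sub>C u) $ j = c *\<^sub>C (L u $ j)" for c u
      by (simp add: L(2) scaleC_vec_def)
    from DERIV_imp_deriv[OF deriv_line[OF Lj this]]
    have J: "partial_jac H (t, y, q) $ j $ k = L (0, axis k 1, 0) $ j" for k
      unfolding partial_jac_line .
    have "(0, v, 0) = (\<Sum>k\<in>UNIV. v $ k *\<^sub>C (0 :: complex ^ _, axis k 1 :: complex ^ _, 0 :: complex ^ _))"
      by (simp add: scaleC_prod_def scaleC_vec_complex sum_prod basis_expansion)
    then have "L (0, v, 0) = L (\<Sum>k\<in>UNIV. v $ k *\<^sub>C (0, axis k 1, 0))"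
      by (rule arg_cong)
    also have "\<dots> = (\<Sum>k\<in>UNIV. L (v $ k *\<^sub>C (0, axis k 1, 0)))"
      by (rule linear_sum[OF lin])
    finally have "L (0, v, 0) = (\<Sum>k\<in>UNIV. v $ k *\<^sub>C L (0, axis k 1, 0))"
      by (simp only: L(2))
    then show "L (0, v, 0) $ j = (partial_jac H (t, y, q) *v v) $ j"
      by (simp add: matrix_vector_nth J scaleC_vec_complex mult.commute)
  qed
  ultimately show ?thesis by simp
qed

text \<open>For fixed \<open>t\<close> and \<open>q\<close> the derivative in \<open>y\<close> of
  \<open>H t y q - jac_y H q *v y\<close> is the difference of the Jacobians at
  \<open>(t, y, q)\<close> and \<open>(0, 0, q)\<close>. Continuity makes it small near
  \<open>(0, 0, q0)\<close>, and the mean value inequality on the convex ball of radius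
  \<open>d\<close> concludes. The matrix at \<open>q\<close>, not at \<open>q0\<close>, is
  subtracted because the equation at \<open>q\<close> is solved coefficientwise with that
  matrix.\<close>

lemma remainder_lipschitz:
  fixes H :: "complex ^ 'm \<Rightarrow> complex ^ 'n \<Rightarrow> complex ^ 'm \<Rightarrow> complex ^ 'n"
  assumes H: "holo_on (\<lambda>(t, y, q). H t y q) S" and z0: "(0, 0, q0) \<in> S" and e: "e > 0"
  obtains d where "d > 0"
    "\<And>t y q. norm t < d \<Longrightarrow> norm y < d \<Longrightarrow> dist q q0 < d \<Longrightarrow> (t, y, q) \<in> S"
    "\<And>t y y' q. norm t < d \<Longrightarrow> norm y < d \<Longrightarrow> norm y' < d \<Longrightarrow> dist q q0 < d \<Longrightarrow>
       norm ((H t y q - jac_y H q *v y) - (H t y' q - jac_y H q *v y')) \<le> e * norm (y - y')"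
proof -
  let ?J = "partial_jac H"
  \<comment> \<open>Both Jacobians are compared with the one at \<open>(0, 0, q0)\<close>, so an
    entry of their difference is at most \<open>2 * e'\<close>; summing over the
    \<open>CARD('n) * CARD('n)\<close> entries gives \<open>e\<close>.\<close>
  define e' where "e' = e / (2 * (real CARD('n) * real CARD('n)))"
  have e': "e' > 0" using e by (simp add: e'_def)
  have S: "open S" using H by (rule holo_on_openD)
  have "\<forall>\<^sub>F z in nhds (0, 0, q0). cmod (?J z $ j $ k - ?J (0, 0, q0) $ j $ k) < e'" for j k
  proof -
    have "isCont (\<lambda>z. ?J z $ j $ k) (0, 0, q0)"
      using holo_on_imp_continuous_on[OF holo_on_partial_jac[OF H]] S z0
        continuous_on_eq_continuous_at by blast
    then have "((\<lambda>z. ?J z $ j $ k) \<longlongrightarrow> ?J (0, 0, q0) $ j $ k) (nhds (0, 0, q0))"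
      unfolding isCont_def by (rule tendsto_at_iff_tendsto_nhds[of "\<lambda>z. ?J z $ j $ k", THEN iffD1])
    from tendstoD[OF this e'] show ?thesis by (simp add: dist_norm)
  qed
  then have "\<forall>\<^sub>F z in nhds (0, 0, q0). z \<in> S \<and> (\<forall>j k. cmod (?J z $ j $ k - ?J (0, 0, q0) $ j $ k) < e')"
    by (intro eventually_conj eventually_nhds_in_open[OF S z0] eventually_all_finite)
  then obtain d0 where d0: "d0 > 0"
    "\<And>z. dist z (0, 0, q0) < d0 \<Longrightarrow> z \<in> S \<and> (\<forall>j k. cmod (?J z $ j $ k - ?J (0, 0, q0) $ j $ k) < e')"
    unfolding eventually_nhds_metric by blast
  define d where "d = d0 / 3"
  have d: "d > 0" using d0(1) by (simp add: d_def)
  have near: "dist (t, y, q) (0, 0, q0) < d0" if "norm t < d" "norm y < d" "dist q q0 < d"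
    for t :: "complex ^ 'm" and y :: "complex ^ 'n" and q
  proof -
    have "dist (t, y, q) (0, 0, q0) = norm (t, y, q - q0)"
      by (simp add: dist_norm)
    also have "\<dots> \<le> norm t + (norm y + norm (q - q0))"
      by (rule order_trans[OF norm_Pair_le add_left_mono[OF norm_Pair_le]])
    also have "\<dots> < d0"
      using that by (simp add: d_def dist_norm)
    finally show ?thesis .
  qed
  have "norm ((H t y q - jac_y H q *v y) - (H t y' q - jac_y H q *v y')) \<le> e * norm (y - y')"
    if t: "norm t < d" and y: "norm y < d" "norm y' < d" and q: "dist q q0 < d" for t y y' q
  proof (rule differentiable_bound[where S = "ball 0 d" and f' = "\<lambda>y v. ?J (t, y, q) *v v - jac_y H q *v v"])
    fix y :: "complex ^ 'n" assume "y \<in> ball 0 d"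
    then have y: "norm y < d" by simp
    have "(t, y, q) \<in> S" using d0(2)[OF near[OF t y q]] by blast
    from partial_jac_has_derivative[OF H this]
    have "((\<lambda>y. H t y q) has_derivative (\<lambda>v. ?J (t, y, q) *v v)) (at y)" .
    moreover have "bounded_linear (\<lambda>v. jac_y H q *v v)"
    proof (rule bounded_linear_intro[where K = "\<Sum>j\<in>UNIV. \<Sum>k\<in>UNIV. cmod (jac_y H q $ j $ k)"])
      show "norm (jac_y H q *v v) \<le> norm v * (\<Sum>j\<in>UNIV. \<Sum>k\<in>UNIV. cmod (jac_y H q $ j $ k))" for v
        using norm_matrix_vector_le[of "jac_y H q" v] by (simp add: mult.commute)
    qed (auto simp: matrix_vector_right_distrib vec_eq_iff matrix_vector_nth scaleR_right.sum)
    ultimately show "((\<lambda>y. H t y q - jac_y H q *v y) has_derivative (\<lambda>v. ?J (t, y, q) *v v - jac_y H q *v v))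
        (at y within ball 0 d)"
      by (intro has_derivative_at_withinI[OF has_derivative_diff] bounded_linear_imp_has_derivative)
    have entry: "cmod ((?J (t, y, q) - jac_y H q) $ j $ k) \<le> 2 * e'" for j k
    proof -
      have "cmod (?J (t, y, q) $ j $ k - ?J (0, 0, q0) $ j $ k) < e'"
        using d0(2)[OF near[OF t y q]] by blast
      moreover have "cmod (?J (0, 0, q) $ j $ k - ?J (0, 0, q0) $ j $ k) < e'"
        using d0(2)[OF near[OF _ _ q, of 0 0]] d by simp
      ultimately show ?thesis
        using norm_triangle_ineq4[of "?J (t, y, q) $ j $ k - ?J (0, 0, q0) $ j $ k" "?J (0, 0, q) $ j $ k - ?J (0, 0, q0) $ j $ k"]
        by (simp add: jac_y_eq_partial_jac)
    qed
    show "onorm (\<lambda>v. ?J (t, y, q) *v v - jac_y H q *v v) \<le> e"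
    proof (rule onorm_le)
      fix v
      have "norm (?J (t, y, q) *v v - jac_y H q *v v) = norm ((?J (t, y, q) - jac_y H q) *v v)"
        by (simp add: matrix_vector_mult_diff_rdistrib)
      also have "\<dots> \<le> (\<Sum>j\<in>UNIV. \<Sum>k\<in>UNIV. cmod ((?J (t, y, q) - jac_y H q) $ j $ k)) * norm v"
        by (rule norm_matrix_vector_le)
      also have "\<dots> \<le> (\<Sum>j\<in>(UNIV :: 'n set). \<Sum>k\<in>(UNIV :: 'n set). 2 * e') * norm v"
        by (intro mult_right_mono sum_mono entry) simp
      also have "\<dots> = e * norm v"
        by (simp add: e'_def)
      finally show "norm (?J (t, y, q) *v v - jac_y H q *v v) \<le> e * norm v" .
    qed
  qed (use y in auto)
  moreover have "(t, y, q) \<in> S" if "norm t < d" "norm y < d" "dist q q0 < d" for t y q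
    using d0(2)[OF near[OF that]] by blast
  ultimately show ?thesis
    using that[OF d] by blast
qed

section \<open>Nonresonance\<close>

text \<open>In finite dimension an injective linear map is bounded below by some \<open>B\<close>,
  and a perturbation of size at most \<open>B / 2\<close> leaves at least \<open>B / 2\<close>. With
  \<open>c = 0\<close> this treats \<open>D\<close> itself, with
  \<open>c q = mpow q \<alpha>\<close> the matrix belonging to \<alpha>.\<close>

lemma bounded_below_near:
  fixes D :: "'a::metric_space \<Rightarrow> complex ^ 'n ^ 'n"
  assumes D: "\<And>j k. isCont (\<lambda>q. D q $ j $ k) q0" and c: "isCont c q0"
    and no_ev: "\<not> cmat_eigenvalue (D q0) (c q0)"
  obtains \<kappa> where "\<kappa> > 0" "\<forall>\<^sub>F q in nhds q0. \<forall>v. \<kappa> * norm v \<le> norm (c q *s v - D q *v v)"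
proof -
  let ?L = "\<lambda>v. c q0 *s v - D q0 *v v"
  have lin: "linear ?L"
    by (rule linearI)
       (simp_all add: matrix_vector_right_distrib vec_eq_iff matrix_vector_nth algebra_simps scaleR_right.sum
         scaleR_right_diff_distrib)
  have "v = 0" if "?L v = 0" for v
    using that no_ev unfolding cmat_eigenvalue_def by force
  then have "inj ?L"
    using linear_injective_0[OF lin] by blast
  then obtain B where B: "B > 0" "\<And>v. B * norm v \<le> norm (?L v)"
    using linear_inj_bounded_below_pos[OF lin] by blast
  let ?E = "\<lambda>q. cmod (c q - c q0) + (\<Sum>j\<in>UNIV. \<Sum>k\<in>UNIV. cmod ((D q - D q0) $ j $ k))"
  have "isCont ?E q0"
    using D c by (auto intro!: continuous_intros)
  then have "(?E \<longlongrightarrow> ?E q0) (nhds q0)"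
    unfolding isCont_def by (rule tendsto_at_iff_tendsto_nhds[of ?E, THEN iffD1])
  then have "\<forall>\<^sub>F q in nhds q0. ?E q < B / 2"
    using B(1) by (intro order_tendstoD(2)[of ?E "?E q0"]) auto
  then have "\<forall>\<^sub>F q in nhds q0. \<forall>v. B / 2 * norm v \<le> norm (c q *s v - D q *v v)"
  proof eventually_elim
    case (elim q)
    show ?case
    proof
      fix v
      have split: "c q *s v - D q *v v = ?L v + ((c q - c q0) *s v - (D q - D q0) *v v)"
        by (simp add: matrix_vector_mult_diff_rdistrib vec_eq_iff algebra_simps)
      have "norm ((c q - c q0) *s v - (D q - D q0) *v v) \<le> norm ((c q - c q0) *s v) + norm ((D q - D q0) *v v)"
        by (rule norm_triangle_ineq4)
      also have "\<dots> \<le> ?E q * norm v"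
        using norm_matrix_vector_le[of "D q - D q0" v]
        by (simp add: scaleC_vec_complex[symmetric] norm_scaleC distrib_right)
      also have "\<dots> \<le> B / 2 * norm v"
        using elim by (intro mult_right_mono) auto
      finally have "norm ((c q - c q0) *s v - (D q - D q0) *v v) \<le> B / 2 * norm v" .
      moreover have "norm (?L v) - norm ((c q - c q0) *s v - (D q - D q0) *v v) \<le> norm (c q *s v - D q *v v)"
        unfolding split by (rule norm_diff_ineq)
      ultimately show "B / 2 * norm v \<le> norm (c q *s v - D q *v v)"
        using B(2)[of v] by simp
    qed
  qed
  then show ?thesis
    using B(1) by (intro that[of "B / 2"]) auto
qed

lemma finite_mdegree_less: "finite {\<alpha> :: 'm::finite \<Rightarrow> nat. mdegree \<alpha> < N}"
proof (rule finite_subset)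
  show "{\<alpha> :: 'm \<Rightarrow> nat. mdegree \<alpha> < N} \<subseteq> PiE UNIV (\<lambda>_. {..<N})"
  proof
    fix \<alpha> :: "'m \<Rightarrow> nat" assume "\<alpha> \<in> {\<alpha>. mdegree \<alpha> < N}"
    then have "\<alpha> i < N" for i
      using member_le_sum[of i UNIV \<alpha>] by simp
    then show "\<alpha> \<in> PiE UNIV (\<lambda>_. {..<N})" by auto
  qed
qed (auto intro: finite_PiE)

text \<open>Each \<alpha> has its own neighbourhood and its own constant, so only finitely many can
  be treated separately. If the degree is at least \<open>N\<close>, then
  \<open>mpow q \<alpha>\<close> has modulus below \<open>\<kappa>0 / 2\<close> whenever the
  coordinates of \<open>q\<close> are at most \<open>\<rho>\<close>, and the lower bound
  \<open>\<kappa>0\<close> for \<open>D q\<close> prevails. The minimum defining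
  \<open>\<kappa>\<close> thus runs over a finite set.\<close>

lemma nonresonance_bounded_below:
  fixes D :: "complex ^ 'm \<Rightarrow> complex ^ 'n ^ 'n"
  assumes D: "\<And>j k. isCont (\<lambda>q. D q $ j $ k) q0"
    and \<rho>: "0 < \<rho>" "\<rho> < 1" "\<And>i. cmod (q0 $ i) < \<rho>"
    and nonres: "\<And>c. cmat_eigenvalue (D q0) c \<Longrightarrow> c \<noteq> 0 \<and> (\<forall>\<alpha>. \<alpha> \<noteq> (\<lambda>_. 0) \<longrightarrow> c \<noteq> mpow q0 \<alpha>)"
  obtains \<kappa> where "\<kappa> > 0" "\<forall>\<^sub>F q in nhds q0. (\<forall>i. cmod (q $ i) < \<rho>) \<and>
      (\<forall>v. \<kappa> * norm v \<le> norm (D q *v v)) \<and>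
      (\<forall>\<alpha> v. \<alpha> \<noteq> (\<lambda>_. 0) \<longrightarrow> \<kappa> * norm v \<le> norm (mpow q \<alpha> *s v - D q *v v))"
proof -
  have "\<not> cmat_eigenvalue (D q0) 0"
    using nonres by blast
  with bounded_below_near[where D = D and c = "\<lambda>_. 0", OF D]
  obtain \<kappa>0 where \<kappa>0: "\<kappa>0 > 0" "\<forall>\<^sub>F q in nhds q0. \<forall>v. \<kappa>0 * norm v \<le> norm (D q *v v)"
    by auto
  have cont: "isCont (\<lambda>q. mpow q \<alpha>) q0" for \<alpha>
    unfolding mpow_def by (intro continuous_intros)
  have "\<exists>\<kappa>>0. \<forall>\<^sub>F q in nhds q0. \<forall>v. \<kappa> * norm v \<le> norm (mpow q \<alpha> *s v - D q *v v)"
    if "\<alpha> \<noteq> (\<lambda>_. 0)" for \<alpha>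
  proof -
    have "\<not> cmat_eigenvalue (D q0) (mpow q0 \<alpha>)" using nonres that by blast
    then show ?thesis
      by (rule bounded_below_near[where D = D and c = "\<lambda>q. mpow q \<alpha>", OF D cont]) blast
  qed
  then have "\<forall>\<alpha>. \<exists>\<kappa>. \<alpha> \<noteq> (\<lambda>_. 0) \<longrightarrow> \<kappa> > 0 \<and>
      (\<forall>\<^sub>F q in nhds q0. \<forall>v. \<kappa> * norm v \<le> norm (mpow q \<alpha> *s v - D q *v v))"
    by blast
  then have "\<exists>\<kappa>'. \<forall>\<alpha>. \<alpha> \<noteq> (\<lambda>_. 0) \<longrightarrow> \<kappa>' \<alpha> > 0 \<and>
      (\<forall>\<^sub>F q in nhds q0. \<forall>v. \<kappa>' \<alpha> * norm v \<le> norm (mpow q \<alpha> *s v - D q *v v))"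
    by (rule choice)
  then obtain \<kappa>' where \<kappa>': "\<And>\<alpha>. \<alpha> \<noteq> (\<lambda>_. 0) \<Longrightarrow> \<kappa>' \<alpha> > 0"
    "\<And>\<alpha>. \<alpha> \<noteq> (\<lambda>_. 0) \<Longrightarrow> \<forall>\<^sub>F q in nhds q0. \<forall>v. \<kappa>' \<alpha> * norm v \<le> norm (mpow q \<alpha> *s v - D q *v v)"
    by blast
  obtain N where N: "\<rho> ^ N < \<kappa>0 / 2"
    using real_arch_pow_inv[of "\<kappa>0 / 2" \<rho>] \<kappa>0(1) \<rho>(2) by auto
  define A where "A = {\<alpha> :: 'm \<Rightarrow> nat. mdegree \<alpha> < N} - {\<lambda>_. 0}"
  have A: "finite A" unfolding A_def using finite_mdegree_less by blast
  define \<kappa> where "\<kappa> = Min (insert (\<kappa>0 / 2) (\<kappa>' ` A))"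
  have \<kappa>: "\<kappa> > 0"
    unfolding \<kappa>_def using A \<kappa>0(1) \<kappa>'(1) by (subst Min_gr_iff) (auto simp: A_def)
  have \<kappa>_le: "\<kappa> \<le> \<kappa>0 / 2" "\<alpha> \<in> A \<Longrightarrow> \<kappa> \<le> \<kappa>' \<alpha>" for \<alpha>
    unfolding \<kappa>_def using A by (intro Min_le; simp)+
  have "\<forall>\<^sub>F q in nhds q0. \<forall>\<alpha>\<in>A. \<forall>v. \<kappa>' \<alpha> * norm v \<le> norm (mpow q \<alpha> *s v - D q *v v)"
    using A \<kappa>'(2) by (intro eventually_ball_finite) (auto simp: A_def)
  moreover have "\<forall>\<^sub>F q in nhds q0. q \<in> polydisc \<rho>"
    using \<rho>(3) by (intro eventually_nhds_in_open open_polydisc) (simp add: polydisc_iff)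
  ultimately have "\<forall>\<^sub>F q in nhds q0. (\<forall>i. cmod (q $ i) < \<rho>) \<and> (\<forall>v. \<kappa> * norm v \<le> norm (D q *v v)) \<and>
      (\<forall>\<alpha> v. \<alpha> \<noteq> (\<lambda>_. 0) \<longrightarrow> \<kappa> * norm v \<le> norm (mpow q \<alpha> *s v - D q *v v))"
    using \<kappa>0(2)
  proof eventually_elim
    case (elim q)
    have q: "cmod (q $ i) \<le> \<rho>" for i
      using elim(2) by (simp add: polydisc_iff less_imp_le)
    have D_below: "\<kappa>0 * norm v \<le> norm (D q *v v)" for v
      using elim(3) by blast
    have "\<kappa> * norm v \<le> norm (mpow q \<alpha> *s v - D q *v v)" if \<alpha>: "\<alpha> \<noteq> (\<lambda>_. 0)" for \<alpha> v
    proof (cases "\<alpha> \<in> A")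
      case True
      with elim(1) have "\<kappa>' \<alpha> * norm v \<le> norm (mpow q \<alpha> *s v - D q *v v)" by blast
      moreover have "\<kappa> * norm v \<le> \<kappa>' \<alpha> * norm v"
        by (intro mult_right_mono \<kappa>_le(2) True) simp
      ultimately show ?thesis by linarith
    next
      case False
      with \<alpha> have "N \<le> mdegree \<alpha>" by (auto simp: A_def)
      then have "\<rho> ^ mdegree \<alpha> \<le> \<rho> ^ N"
        using \<rho>(1,2) by (intro power_decreasing) auto
      with norm_mpow_le[OF q, of \<alpha>] N have "cmod (mpow q \<alpha>) \<le> \<kappa>0 / 2"
        by linarith
      then have "norm (mpow q \<alpha> *s v) \<le> \<kappa>0 / 2 * norm v"
        unfolding scaleC_vec_complex[symmetric] norm_scaleC by (rule mult_right_mono) simp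
      moreover have "norm (D q *v v) - norm (mpow q \<alpha> *s v) \<le> norm (mpow q \<alpha> *s v - D q *v v)"
        using norm_triangle_ineq2[of "D q *v v" "mpow q \<alpha> *s v"] by (simp add: norm_minus_commute)
      moreover have "\<kappa> * norm v \<le> \<kappa>0 / 2 * norm v"
        by (intro mult_right_mono \<kappa>_le(1)) simp
      ultimately show ?thesis
        using D_below[of v] by (simp add: field_simps)
    qed
    moreover have "\<kappa> * norm v \<le> norm (D q *v v)" for v
    proof -
      have "\<kappa> * norm v \<le> \<kappa>0 * norm v"
        using \<kappa>_le(1) \<kappa>0(1) by (intro mult_right_mono) auto
      with D_below[of v] show ?thesis by linarith
    qed
    ultimately show ?case
      using elim(2) by (simp add: polydisc_iff)
  qed
  with \<kappa> show ?thesis by (rule that)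
qed

section \<open>Uniqueness\<close>

lemma eventually_polydisc:
  fixes P :: "complex ^ 'm \<Rightarrow> bool"
  assumes "\<forall>\<^sub>F t in nhds 0. P t"
  obtains r where "r > 0" "\<And>t. t \<in> polydisc r \<Longrightarrow> P t"
proof -
  obtain e where e: "e > 0" "\<And>t. dist t 0 < e \<Longrightarrow> P t"
    using assms unfolding eventually_nhds_metric by blast
  show ?thesis
  proof (rule that[of "e / (2 * real CARD('m))"])
    fix t :: "complex ^ 'm" assume "t \<in> polydisc (e / (2 * real CARD('m)))"
    then have "norm t \<le> real CARD('m) * (e / (2 * real CARD('m)))"
      by (intro norm_vec_le) (simp add: polydisc_iff less_imp_le)
    then show "P t"
      using e by simp
  qed (use e in simp)
qed

text \<open>Absolute convergence at the point with all coordinates \<open>r / 2\<close> gives a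
  finite sum of the moduli. Shrinking to radius \<open>s\<close> multiplies a term of degree at
  least \<open>N\<close> by at most \<open>(s / (r / 2)) ^ N\<close>. The constant does not depend
  on \<open>s\<close>, which is later sent to 0.\<close>

lemma multi_series_order_bound:
  fixes x :: "('m::finite \<Rightarrow> nat) \<Rightarrow> complex"
  assumes r: "r > 0" and sum: "\<And>t. t \<in> polydisc r \<Longrightarrow> ((\<lambda>\<alpha>. x \<alpha> * mpow t \<alpha>) has_sum g t) UNIV"
    and N: "\<And>\<alpha>. mdegree \<alpha> < N \<Longrightarrow> x \<alpha> = 0"
  obtains K where "K \<ge> 0" "\<And>s t. 0 < s \<Longrightarrow> s \<le> r / 2 \<Longrightarrow> t \<in> polydisc s \<Longrightarrow> cmod (g t) \<le> K * s ^ N"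
proof -
  define w :: "complex ^ 'm" where "w = (\<chi> i. of_real (r / 2))"
  have "w \<in> polydisc r" using r by (simp add: w_def polydisc_iff)
  from sum[OF this] have "(\<lambda>\<alpha>. x \<alpha> * mpow w \<alpha>) summable_on UNIV"
    by (auto simp: summable_on_def)
  then have "(\<lambda>\<alpha>. norm (x \<alpha> * mpow w \<alpha>)) summable_on UNIV"
    by (rule summable_on_iff_abs_summable_on_complex[THEN iffD1])
  moreover have "norm (x \<alpha> * mpow w \<alpha>) = cmod (x \<alpha>) * (r / 2) ^ mdegree \<alpha>" for \<alpha>
    using r by (simp add: norm_mult norm_mpow w_def power_sum norm_divide)
  ultimately have "(\<lambda>\<alpha>. cmod (x \<alpha>) * (r / 2) ^ mdegree \<alpha>) summable_on UNIV"
    by simp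
  then obtain K where K: "((\<lambda>\<alpha>. cmod (x \<alpha>) * (r / 2) ^ mdegree \<alpha>) has_sum K) UNIV"
    by (auto simp: summable_on_def)
  have K0: "K \<ge> 0"
    using K by (rule has_sum_nonneg) (use r in auto)
  show ?thesis
  proof (rule that[of "K / (r / 2) ^ N"])
    fix s :: real and t :: "complex ^ 'm"
    assume s: "0 < s" "s \<le> r / 2" and t: "t \<in> polydisc s"
    have tr: "t \<in> polydisc r"
      using s r by (intro polydisc_mono[OF t]) simp
    have "cmod (g t) \<le> K * (s / (r / 2)) ^ N"
    proof (rule norm_infsum_le[OF sum[OF tr] has_sum_cmult_left[OF K]])
      fix \<alpha> :: "'m \<Rightarrow> nat"
      show "norm (x \<alpha> * mpow t \<alpha>) \<le> cmod (x \<alpha>) * (r / 2) ^ mdegree \<alpha> * (s / (r / 2)) ^ N"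
      proof (cases "mdegree \<alpha> < N")
        case True
        then show ?thesis using N by simp
      next
        case False
        have "cmod (mpow t \<alpha>) \<le> s ^ mdegree \<alpha>"
          using t by (intro norm_mpow_le) (simp add: polydisc_iff less_imp_le)
        also have "\<dots> = (r / 2) ^ mdegree \<alpha> * (s / (r / 2)) ^ mdegree \<alpha>"
          using r by (simp add: power_mult_distrib[symmetric])
        also have "\<dots> \<le> (r / 2) ^ mdegree \<alpha> * (s / (r / 2)) ^ N"
          using False s r by (intro mult_left_mono power_decreasing) auto
        finally show ?thesis
          by (simp add: norm_mult mult.assoc mult_left_mono)
      qed
    qed
    then show "cmod (g t) \<le> K / (r / 2) ^ N * s ^ N"
      by (simp add: power_divide mult_ac)
  qed (use K0 r in auto)
qed

lemma vec_series_order_bound: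
  fixes x :: "'n::finite \<Rightarrow> ('m::finite \<Rightarrow> nat) \<Rightarrow> complex"
  assumes r: "r > 0"
    and sum: "\<And>j t. t \<in> polydisc r \<Longrightarrow> ((\<lambda>\<alpha>. x j \<alpha> * mpow t \<alpha>) has_sum g t $ j) UNIV"
    and N: "\<And>j \<alpha>. mdegree \<alpha> < N \<Longrightarrow> x j \<alpha> = 0"
  obtains K where "K \<ge> 0" "\<And>s t. 0 < s \<Longrightarrow> s \<le> r / 2 \<Longrightarrow> t \<in> polydisc s \<Longrightarrow> norm (g t) \<le> K * s ^ N"
proof -
  have "\<exists>K\<ge>0. \<forall>s t. 0 < s \<longrightarrow> s \<le> r / 2 \<longrightarrow> t \<in> polydisc s \<longrightarrow> cmod (g t $ j) \<le> K * s ^ N" for j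
    by (rule multi_series_order_bound[where x = "x j" and g = "\<lambda>t. g t $ j", OF r sum N]) blast+
  then obtain K where K: "\<And>j. K j \<ge> 0"
    "\<And>j s t. 0 < s \<Longrightarrow> s \<le> r / 2 \<Longrightarrow> t \<in> polydisc s \<Longrightarrow> cmod (g t $ j) \<le> K j * s ^ N"
    by metis
  show ?thesis
  proof (rule that[of "\<Sum>j\<in>UNIV. K j"])
    fix s :: real and t :: "complex ^ 'm"
    assume s: "0 < s" "s \<le> r / 2" "t \<in> polydisc s"
    have "norm (g t) \<le> (\<Sum>j\<in>UNIV. norm (g t $ j))"
      by (rule norm_vec_le_sum)
    also have "\<dots> \<le> (\<Sum>j\<in>UNIV. K j * s ^ N)"
      by (intro sum_mono K(2) s)
    finally show "norm (g t) \<le> (\<Sum>j\<in>UNIV. K j) * s ^ N"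
      by (simp add: sum_distrib_right)
  qed (intro sum_nonneg K(1))
qed

lemma is_solutionE:
  assumes "is_solution H q b"
  obtains r where "r > 0"
    "\<And>t j. t \<in> polydisc r \<Longrightarrow> ((\<lambda>\<alpha>. b j \<alpha> * mpow t \<alpha>) has_sum pseries b t $ j) UNIV"
    "\<And>t. t \<in> polydisc r \<Longrightarrow> pseries b (cwmult q t) = H t (pseries b t) q"
proof -
  have "\<forall>\<^sub>F t in nhds 0. (\<forall>j. (\<lambda>\<alpha>. b j \<alpha> * mpow t \<alpha>) summable_on UNIV) \<and>
      pseries b (cwmult q t) = H t (pseries b t) q"
    using assms unfolding is_solution_def by (simp add: eventually_conj_iff)
  then show ?thesis
    by (rule eventually_polydisc) (rule that, auto simp: pseries_def has_sum_infsum)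
qed

text \<open>Let \<Delta> be the difference, of order \<open>N\<close>. Applying \<open>L\<close> to
  it gives the difference of two values of the remainder, which on a small polydisc of radius
  \<open>s\<close> is at most \<open>e * K * s ^ N\<close>. Cauchy's estimate for a coefficient of
  degree \<open>N\<close> cancels the power of \<open>s\<close> and leaves \<open>e * K\<close>; as
  \<open>e\<close> is arbitrary, the coefficient vanishes. No expansion of
  \<open>H t (y t) q\<close> in powers of \<open>t\<close> is required.\<close>

theorem is_solution_unique:
  fixes H :: "complex ^ 'm \<Rightarrow> complex ^ 'n \<Rightarrow> complex ^ 'm \<Rightarrow> complex ^ 'n"
  assumes H: "holo_on (\<lambda>(t, y, q). H t y q) S" and S: "(0, 0, q) \<in> S"
    and q: "\<And>i. cmod (q $ i) < 1"
    and nonres: "\<And>c \<alpha>. cmat_eigenvalue (jac_y H q) c \<Longrightarrow> \<alpha> \<noteq> (\<lambda>_. 0) \<Longrightarrow> c \<noteq> mpow q \<alpha>"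
    and b: "is_solution H q b" and b': "is_solution H q b'"
  shows "b = b'"
proof (rule ccontr)
  assume "b \<noteq> b'"
  define x where "x j \<alpha> = b j \<alpha> - b' j \<alpha>" for j \<alpha>
  define N where "N = (LEAST n. \<exists>\<alpha> j. mdegree \<alpha> = n \<and> x j \<alpha> \<noteq> 0)"
  obtain j1 \<alpha>1 where "x j1 \<alpha>1 \<noteq> 0"
    using \<open>b \<noteq> b'\<close> by (auto simp: fun_eq_iff x_def)
  then have "\<exists>\<alpha> j. mdegree \<alpha> = N \<and> x j \<alpha> \<noteq> 0"
    unfolding N_def by (intro LeastI_ex[of "\<lambda>n. \<exists>\<alpha> j. mdegree \<alpha> = n \<and> x j \<alpha> \<noteq> 0"]) blast
  then obtain \<alpha>0 j0 where \<alpha>0: "mdegree \<alpha>0 = N" "x j0 \<alpha>0 \<noteq> 0"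
    by blast
  have lowest: "x j \<alpha> = 0" if "mdegree \<alpha> < N" for j \<alpha>
    using not_less_Least[of "mdegree \<alpha>" "\<lambda>n. \<exists>\<alpha> j. mdegree \<alpha> = n \<and> x j \<alpha> \<noteq> 0"] that
    unfolding N_def by blast
  have zero: "b j (\<lambda>_. 0) = 0" "b' j (\<lambda>_. 0) = 0" for j
    using b b' by (auto simp: is_solution_def)
  then have \<alpha>0_nz: "\<alpha>0 \<noteq> (\<lambda>_. 0)"
    using \<alpha>0(2) by (auto simp: x_def)
  \<comment> \<open>Vanishing at the origin is recast as order at least 1, so that both solutions
    are bounded by a multiple of \<open>s\<close> and enter the region of the Lipschitz
    estimate.\<close>
  have zero1: "b j \<alpha> = 0" "b' j \<alpha> = 0" if "mdegree \<alpha> < 1" for j \<alpha>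
  proof -
    have "\<alpha> = (\<lambda>_. 0)" using that by (simp add: fun_eq_iff)
    then show "b j \<alpha> = 0" "b' j \<alpha> = 0" using zero by auto
  qed
  obtain r1 where r1: "r1 > 0"
    "\<And>t j. t \<in> polydisc r1 \<Longrightarrow> ((\<lambda>\<alpha>. b j \<alpha> * mpow t \<alpha>) has_sum pseries b t $ j) UNIV"
    "\<And>t. t \<in> polydisc r1 \<Longrightarrow> pseries b (cwmult q t) = H t (pseries b t) q"
    by (rule is_solutionE[OF b]) blast
  obtain r2 where r2: "r2 > 0"
    "\<And>t j. t \<in> polydisc r2 \<Longrightarrow> ((\<lambda>\<alpha>. b' j \<alpha> * mpow t \<alpha>) has_sum pseries b' t $ j) UNIV"
    "\<And>t. t \<in> polydisc r2 \<Longrightarrow> pseries b' (cwmult q t) = H t (pseries b' t) q"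
    by (rule is_solutionE[OF b']) blast
  define r where "r = min r1 r2"
  have r: "r > 0" using r1(1) r2(1) by (simp add: r_def)
  have sub: "t \<in> polydisc r1" "t \<in> polydisc r2" if "t \<in> polydisc r" for t :: "complex ^ 'm"
    using that by (auto simp: r_def polydisc_iff)
  let ?D = "jac_y H q"
  define \<Delta> where "\<Delta> t = pseries b t - pseries b' t" for t
  have \<Delta>_sum: "((\<lambda>\<alpha>. x j \<alpha> * mpow t \<alpha>) has_sum \<Delta> t $ j) UNIV" if "t \<in> polydisc r" for j t
    using has_sum_diff[OF r1(2) r2(2), OF sub[OF that], of j j]
    by (simp add: x_def \<Delta>_def left_diff_distrib)
  obtain K where K: "K \<ge> 0"
    "\<And>s t. 0 < s \<Longrightarrow> s \<le> r / 2 \<Longrightarrow> t \<in> polydisc s \<Longrightarrow> norm (\<Delta> t) \<le> K * s ^ N"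
    by (rule vec_series_order_bound[OF r \<Delta>_sum lowest]) blast+
  obtain K1 where K1: "K1 \<ge> 0"
    "\<And>s t. 0 < s \<Longrightarrow> s \<le> r / 2 \<Longrightarrow> t \<in> polydisc s \<Longrightarrow> norm (pseries b t) \<le> K1 * s ^ 1"
    by (rule vec_series_order_bound[OF r r1(2)[OF sub(1)] zero1(1)]) blast+
  obtain K2 where K2: "K2 \<ge> 0"
    "\<And>s t. 0 < s \<Longrightarrow> s \<le> r / 2 \<Longrightarrow> t \<in> polydisc s \<Longrightarrow> norm (pseries b' t) \<le> K2 * s ^ 1"
    by (rule vec_series_order_bound[OF r r2(2)[OF sub(2)] zero1(2)]) blast+
  define xv where "xv \<alpha> = (\<chi> j. x j \<alpha>)" for \<alpha>
  \<comment> \<open>These are the coefficients of \<open>L\<close> applied to the difference of the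
    two solutions.\<close>
  define \<epsilon> where "\<epsilon> \<alpha> = mpow q \<alpha> *s xv \<alpha> - ?D *v xv \<alpha>" for \<alpha>
  have \<epsilon>_sum: "((\<lambda>\<alpha>. \<epsilon> \<alpha> $ j * mpow t \<alpha>) has_sum (\<Delta> (cwmult q t) - ?D *v \<Delta> t) $ j) UNIV"
    if t: "t \<in> polydisc r" for j t
  proof -
    have "((\<lambda>\<alpha>. x j \<alpha> * mpow (cwmult q t) \<alpha> - (\<Sum>k\<in>UNIV. ?D $ j $ k * (x k \<alpha> * mpow t \<alpha>)))
        has_sum (\<Delta> (cwmult q t) $ j - (\<Sum>k\<in>UNIV. ?D $ j $ k * \<Delta> t $ k))) UNIV"
      by (intro has_sum_diff has_sum_sum has_sum_cmult_right \<Delta>_sum cwmult_in_polydisc q t finite)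
    also have "(\<lambda>\<alpha>. x j \<alpha> * mpow (cwmult q t) \<alpha> - (\<Sum>k\<in>UNIV. ?D $ j $ k * (x k \<alpha> * mpow t \<alpha>)))
        = (\<lambda>\<alpha>. \<epsilon> \<alpha> $ j * mpow t \<alpha>)"
      by (simp add: fun_eq_iff \<epsilon>_def xv_def mpow_cwmult matrix_vector_nth left_diff_distrib sum_distrib_right
          mult.assoc mult.left_commute)
    finally show ?thesis
      by (simp add: matrix_vector_nth)
  qed
  have small: "cmod (\<epsilon> \<alpha>0 $ j) \<le> e * K" if e: "e > 0" for e j
  proof -
    obtain d where d: "d > 0"
      "\<And>t y y' q'. norm t < d \<Longrightarrow> norm y < d \<Longrightarrow> norm y' < d \<Longrightarrow> dist q' q < d \<Longrightarrow>
       norm ((H t y q' - jac_y H q' *v y) - (H t y' q' - jac_y H q' *v y')) \<le> e * norm (y - y')"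
      by (rule remainder_lipschitz[OF H S e]) blast
    \<comment> \<open>Dominates the three factors by which \<open>s\<close> bounds \<open>t\<close>
      and the two solutions, so \<open>m * s < d\<close> brings all of them into the ball of radius
      \<open>d\<close>.\<close>
    define m where "m = real CARD('m) + K1 + K2 + 1"
    have m: "m > 0" using K1(1) K2(1) by (simp add: m_def)
    define s where "s = min (r / 2) (d / (2 * m))"
    have s: "0 < s" "s \<le> r / 2" using r d(1) m by (auto simp: s_def)
    have "s \<le> d / (2 * m)" by (simp add: s_def)
    then have "m * s \<le> d / 2" using m by (simp add: field_simps)
    then have ms: "m * s < d" using d(1) by linarith
    have less_d: "c * s < d" if "c \<le> m" for c
    proof -
      have "c * s \<le> m * s" using that s(1) by (intro mult_right_mono) auto
      with ms show ?thesis by linarith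
    qed
    have "cmod ((\<Delta> (cwmult q t) - ?D *v \<Delta> t) $ j) \<le> e * (K * s ^ N)" if t: "t \<in> polydisc s" for t
    proof -
      have tr: "t \<in> polydisc r"
        using s r by (intro polydisc_mono[OF t]) simp
      have "norm t \<le> real CARD('m) * s"
        using t by (intro norm_vec_le) (simp add: polydisc_iff less_imp_le)
      also have "\<dots> < d" using K1(1) K2(1) by (intro less_d) (simp add: m_def)
      finally have t_d: "norm t < d" .
      have "norm (pseries b t) \<le> K1 * s" using K1(2)[OF s t] by simp
      also have "\<dots> < d" using K2(1) by (intro less_d) (simp add: m_def)
      finally have b_d: "norm (pseries b t) < d" .
      have "norm (pseries b' t) \<le> K2 * s" using K2(2)[OF s t] by simp
      also have "\<dots> < d" using K1(1) by (intro less_d) (simp add: m_def)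
      finally have b'_d: "norm (pseries b' t) < d" .
      have "\<Delta> (cwmult q t) - ?D *v \<Delta> t =
          (H t (pseries b t) q - ?D *v pseries b t) - (H t (pseries b' t) q - ?D *v pseries b' t)"
        using r1(3)[OF sub(1)[OF tr]] r2(3)[OF sub(2)[OF tr]]
        by (simp add: \<Delta>_def matrix_vector_mult_diff_distrib)
      also have "norm \<dots> \<le> e * norm (\<Delta> t)"
        unfolding \<Delta>_def using d(1) by (intro d(2) t_d b_d b'_d) simp
      also have "\<dots> \<le> e * (K * s ^ N)"
        using e by (intro mult_left_mono K(2) s t) auto
      finally show ?thesis
        by (rule order_trans[OF Finite_Cartesian_Product.norm_nth_le])
    qed
    moreover have "((\<lambda>\<alpha>. \<epsilon> \<alpha> $ j * mpow t \<alpha>) has_sum (\<Delta> (cwmult q t) - ?D *v \<Delta> t) $ j) UNIV"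
      if "t \<in> polydisc s" for t
      using s r by (intro \<epsilon>_sum polydisc_mono[OF that]) simp
    ultimately have "cmod (\<epsilon> \<alpha>0 $ j) \<le> e * (K * s ^ N) / s ^ mdegree \<alpha>0"
      by (intro multi_series_coeff_bound[OF s(1)])
    then show ?thesis
      using s(1) \<alpha>0(1) by simp
  qed
  have "\<epsilon> \<alpha>0 $ j = 0" for j
  proof (rule ccontr)
    assume "\<epsilon> \<alpha>0 $ j \<noteq> 0"
    then have pos: "cmod (\<epsilon> \<alpha>0 $ j) > 0" by simp
    \<comment> \<open>The choice of \<open>e\<close> makes the right-hand side at most half of the
      left; \<open>K + 1\<close> avoids dividing by 0 when \<open>K = 0\<close>.\<close>
    have "cmod (\<epsilon> \<alpha>0 $ j) \<le> cmod (\<epsilon> \<alpha>0 $ j) / (2 * (K + 1)) * K"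
      using pos K(1) by (intro small) auto
    also have "\<dots> \<le> cmod (\<epsilon> \<alpha>0 $ j) / 2"
      using pos K(1) by (simp add: field_simps)
    finally show False using pos by simp
  qed
  then have "?D *v xv \<alpha>0 = mpow q \<alpha>0 *s xv \<alpha>0"
    by (simp add: \<epsilon>_def vec_eq_iff)
  moreover have "xv \<alpha>0 \<noteq> 0"
    using \<alpha>0(2) by (auto simp: xv_def vec_eq_iff)
  ultimately have "cmat_eigenvalue ?D (mpow q \<alpha>0)"
    unfolding cmat_eigenvalue_def by blast
  with nonres \<alpha>0_nz show False by blast
qed

section \<open>Existence\<close>

lemma holo_on_matrix_vector:
  fixes D :: "'a::complex_normed \<Rightarrow> complex ^ 'n ^ 'n"
  assumes D: "\<And>j k. holo_on (\<lambda>z. D z $ j $ k) S" and y: "holo_on y S"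
  shows "holo_on (\<lambda>z. D z *v y z) S"
proof (rule holo_on_vec)
  show "holo_on (\<lambda>z. (D z *v y z) $ j) S" for j
    unfolding matrix_vector_nth
    by (rule holo_on_sum[OF holo_on_mult[OF D holo_on_vec_nth[OF y]] holo_on_openD[OF y]])
qed

lemma geometric_step_limit:
  fixes Y :: "nat \<Rightarrow> 'a \<Rightarrow> 'b::banach"
  assumes step: "\<And>k p. p \<in> X \<Longrightarrow> norm (Y (Suc k) p - Y k p) \<le> c * (1 / 2) ^ Suc k"
  obtains y where "\<And>p. p \<in> X \<Longrightarrow> (\<lambda>k. Y k p) \<longlonglongrightarrow> y p"
    "\<And>k p. p \<in> X \<Longrightarrow> norm (Y k p - y p) \<le> c * (1 / 2) ^ k"
proof -
  have dist: "norm (Y (k + n) p - Y k p) \<le> c * (1 / 2) ^ k - c * (1 / 2) ^ (k + n)" if p: "p \<in> X" for k n p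
  proof (induction n)
    case (Suc n)
    have "norm (Y (k + Suc n) p - Y k p) \<le> norm (Y (Suc (k + n)) p - Y (k + n) p) + norm (Y (k + n) p - Y k p)"
      using norm_triangle_ineq[of "Y (Suc (k + n)) p - Y (k + n) p" "Y (k + n) p - Y k p"] by simp
    also have "\<dots> \<le> c * (1 / 2) ^ Suc (k + n) + (c * (1 / 2) ^ k - c * (1 / 2) ^ (k + n))"
      by (intro add_mono step p Suc)
    also have "\<dots> = c * (1 / 2) ^ k - c * (1 / 2) ^ (k + Suc n)"
      by simp
    finally show ?case .
  qed simp
  have c: "c \<ge> 0" if "p \<in> X" for p
    using order_trans[OF norm_ge_zero step[OF that, of 0]] by simp
  have le: "norm (Y m p - Y k p) \<le> c * (1 / 2) ^ k" if "p \<in> X" "k \<le> m" for m k p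
  proof -
    have "0 \<le> c * (1 / 2) ^ m" using c[OF that(1)] by simp
    with dist[OF that(1), of k "m - k"] that(2) show ?thesis by simp
  qed
  have lim0: "(\<lambda>k. 2 * (c * (1 / 2) ^ k)) \<longlonglongrightarrow> 0"
    by (intro tendsto_mult_right_zero LIMSEQ_power_zero) simp
  have "convergent (\<lambda>k. Y k p)" if p: "p \<in> X" for p
    unfolding Cauchy_convergent_iff[symmetric]
  proof (rule CauchyI)
    fix e :: real assume "e > 0"
    with order_tendstoD(2)[OF lim0] obtain N where N: "2 * (c * (1 / 2) ^ N) < e"
      by (meson eventually_sequentially order_refl)
    have "norm (Y m p - Y n p) < e" if "m \<ge> N" "n \<ge> N" for m n
      using le[OF p that(1)] le[OF p that(2)] N norm_triangle_ineq4[of "Y m p - Y N p" "Y n p - Y N p"] by simp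
    then show "\<exists>M. \<forall>m\<ge>M. \<forall>n\<ge>M. norm (Y m p - Y n p) < e" by blast
  qed
  then have "\<forall>p. \<exists>l. p \<in> X \<longrightarrow> (\<lambda>k. Y k p) \<longlonglongrightarrow> l"
    unfolding convergent_def by blast
  then have "\<exists>y. \<forall>p. p \<in> X \<longrightarrow> (\<lambda>k. Y k p) \<longlonglongrightarrow> y p"
    by (rule choice)
  then obtain y where y: "\<And>p. p \<in> X \<Longrightarrow> (\<lambda>k. Y k p) \<longlonglongrightarrow> y p" by blast
  have "norm (Y k p - y p) \<le> c * (1 / 2) ^ k" if p: "p \<in> X" for k p
  proof (rule tendsto_upperbound)
    show "(\<lambda>m. norm (Y k p - Y m p)) \<longlonglongrightarrow> norm (Y k p - y p)"
      by (intro tendsto_intros y p)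
    show "\<forall>\<^sub>F m in sequentially. norm (Y k p - Y m p) \<le> c * (1 / 2) ^ k"
      using le[OF p] unfolding eventually_sequentially by (metis norm_minus_commute)
  qed simp
  with y show ?thesis by (rule that)
qed

text \<open>Writing \<open>L y = y (q t, q) - D q y\<close>, the solution is the limit of the iteration
  \<open>L y\<^sub>k\<^sub>+\<^sub>1 = H (t, y\<^sub>k, q) - D q y\<^sub>k\<close>; the right-hand side is Lipschitz in \<open>y\<^sub>k\<close> with
  constant \<open>1 / (2 C)\<close>, where \<open>C\<close> bounds the inverse of \<open>L\<close> in the supremum norm.\<close>

theorem local_holomorphic_solution:
  fixes H :: "complex ^ 'm \<Rightarrow> complex ^ 'n \<Rightarrow> complex ^ 'm \<Rightarrow> complex ^ 'n"
  assumes U: "open U" "q0 \<in> U" and H0: "\<And>q. q \<in> U \<Longrightarrow> H 0 0 q = 0"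
    and H: "holo_on (\<lambda>(t, y, q). H t y q) S" and S: "(0, 0, q0) \<in> S"
    and q0: "\<And>i. cmod (q0 $ i) < 1"
    and nonres: "\<And>c. cmat_eigenvalue (jac_y H q0) c \<Longrightarrow> c \<noteq> 0 \<and> (\<forall>\<alpha>. \<alpha> \<noteq> (\<lambda>_. 0) \<longrightarrow> c \<noteq> mpow q0 \<alpha>)"
  obtains r V y M where "r > 0" "open V" "q0 \<in> V" "V \<subseteq> U" "\<And>q i. q \<in> V \<Longrightarrow> cmod (q $ i) < 1"
    "holo_on y (polydisc r \<times> V)" "\<And>q. q \<in> V \<Longrightarrow> y (0, q) = 0"
    "\<And>t q. t \<in> polydisc r \<Longrightarrow> q \<in> V \<Longrightarrow> norm (y (t, q)) \<le> M"
    "\<And>t q. t \<in> polydisc r \<Longrightarrow> q \<in> V \<Longrightarrow> y (cwmult q t, q) = H t (y (t, q)) q"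
proof -
  let ?D = "jac_y H"
  have S_open: "open S" using H by (rule holo_on_openD)
  \<comment> \<open>\<open>S\<close> is a neighbourhood attached to \<open>q0\<close> alone, so the
    matrix \<open>?D q\<close> is known to be holomorphic only for those \<open>q\<close>.\<close>
  define V0 where "V0 = {q. (0, 0, q) \<in> S}"
  have "continuous_on UNIV (\<lambda>q :: complex ^ 'm. (0 :: complex ^ 'm, 0 :: complex ^ 'n, q))"
    by (intro continuous_intros)
  from open_vimage[OF S_open this] have V0: "open V0"
    by (simp add: V0_def vimage_def)
  have q0V0: "q0 \<in> V0" using S by (simp add: V0_def)
  have D_holo0: "holo_on (\<lambda>q. ?D q $ j $ k) V0" for j k
  proof -
    have "holo_on (\<lambda>q. (0 :: complex ^ 'm, 0 :: complex ^ 'n, q)) V0"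
      by (rule holo_on_Pair[OF holo_on_const[OF V0] holo_on_Pair[OF holo_on_const[OF V0] holo_on_id[OF V0]]])
    from holo_on_compose[OF this holo_on_partial_jac[OF H], of j k]
    show ?thesis by (auto simp: jac_y_eq_partial_jac V0_def)
  qed
  have D_cont: "isCont (\<lambda>q. ?D q $ j $ k) q0" for j k
    using holo_on_imp_continuous_on[OF D_holo0] V0 q0V0 continuous_on_eq_continuous_at by blast
  have "q0 \<in> polydisc 1" using q0 by (simp add: polydisc_iff)
  then obtain \<rho> where \<rho>: "0 < \<rho>" "\<rho> < 1" "q0 \<in> polydisc \<rho>"
    using polydisc_shrink[of q0 1] by auto
  then have \<rho>q0: "cmod (q0 $ i) < \<rho>" for i
    by (simp add: polydisc_iff)
  obtain \<kappa> where \<kappa>: "\<kappa> > 0" and ev: "\<forall>\<^sub>F q in nhds q0. (\<forall>i. cmod (q $ i) < \<rho>) \<and>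
      (\<forall>v. \<kappa> * norm v \<le> norm (?D q *v v)) \<and>
      (\<forall>\<alpha> v. \<alpha> \<noteq> (\<lambda>_. 0) \<longrightarrow> \<kappa> * norm v \<le> norm (mpow q \<alpha> *s v - ?D q *v v))"
    by (rule nonresonance_bounded_below[OF D_cont \<rho>(1,2) \<rho>q0 nonres])
  have "(\<lambda>\<alpha> :: 'm \<Rightarrow> nat. \<rho> ^ mdegree \<alpha>) summable_on UNIV"
    unfolding power_sum using \<rho> by (intro summable_on_multi_geometric) auto
  then obtain G where G: "((\<lambda>\<alpha> :: 'm \<Rightarrow> nat. \<rho> ^ mdegree \<alpha>) has_sum G) UNIV"
    by (auto simp: summable_on_def)
  have G0: "G \<ge> 0"
    using G by (rule has_sum_nonneg) (use \<rho> in auto)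
  \<comment> \<open>This is the constant of \<open>linear_qdifference_solution\<close>. It involves
    neither the radius nor \<open>M\<close>, so it can be fixed before \<open>e\<close>,
    \<open>d\<close> and finally \<open>r\<close>.\<close>
  define C where "C = (real CARD('n) * real CARD('n) * G / \<kappa> + 1) / \<kappa>"
  have C: "C > 0"
    using G0 \<kappa> by (auto simp: C_def intro!: divide_pos_pos add_nonneg_pos)
  define e where "e = 1 / (2 * C)"
  have e: "e > 0" and Ce: "C * e = 1 / 2" using C by (auto simp: e_def)
  obtain d where d: "d > 0"
    and dS: "\<And>t y q. norm t < d \<Longrightarrow> norm y < d \<Longrightarrow> dist q q0 < d \<Longrightarrow> (t, y, q) \<in> S"
    and lip: "\<And>t y y' q. norm t < d \<Longrightarrow> norm y < d \<Longrightarrow> norm y' < d \<Longrightarrow> dist q q0 < d \<Longrightarrow>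
       norm ((H t y q - ?D q *v y) - (H t y' q - ?D q *v y')) \<le> e * norm (y - y')"
    by (rule remainder_lipschitz[OF H S e]) blast
  \<comment> \<open>All iterates, and hence their limit, will have norm at most
    \<open>\<delta>\<close>; staying strictly below \<open>d\<close> keeps the Lipschitz estimate
    applicable to the limit.\<close>
  define \<delta> where "\<delta> = d / 2"
  have \<delta>: "\<delta> > 0" "\<delta> < d" using d by (auto simp: \<delta>_def)
  have "isCont (\<lambda>(t, y, q). H t y q) (0, 0, q0)"
    using holo_on_imp_continuous_on[OF H] S_open S continuous_on_eq_continuous_at by blast
  then have "((\<lambda>(t, y, q). H t y q) \<longlongrightarrow> (\<lambda>(t, y, q). H t y q) (0, 0, q0)) (nhds (0, 0, q0))"
    unfolding isCont_def by (rule tendsto_at_iff_tendsto_nhds[THEN iffD1])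
  from tendstoD[OF this mult_pos_pos[OF \<delta>(1) e]]
  obtain \<eta> where \<eta>: "\<eta> > 0"
    "\<And>z. dist z (0, 0, q0) < \<eta> \<Longrightarrow> dist ((\<lambda>(t, y, q). H t y q) z) (H 0 0 q0) < \<delta> * e"
    unfolding eventually_nhds_metric case_prod_conv by blast
  define \<eta>' where "\<eta>' = min (\<eta> / 2) d"
  have \<eta>': "\<eta>' > 0" "\<eta>' \<le> \<eta> / 2" "\<eta>' \<le> d" using \<eta>(1) d by (auto simp: \<eta>'_def)
  \<comment> \<open>The right-hand side of the first iteration, started at 0. Inverting
    \<open>L\<close> costs the factor \<open>C\<close>, so the first step has size at most
    \<open>C * (\<delta> * e) = \<delta> / 2\<close>.\<close>
  have Hsmall: "norm (H t 0 q) \<le> \<delta> * e" if "norm t < \<eta>'" "dist q q0 < \<eta>'" for t q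
  proof -
    have "dist (t, 0 :: complex ^ 'n, q) (0, 0, q0) = norm (t, 0 :: complex ^ 'n, q - q0)"
      by (simp add: dist_norm)
    also have "\<dots> \<le> norm t + (norm (0 :: complex ^ 'n) + norm (q - q0))"
      by (rule order_trans[OF norm_Pair_le add_left_mono[OF norm_Pair_le]])
    also have "\<dots> < \<eta>"
      using that \<eta>'(2) by (simp add: dist_norm)
    finally have "dist ((\<lambda>(t, y, q). H t y q) (t, 0, q)) (H 0 0 q0) < \<delta> * e"
      by (rule \<eta>(2))
    then show ?thesis
      using H0[OF U(2)] by simp
  qed
  have near: "\<forall>\<^sub>F q in nhds q0. dist q q0 < \<eta>'"
    using \<eta>'(1) unfolding eventually_nhds_metric by blast
  have "\<forall>\<^sub>F q in nhds q0. q \<in> U \<and> q \<in> V0 \<and> dist q q0 < \<eta>' \<and> (\<forall>i. cmod (q $ i) < \<rho>) \<and>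
      (\<forall>v. \<kappa> * norm v \<le> norm (?D q *v v)) \<and>
      (\<forall>\<alpha> v. \<alpha> \<noteq> (\<lambda>_. 0) \<longrightarrow> \<kappa> * norm v \<le> norm (mpow q \<alpha> *s v - ?D q *v v))"
    by (rule eventually_conj[OF eventually_nhds_in_open[OF U]
          eventually_conj[OF eventually_nhds_in_open[OF V0 q0V0] eventually_conj[OF near ev]]])
  then obtain V where V: "open V" "q0 \<in> V" and
    VP: "\<forall>q\<in>V. q \<in> U \<and> q \<in> V0 \<and> dist q q0 < \<eta>' \<and> (\<forall>i. cmod (q $ i) < \<rho>) \<and>
      (\<forall>v. \<kappa> * norm v \<le> norm (?D q *v v)) \<and>
      (\<forall>\<alpha> v. \<alpha> \<noteq> (\<lambda>_. 0) \<longrightarrow> \<kappa> * norm v \<le> norm (mpow q \<alpha> *s v - ?D q *v v))"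
    unfolding eventually_nhds by blast
  have VU: "V \<subseteq> U" and VV0: "V \<subseteq> V0" using VP by auto
  have V\<eta>: "dist q q0 < \<eta>'" if "q \<in> V" for q using VP that by blast
  have Vd: "dist q q0 < d" if "q \<in> V" for q using V\<eta>[OF that] \<eta>'(3) by linarith
  have V\<rho>: "cmod (q $ i) \<le> \<rho>" if "q \<in> V" for q i using VP that less_imp_le by blast
  have V1: "cmod (q $ i) < 1" if "q \<in> V" for q i using V\<rho>[OF that, of i] \<rho>(2) by linarith
  have V\<kappa>: "\<kappa> * norm v \<le> norm (?D q *v v)" if "q \<in> V" for q v using VP that by blast
  have V\<kappa>': "\<kappa> * norm v \<le> norm (mpow q \<alpha> *s v - ?D q *v v)" if "q \<in> V" "\<alpha> \<noteq> (\<lambda>_. 0)" for q \<alpha> v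
    using VP that by blast
  have "\<forall>\<^sub>F t :: complex ^ 'm in nhds 0. t \<in> ball 0 \<eta>'"
    using \<eta>'(1) by (intro eventually_nhds_in_open) auto
  then obtain r where r: "r > 0" and "\<And>t :: complex ^ 'm. t \<in> polydisc r \<Longrightarrow> t \<in> ball 0 \<eta>'"
    by (rule eventually_polydisc) blast
  then have r\<eta>: "norm t < \<eta>'" if "t \<in> polydisc r" for t :: "complex ^ 'm" using that by simp
  have rd: "norm t < d" if "t \<in> polydisc r" for t :: "complex ^ 'm" using r\<eta>[OF that] \<eta>'(3) by linarith
  let ?X = "(polydisc r :: (complex ^ 'm) set) \<times> V"
  have X: "open ?X" by (intro open_Times open_polydisc V)
  have D_holo: "holo_on (\<lambda>q. ?D q $ j $ k) V" for j k
    using D_holo0 V(1) VV0 by (rule holo_on_subset)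
  have DX_holo: "holo_on (\<lambda>p. ?D (snd p) $ j $ k) ?X" for j k
    by (rule holo_on_compose[OF holo_on_snd[OF X] D_holo]) auto
  define R where "R y p = H (fst p) (y p) (snd p) - ?D (snd p) *v y p" for y p
  have R_holo: "holo_on (R y) ?X" if y: "holo_on y ?X" and yd: "\<And>p. p \<in> ?X \<Longrightarrow> norm (y p) < d" for y
  proof -
    have "holo_on (\<lambda>p. (fst p, y p, snd p)) ?X"
      by (intro holo_on_Pair holo_on_fst X y holo_on_snd)
    from holo_on_compose[OF this H] have "holo_on (\<lambda>p. H (fst p) (y p) (snd p)) ?X"
      using yd dS rd Vd by fastforce
    from holo_on_diff[OF this holo_on_matrix_vector[OF DX_holo y]] show ?thesis
      by (simp add: R_def[abs_def])
  qed
  have R_zero: "R y (0, q) = 0" if "q \<in> V" "y (0, q) = 0" for y q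
    using that VU H0 by (auto simp: R_def)
  have R_lip: "norm (R y p - R z p) \<le> e * norm (y p - z p)"
    if "p \<in> ?X" "norm (y p) < d" "norm (z p) < d" for y z p
    unfolding R_def using that rd Vd by (intro lip) auto
  note solve = linear_qdifference_solution[OF V(1) D_holo \<rho>(1,2) V\<rho> G \<kappa> V\<kappa> V\<kappa>' r, folded C_def]
  \<comment> \<open>The state is a pair of consecutive iterates, since the size of the next step is
    derived from the difference of the last two. The bounds fit together:
    \<open>\<delta> * (1 - (1 / 2) ^ k)\<close> plus the step
    \<open>\<delta> * (1 / 2) ^ Suc k\<close> is the bound for \<open>Suc k\<close>.\<close>
  define P where "P k yz \<longleftrightarrow> (case yz of (y, z) \<Rightarrow>
      holo_on y ?X \<and> holo_on z ?X \<and> (\<forall>q\<in>V. y (0, q) = 0 \<and> z (0, q) = 0) \<and>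
      (\<forall>p\<in>?X. norm (y p) \<le> \<delta> * (1 - (1 / 2) ^ k) \<and> norm (z p - y p) \<le> \<delta> * (1 / 2) ^ Suc k) \<and>
      (\<forall>t\<in>polydisc r. \<forall>q\<in>V. z (cwmult q t, q) - ?D q *v z (t, q) = R y (t, q)))"
    for k and yz :: "((complex ^ 'm) \<times> (complex ^ 'm) \<Rightarrow> complex ^ 'n) \<times> ((complex ^ 'm) \<times> (complex ^ 'm) \<Rightarrow> complex ^ 'n)"
  have "\<exists>f. \<forall>k. P k (f k) \<and> fst (f (Suc k)) = snd (f k)"
  proof (rule dependent_nat_choice)
    have zero_holo: "holo_on (\<lambda>_. 0 :: complex ^ 'n) ?X" by (rule holo_on_const[OF X])
    have "holo_on (R (\<lambda>_. 0)) ?X" using zero_holo d by (intro R_holo) auto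
    moreover have "norm (R (\<lambda>_. 0) (t, q)) \<le> \<delta> * e" if "t \<in> polydisc r" "q \<in> V" for t q
      using Hsmall[OF r\<eta>[OF that(1)] V\<eta>[OF that(2)]] by (simp add: R_def)
    moreover have "R (\<lambda>_. 0) (0, q) = 0" if "q \<in> V" for q
      using that by (rule R_zero) simp
    ultimately obtain z where z: "holo_on z ?X" "\<And>q. q \<in> V \<Longrightarrow> z (0, q) = 0"
      "\<And>t q. t \<in> polydisc r \<Longrightarrow> q \<in> V \<Longrightarrow> z (cwmult q t, q) - ?D q *v z (t, q) = R (\<lambda>_. 0) (t, q)"
      "\<And>t q. t \<in> polydisc r \<Longrightarrow> q \<in> V \<Longrightarrow> norm (z (t, q)) \<le> C * (\<delta> * e)"
      using solve by blast
    have "C * (\<delta> * e) = \<delta> * (1 / 2) ^ Suc 0" using Ce by (simp add: mult.left_commute)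
    with z zero_holo have "P 0 (\<lambda>_. 0, z)" by (auto simp: P_def)
    then show "\<exists>yz. P 0 yz" by blast
  next
    fix yz k assume "P k yz"
    moreover obtain y z where yz: "yz = (y, z)" by fastforce
    ultimately have P: "holo_on y ?X" "holo_on z ?X" "\<And>q. q \<in> V \<Longrightarrow> y (0, q) = 0" "\<And>q. q \<in> V \<Longrightarrow> z (0, q) = 0"
      "\<And>p. p \<in> ?X \<Longrightarrow> norm (y p) \<le> \<delta> * (1 - (1 / 2) ^ k)"
      "\<And>p. p \<in> ?X \<Longrightarrow> norm (z p - y p) \<le> \<delta> * (1 / 2) ^ Suc k"
      "\<And>t q. t \<in> polydisc r \<Longrightarrow> q \<in> V \<Longrightarrow> z (cwmult q t, q) - ?D q *v z (t, q) = R y (t, q)"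
      by (auto simp: P_def)
    have z_le: "norm (z p) \<le> \<delta> * (1 - (1 / 2) ^ Suc k)" if "p \<in> ?X" for p
    proof -
      have "norm (z p) \<le> norm (y p) + norm (z p - y p)"
        using norm_triangle_ineq[of "y p" "z p - y p"] by simp
      also have "\<dots> \<le> \<delta> * (1 - (1 / 2) ^ k) + \<delta> * (1 / 2) ^ Suc k"
        by (intro add_mono P that)
      also have "\<dots> = \<delta> * (1 - (1 / 2) ^ Suc k)"
        by (simp add: algebra_simps)
      finally show ?thesis .
    qed
    have less_d: "\<delta> * (1 - (1 / 2) ^ n) < d" for n
    proof -
      have "\<delta> * (1 - (1 / 2) ^ n) \<le> \<delta> * 1" using \<delta>(1) by (intro mult_left_mono) auto
      with \<delta>(2) show ?thesis by simp
    qed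
    have y_d: "norm (y p) < d" and z_d: "norm (z p) < d" if "p \<in> ?X" for p
      using P(5)[OF that] z_le[OF that] less_d[of k] less_d[of "Suc k"] by linarith+
    have "holo_on (\<lambda>p. R z p - R y p) ?X"
      by (intro holo_on_diff R_holo P y_d z_d)
    moreover have "norm (R z (t, q) - R y (t, q)) \<le> e * (\<delta> * (1 / 2) ^ Suc k)" if "t \<in> polydisc r" "q \<in> V" for t q
    proof -
      have p: "(t, q) \<in> ?X" using that by simp
      have "norm (R z (t, q) - R y (t, q)) \<le> e * norm (z (t, q) - y (t, q))"
        by (rule R_lip[of "(t, q)" z y, OF p z_d[OF p] y_d[OF p]])
      also have "\<dots> \<le> e * (\<delta> * (1 / 2) ^ Suc k)"
        using e by (intro mult_left_mono P(6) p) simp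
      finally show ?thesis .
    qed
    moreover have "R z (0, q) - R y (0, q) = 0" if "q \<in> V" for q
      using R_zero[where y = y, OF that P(3)[OF that]] R_zero[where y = z, OF that P(4)[OF that]] by simp
    \<comment> \<open>The increment is solved for rather than the next iterate: \<open>solve\<close>
      provides some bounded solution for each right-hand side, and its statement does not say that
      the difference of two of them is the one obtained for the difference.\<close>
    ultimately obtain g where g: "holo_on g ?X" "\<And>q. q \<in> V \<Longrightarrow> g (0, q) = 0"
      "\<And>t q. t \<in> polydisc r \<Longrightarrow> q \<in> V \<Longrightarrow> g (cwmult q t, q) - ?D q *v g (t, q) = R z (t, q) - R y (t, q)"
      "\<And>t q. t \<in> polydisc r \<Longrightarrow> q \<in> V \<Longrightarrow> norm (g (t, q)) \<le> C * (e * (\<delta> * (1 / 2) ^ Suc k))"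
      using solve[of "\<lambda>p. R z p - R y p"] by blast
    have Ce': "C * (e * (\<delta> * (1 / 2) ^ Suc k)) = \<delta> * (1 / 2) ^ Suc (Suc k)"
      using Ce by (simp add: mult.assoc[symmetric])
    have "P (Suc k) (z, \<lambda>p. z p + g p)"
      unfolding P_def case_prod_conv
    proof (intro conjI ballI)
      show "holo_on (\<lambda>p. z p + g p) ?X" by (intro holo_on_add P g)
      fix t q :: "complex ^ 'm" assume tq: "t \<in> polydisc r" "q \<in> V"
      show "z (cwmult q t, q) + g (cwmult q t, q) - ?D q *v (z (t, q) + g (t, q)) = R z (t, q)"
        using P(7)[OF tq] g(3)[OF tq] by (simp add: matrix_vector_right_distrib algebra_simps)
    next
      fix p assume p: "p \<in> ?X"
      then show "norm (z p + g p - z p) \<le> \<delta> * (1 / 2) ^ Suc (Suc k)"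
        using g(4)[of "fst p" "snd p"] unfolding Ce' by auto
    qed (use P(2,4) g(2) z_le in auto)
    then show "\<exists>yz'. P (Suc k) yz' \<and> fst yz' = snd yz"
      using yz by auto
  qed
  then obtain f where f: "\<And>k. P k (f k)" "\<And>k. fst (f (Suc k)) = snd (f k)" by blast
  define Y where "Y k = fst (f k)" for k
  have fk: "f k = (Y k, Y (Suc k))" for k
    using f(2)[of k] by (simp add: Y_def prod_eq_iff)
  have Y_holo: "holo_on (Y k) ?X" and Y0: "q \<in> V \<Longrightarrow> Y k (0, q) = 0"
    and Y_le: "p \<in> ?X \<Longrightarrow> norm (Y k p) \<le> \<delta> * (1 - (1 / 2) ^ k)"
    and Y_step: "p \<in> ?X \<Longrightarrow> norm (Y (Suc k) p - Y k p) \<le> \<delta> * (1 / 2) ^ Suc k"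
    and Y_eq: "t \<in> polydisc r \<Longrightarrow> q \<in> V \<Longrightarrow> Y (Suc k) (cwmult q t, q) - ?D q *v Y (Suc k) (t, q) = R (Y k) (t, q)"
    for k p and t q :: "complex ^ 'm"
    using f(1)[of k] unfolding fk P_def by auto
  have Y_\<delta>: "norm (Y k p) \<le> \<delta>" if "p \<in> ?X" for k p
  proof -
    have "\<delta> * (1 - (1 / 2) ^ k) \<le> \<delta> * 1" using \<delta>(1) by (intro mult_left_mono) auto
    with Y_le[OF that, of k] show ?thesis by simp
  qed
  obtain y where y_lim: "\<And>p. p \<in> ?X \<Longrightarrow> (\<lambda>k. Y k p) \<longlonglongrightarrow> y p"
    and y_le: "\<And>k p. p \<in> ?X \<Longrightarrow> norm (Y k p - y p) \<le> \<delta> * (1 / 2) ^ k"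
    by (rule geometric_step_limit[of ?X Y \<delta>, OF Y_step]) blast+
  have half_lim: "(\<lambda>k. \<delta> * (1 / 2) ^ k) \<longlonglongrightarrow> 0"
    by (intro tendsto_mult_right_zero LIMSEQ_power_zero) simp
  have y_holo: "holo_on y ?X"
  proof (rule holo_on_vec, rule holo_on_uniform_approx[OF X])
    fix j and e' :: real assume "e' > 0"
    with order_tendstoD(2)[OF half_lim] obtain k where k: "\<delta> * (1 / 2) ^ k < e'"
      by (meson eventually_sequentially order_refl)
    have "cmod (Y k p $ j - y p $ j) \<le> e'" if "p \<in> ?X" for p
      using Finite_Cartesian_Product.norm_nth_le[of "Y k p - y p" j] y_le[OF that, of k] k by simp
    then show "\<exists>g. holo_on g ?X \<and> (\<forall>p\<in>?X. cmod (g p - y p $ j) \<le> e')"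
      using holo_on_vec_nth[OF Y_holo] by blast
  qed
  have y_bound: "norm (y p) \<le> \<delta>" if "p \<in> ?X" for p
    by (rule tendsto_upperbound[OF tendsto_norm[OF y_lim[OF that]]]) (use Y_\<delta>[OF that] in auto)
  have y_zero: "y (0, q) = 0" if "q \<in> V" for q
  proof (rule LIMSEQ_unique[OF y_lim])
    show "(0, q) \<in> ?X" using that zero_in_polydisc[OF r] by simp
    show "(\<lambda>k. Y k (0, q)) \<longlonglongrightarrow> 0" using Y0[OF that] by simp
  qed
  have y_eq: "y (cwmult q t, q) = H t (y (t, q)) q" if t: "t \<in> polydisc r" and q: "q \<in> V" for t q
  proof -
    have p: "(t, q) \<in> ?X" "(cwmult q t, q) \<in> ?X"
      using t q cwmult_in_polydisc[OF V1[OF q] t] by auto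
    \<comment> \<open>The Lipschitz bound, valid for the limit as well because
      \<open>\<delta> < d\<close>, allows the passage to the limit inside \<open>H\<close>.\<close>
    have "(\<lambda>k. R (Y k) (t, q)) \<longlonglongrightarrow> R y (t, q)"
    proof (rule LIM_zero_cancel, rule Lim_null_comparison)
      have "norm (R (Y k) (t, q) - R y (t, q)) \<le> e * (\<delta> * (1 / 2) ^ k)" for k
      proof -
        have "norm (R (Y k) (t, q) - R y (t, q)) \<le> e * norm (Y k (t, q) - y (t, q))"
          using Y_\<delta>[OF p(1), of k] y_bound[OF p(1)] \<delta>(2) by (intro R_lip p) auto
        also have "\<dots> \<le> e * (\<delta> * (1 / 2) ^ k)"
          using e by (intro mult_left_mono y_le p) simp
        finally show ?thesis .
      qed
      then show "\<forall>\<^sub>F k in sequentially. norm (R (Y k) (t, q) - R y (t, q)) \<le> e * (\<delta> * (1 / 2) ^ k)"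
        by simp
      show "(\<lambda>k. e * (\<delta> * (1 / 2) ^ k)) \<longlonglongrightarrow> 0"
        by (intro tendsto_mult_right_zero half_lim)
    qed
    moreover have "(\<lambda>k. Y (Suc k) (cwmult q t, q) - ?D q *v Y (Suc k) (t, q)) \<longlonglongrightarrow>
        y (cwmult q t, q) - ?D q *v y (t, q)"
      unfolding matrix_vector_mult_def
      by (intro tendsto_intros tendsto_vec_lambda y_lim[THEN LIMSEQ_Suc] p)
    ultimately have "y (cwmult q t, q) - ?D q *v y (t, q) = R y (t, q)"
      unfolding Y_eq[OF t q] using LIMSEQ_unique by blast
    then show ?thesis by (simp add: R_def)
  qed
  show ?thesis
    by (rule that[OF r V VU V1 y_holo y_zero _ y_eq]) (auto intro: y_bound)
qed

text \<open>Existence is local in \<open>q\<close>: the radius, the neighbourhood and the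
  coefficients all vary with \<open>q0\<close>. Uniqueness at each single \<open>q\<close> forces
  the local families to agree on overlaps, so one global family inherits holomorphy and uniform
  convergence near every point.\<close>

theorem mainTheorem11:
  fixes U :: "(complex^'m) set"
    and H :: "complex^'m \<Rightarrow> complex^'n \<Rightarrow> complex^'m \<Rightarrow> complex^'n"
  assumes U_open: "open U"
    and U_sub: "\<forall>q\<in>U. \<forall>i. cmod (q $ i) < 1"
    and H_holo: "\<forall>q0\<in>U. holo3_at (\<lambda>(t, y, q). H t y q) (0, 0, q0)"
    and H_zero: "\<forall>q0\<in>U. H 0 0 q0 = 0"
    and nonres: "\<forall>q\<in>U. \<forall>c. cmat_eigenvalue (jac_y H q) c \<longrightarrow>
                   c \<noteq> 0 \<and> (\<forall>\<alpha>. \<alpha> \<noteq> (\<lambda>_. 0) \<longrightarrow> c \<noteq> mpow q \<alpha>)"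
  shows "\<exists>B :: complex^'m \<Rightarrow> 'n \<Rightarrow> ('m \<Rightarrow> nat) \<Rightarrow> complex.
           (\<forall>q\<in>U. is_solution H q (B q) \<and> (\<forall>b. is_solution H q b \<longrightarrow> b = B q)) \<and>
           (\<forall>q0\<in>U. \<exists>Z V. open Z \<and> (0::complex^'m) \<in> Z \<and> open V \<and> q0 \<in> V \<and> V \<subseteq> U \<and>
              (\<forall>j. uniform_limit (Z \<times> V)
                     (\<lambda>F (t, q). \<Sum>\<alpha>\<in>F. B q j \<alpha> * mpow t \<alpha>)
                     (\<lambda>(t, q). infsum (\<lambda>\<alpha>. B q j \<alpha> * mpow t \<alpha>) UNIV)
                     (finite_subsets_at_top UNIV)) \<and>
              holo2_on (\<lambda>(t, q). pseries (B q) t) (Z \<times> V))"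
proof -
  have holo: "\<exists>S. holo_on (\<lambda>(t, y, q). H t y q) S \<and> (0, 0, q) \<in> S" if "q \<in> U" for q
    using H_holo that holo3_on_imp_holo_on unfolding holo3_at_def by blast
  have unique: "b = b'" if q: "q \<in> U" and b: "is_solution H q b" "is_solution H q b'" for q b b'
  proof -
    obtain S where S: "holo_on (\<lambda>(t, y, q). H t y q) S" "(0, 0, q) \<in> S"
      using holo[OF q] by blast
    show ?thesis
      by (rule is_solution_unique[OF S _ _ b]) (use U_sub nonres q in auto)
  qed
  \<comment> \<open>The constant \<open>M\<close> is recorded together with the solution because
    uniform convergence needs coefficient bounds common to all \<open>q\<close> in
    \<open>V\<close>.\<close>
  have local: "\<exists>r V c y. r > 0 \<and> open V \<and> q0 \<in> V \<and> V \<subseteq> U \<and> holo_on y (polydisc r \<times> V) \<and>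
      (\<exists>M. \<forall>q\<in>V. \<forall>j \<alpha>. cmod (c q j \<alpha>) \<le> M / r ^ mdegree \<alpha>) \<and>
      (\<forall>q\<in>V. is_solution H q (c q) \<and> (\<forall>t\<in>polydisc r. pseries (c q) t = y (t, q)))"
    if q0: "q0 \<in> U" for q0
  proof -
    obtain S where S: "holo_on (\<lambda>(t, y, q). H t y q) S" "(0, 0, q0) \<in> S"
      using holo[OF q0] by blast
    have "H 0 0 q = 0" if "q \<in> U" for q using H_zero that by blast
    moreover have "cmod (q0 $ i) < 1" for i using U_sub q0 by blast
    moreover have "c \<noteq> 0 \<and> (\<forall>\<alpha>. \<alpha> \<noteq> (\<lambda>_. 0) \<longrightarrow> c \<noteq> mpow q0 \<alpha>)" if "cmat_eigenvalue (jac_y H q0) c" for c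
      using nonres q0 that by blast
    ultimately obtain r V y M where r: "r > 0" and V: "open V" "q0 \<in> V" "V \<subseteq> U"
      and V1: "\<And>q i. q \<in> V \<Longrightarrow> cmod (q $ i) < 1"
      and y: "holo_on y (polydisc r \<times> V)" "\<And>q. q \<in> V \<Longrightarrow> y (0, q) = 0"
      and M: "\<And>t q. t \<in> polydisc r \<Longrightarrow> q \<in> V \<Longrightarrow> norm (y (t, q)) \<le> M"
      and y_eq: "\<And>t q. t \<in> polydisc r \<Longrightarrow> q \<in> V \<Longrightarrow> y (cwmult q t, q) = H t (y (t, q)) q"
      by (rule local_holomorphic_solution[OF U_open q0 _ S]) blast+
    have "\<exists>c. (\<forall>\<alpha>. \<forall>q\<in>V. cmod (c \<alpha> q) \<le> M / r ^ mdegree \<alpha>) \<and>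
        (\<forall>t\<in>polydisc r. \<forall>q\<in>V. ((\<lambda>\<alpha>. c \<alpha> q * mpow t \<alpha>) has_sum y (t, q) $ j) UNIV)" for j
    proof -
      have "cmod (y (t, q) $ j) \<le> M" if "t \<in> polydisc r" "q \<in> V" for t q
        using order_trans[OF Finite_Cartesian_Product.norm_nth_le M[OF that]] .
      then show ?thesis
        by (rule taylor_expansion[OF holo_on_vec_nth[OF y(1), of j] r V(1)]) blast+
    qed
    then have "\<exists>c. \<forall>j. (\<forall>\<alpha>. \<forall>q\<in>V. cmod (c j \<alpha> q) \<le> M / r ^ mdegree \<alpha>) \<and>
        (\<forall>t\<in>polydisc r. \<forall>q\<in>V. ((\<lambda>\<alpha>. c j \<alpha> q * mpow t \<alpha>) has_sum y (t, q) $ j) UNIV)"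
      by (intro choice allI)
    then obtain c where c_bound: "\<And>j \<alpha> q. q \<in> V \<Longrightarrow> cmod (c j \<alpha> q) \<le> M / r ^ mdegree \<alpha>"
      and c_sum: "\<And>j t q. t \<in> polydisc r \<Longrightarrow> q \<in> V \<Longrightarrow> ((\<lambda>\<alpha>. c j \<alpha> q * mpow t \<alpha>) has_sum y (t, q) $ j) UNIV"
      by blast
    define b where "b q j \<alpha> = c j \<alpha> q" for q j \<alpha>
    have pseries_b: "pseries (b q) t = y (t, q)" if "t \<in> polydisc r" "q \<in> V" for t q
      using infsumI[OF c_sum[OF that]] by (simp add: pseries_def b_def vec_eq_iff)
    have "is_solution H q (b q)" if q: "q \<in> V" for q
      unfolding is_solution_def
    proof (intro conjI allI)
      show "b q j (\<lambda>_. 0) = 0" for j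
        using multi_series_at_zero[OF c_sum[OF zero_in_polydisc[OF r] q, of j]] y(2)[OF q] by (simp add: b_def)
      have ev: "\<forall>\<^sub>F t :: complex ^ 'm in nhds 0. t \<in> polydisc r"
        by (intro eventually_nhds_in_open open_polydisc zero_in_polydisc r)
      then show "\<forall>\<^sub>F t in nhds 0. \<forall>j. (\<lambda>\<alpha>. b q j \<alpha> * mpow t \<alpha>) summable_on UNIV"
      proof eventually_elim
        case (elim t)
        show ?case
          using has_sum_imp_summable[OF c_sum[OF elim q]] by (simp add: b_def)
      qed
      from ev show "\<forall>\<^sub>F t in nhds 0. pseries (b q) (cwmult q t) = H t (pseries (b q) t) q"
      proof eventually_elim
        case (elim t)
        then show ?case
          using pseries_b[OF elim q] pseries_b[OF cwmult_in_polydisc[OF V1[OF q] elim] q] y_eq[OF elim q]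
          by simp
      qed
    qed
    with r V y(1) pseries_b c_bound show ?thesis
      by (intro exI[of _ r] exI[of _ V] exI[of _ b] exI[of _ y] conjI exI[of _ M]) (auto simp: b_def)
  qed
  \<comment> \<open>A pointwise choice carries no regularity in \<open>q\<close> by itself;
    \<open>B_eq\<close> identifies it with the local coefficients throughout each
    \<open>V\<close>.\<close>
  define B where "B q = (SOME b. is_solution H q b)" for q
  have B_eq: "b = B q" if "q \<in> U" "is_solution H q b" for q b
  proof (rule unique[OF that])
    show "is_solution H q (B q)" unfolding B_def by (rule someI[of "is_solution H q" b, OF that(2)])
  qed
  have "is_solution H q (B q)" if q: "q \<in> U" for q
    using local[OF q] someI_ex[of "is_solution H q"] unfolding B_def by blast
  moreover have "\<exists>Z V. open Z \<and> (0::complex^'m) \<in> Z \<and> open V \<and> q0 \<in> V \<and> V \<subseteq> U \<and>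
              (\<forall>j. uniform_limit (Z \<times> V)
                     (\<lambda>F (t, q). \<Sum>\<alpha>\<in>F. B q j \<alpha> * mpow t \<alpha>)
                     (\<lambda>(t, q). infsum (\<lambda>\<alpha>. B q j \<alpha> * mpow t \<alpha>) UNIV)
                     (finite_subsets_at_top UNIV)) \<and>
              holo2_on (\<lambda>(t, q). pseries (B q) t) (Z \<times> V)"
    if q0: "q0 \<in> U" for q0
  proof -
    obtain r V c y M where r: "r > 0" and V: "open V" "q0 \<in> V" "V \<subseteq> U"
      and y: "holo_on y (polydisc r \<times> V)"
      and M: "\<forall>q\<in>V. \<forall>j \<alpha>. cmod (c q j \<alpha>) \<le> M / r ^ mdegree \<alpha>"
      and c: "\<forall>q\<in>V. is_solution H q (c q) \<and> (\<forall>t\<in>polydisc r. pseries (c q) t = y (t, q))"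
      using local[OF q0] by blast
    have cB: "c q = B q" if "q \<in> V" for q
      using B_eq c V(3) that by blast
    \<comment> \<open>The coefficient bounds refer to radius \<open>r\<close>, and the uniform
      convergence test asks for a strictly smaller one.\<close>
    let ?Z = "polydisc (r / 2) :: (complex ^ 'm) set"
    have ZV: "open (?Z \<times> V)" by (intro open_Times open_polydisc V)
    have Z: "t \<in> polydisc r" if "t \<in> ?Z" for t
      using r by (intro polydisc_mono[OF that]) simp
    have "uniform_limit (?Z \<times> V) (\<lambda>F (t, q). \<Sum>\<alpha>\<in>F. B q j \<alpha> * mpow t \<alpha>)
            (\<lambda>(t, q). infsum (\<lambda>\<alpha>. B q j \<alpha> * mpow t \<alpha>) UNIV) (finite_subsets_at_top UNIV)" for j
      by (rule uniform_limit_multi_series[where r = r and K = M]) (use r M cB in auto)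
    moreover have "holo_on (\<lambda>(t, q). pseries (B q) t) (?Z \<times> V)"
    proof -
      have "holo_on y (?Z \<times> V)"
        using Z by (intro holo_on_subset[OF y ZV]) auto
      also have "?this \<longleftrightarrow> ?thesis"
        using c Z cB by (intro holo_on_cong) auto
      finally show ?thesis .
    qed
    ultimately show ?thesis
      using V zero_in_polydisc[of "r / 2"] r open_polydisc
      by (intro exI[of _ ?Z] exI[of _ V] conjI allI holo_on_imp_holo2_on) auto
  qed
  ultimately show ?thesis
    using B_eq by (intro exI[of _ B]) blast
qed

end
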